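(* Let $M$ be a smooth $n$-manifold and $\nabla$ a flat connection on a rank $n$ real vector bundle $V$ over $M$. Then a $\nabla$-semi-flat generalized complex structure $\mathcal{J}=F^{-1}(\pi^*\underline{\mathcal{J}})F$ on the total space of $V$ induces a pair of transverse Dirac structures on $M$, namely $$\Delta=\underline{\mathcal{J}}(V),\qquad\widehat\Delta=\underline{\mathcal{J}}(V^\vee),\qquad \Delta\oplus\widehat\Delta=T_M\oplus T_M^\vee.$$ These Dirac structures inherit flat connections (transported from $\nabla$ on $V$ and $\nabla^\vee$ on $V^\vee$ via the isomorphisms $\underline{\mathcal{J}}:V\to\Delta$ and $\underline{\mathcal{J}}:V^\vee\to\widehat\Delta$).
   Context: On $W\oplus W^\vee$ ($W$ a real vector bundle) use the pairing $\langle v+f,w+g\rangle=-\tfrac12(f(w)+g(v))$. A generalized almost complex structure on $W$ is an automorphism $\mathcal{J}$ of $W\oplus W^\vee$ which is orthogonal for this pairing and satisfies $\mathcal{J}^2=-1$. A generalized almost complex structure on a manifold $N$ is one on $W=T_N$. The Courant bracket is $[X+\xi,Y+\eta]=[X,Y]+\mathcal{L}_X\eta-\mathcal{L}_Y\xi+\tfrac12 d(\iota_Y\xi-\iota_X\eta)$. A generalized almost complex structure on $N$ is integrable (a generalized complex structure) if the sheaf of sections of its $(+i)$-eigenbundle in $(T_N\oplus T_N^\vee)\otimes\mathbb{C}$ is closed under the ($\mathbb{C}$-bilinearly extended) Courant bracket. An almost Dirac structure on $M$ is a maximally isotropic sub-bundle of $T_M\oplus T_M^\vee$; it is a Dirac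 structure if its sections are closed under the Courant bracket. Let $\pi:X=\mathrm{tot}(V)\to M$, and let $0\to\pi^*V\xrightarrow{j}T_X\xrightarrow{d\pi}\pi^*T_M\to0$ be the tangent sequence. A connection $\nabla$ on $V$ gives a splitting: if $S$ is the tautological section of $\pi^*V$, then $D=(\pi^*\nabla)(S):T_X\to\pi^*V$ satisfies $D\circ j=1$; let $\alpha:\pi^*T_M\to T_X$ be the corresponding map with $d\pi\circ\alpha=1$, $D\circ\alpha=0$. Set $$F:T_X\oplus T_X^\vee\to\pi^*V\oplus\pi^*T_M\oplus\pi^*V^\vee\oplus\pi^*T_M^\vee,\quad F(w+\xi)=(Dw,\ d\pi\,w,\ j^\vee\xi,\ \alpha^\vee\xi),$$ an isomorphism. When $\mathrm{rank}\,V=\dim M$ and $\nabla$ is flat, a $\nabla$-semi-flat generalized almost complex structure on $X$ is one of the form $\mathcal{J}=F^{-1}(\pi^*\underline{\mathcal{J}})F$ with $\underline{\mathcal{J}}$ a generalized almost complex structure on $V\oplus T_M$ that is adapted: $\underline{\mathcal{J}}(V\oplus V^\vee)=T_M\oplus T_M^\vee$. It is a $\nabla$-semi-flat generalized complex structure if in addition it is integrable. *)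

theory Defs
  imports "HOL-Analysis.Analysis"
begin

section \<open>Smooth maps and manifolds\<close>

text \<open>On an open subset of a finite-dimensional space, \<open>smooth_on\<close> is $C^\infty$: all iterated
  directional derivatives exist as Frechet derivatives and are continuous.\<close>

primrec Ck_on :: "nat \<Rightarrow> 'a::real_normed_vector set \<Rightarrow> ('a \<Rightarrow> 'b::real_normed_vector) \<Rightarrow> bool" where
  "Ck_on 0 S f \<longleftrightarrow> continuous_on S f"
| "Ck_on (Suc k) S f \<longleftrightarrow>
     (\<forall>x\<in>S. f differentiable (at x)) \<and> (\<forall>v. Ck_on k S (\<lambda>x. frechet_derivative f (at x) v))"

definition smooth_on :: "'a::real_normed_vector set \<Rightarrow> ('a \<Rightarrow> 'b::real_normed_vector) \<Rightarrow> bool" where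
  "smooth_on S f \<longleftrightarrow> (\<forall>k. Ck_on k S f)"

text \<open>A manifold modelled on \<open>'e\<close> is given by an atlas: a set of pairs (domain, coordinate map).
  Its points are the union of the chart domains, and its topology is the one induced by the
  charts. The atlas need not be maximal.\<close>

type_synonym ('p, 'e) chart = "'p set \<times> ('p \<Rightarrow> 'e)"

definition points :: "('p, 'e) chart set \<Rightarrow> 'p set" where
  "points A = (\<Union>c\<in>A. fst c)"

definition chart_inv :: "('p, 'e) chart \<Rightarrow> 'e \<Rightarrow> 'p" where
  "chart_inv c = inv_into (fst c) (snd c)"

definition man_topology :: "('p, 'e::real_normed_vector) chart set \<Rightarrow> 'p topology" where
  "man_topology A = topology (\<lambda>S. S \<subseteq> points A \<and> (\<forall>c\<in>A. open (snd c ` (S \<inter> fst c))))"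

definition smooth_manifold :: "('p, 'e::euclidean_space) chart set \<Rightarrow> bool" where
  "smooth_manifold A \<longleftrightarrow>
     (\<forall>c\<in>A. inj_on (snd c) (fst c) \<and> open (snd c ` fst c)) \<and>
     (\<forall>c\<in>A. \<forall>d\<in>A. open (snd c ` (fst c \<inter> fst d)) \<and>
        smooth_on (snd c ` (fst c \<inter> fst d)) (snd d \<circ> chart_inv c)) \<and>
     Hausdorff_space (man_topology A) \<and> second_countable (man_topology A)"

definition smooth_fun :: "('p, 'e::euclidean_space) chart set \<Rightarrow> 'p set \<Rightarrow> ('p \<Rightarrow> real) \<Rightarrow> bool" where
  "smooth_fun A U f \<longleftrightarrow> (\<forall>c\<in>A. smooth_on (snd c ` (U \<inter> fst c)) (f \<circ> chart_inv c))"

definition chart_at :: "('p, 'e) chart set \<Rightarrow> 'p \<Rightarrow> ('p, 'e) chart" where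
  "chart_at A p = (SOME c. c \<in> A \<and> p \<in> fst c)"


section \<open>Vector bundles\<close>

text \<open>Each fibre of a vector bundle is taken to be a copy of a fixed finite-dimensional vector
  space \<open>'v\<close>; this only chooses an (arbitrary, pointwise, in general discontinuous) basis
  of every fibre. The topology and smooth structure are carried entirely by the local
  trivialisations: a trivialisation over \<open>U\<close> is a family of linear isomorphisms
  \<open>t x\<close> from the fibre at \<open>x\<close> to the model fibre, \<open>x \<in> U\<close>. Nontrivial bundles are thus
  included, and \<open>'p \<times> 'v\<close> is the set of points of the total space but does not carry
  the product smooth structure.\<close>

type_synonym ('p, 'v) triv = "'p set \<times> ('p \<Rightarrow> 'v \<Rightarrow> 'v)"

definition local_rep ::
  "('p, 'e) chart \<Rightarrow> ('p \<Rightarrow> 'v \<Rightarrow> 'w) \<Rightarrow> ('p \<Rightarrow> 'v) \<Rightarrow> 'e \<Rightarrow> 'w" where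
  "local_rep c t s = (\<lambda>u. t (chart_inv c u) (s (chart_inv c u)))"

definition smooth_section ::
  "('p, 'e::euclidean_space) chart set \<Rightarrow> ('p, 'v::real_normed_vector) triv set \<Rightarrow>
   'p set \<Rightarrow> ('p \<Rightarrow> 'v) \<Rightarrow> bool" where
  "smooth_section A B U s \<longleftrightarrow>
     (\<forall>c\<in>A. \<forall>(U', t)\<in>B. smooth_on (snd c ` (U \<inter> U' \<inter> fst c)) (local_rep c t s))"

text \<open>Smoothness of the transition maps is expressed by saying that the local frames
  \<open>x \<mapsto> (t x)\<^sup>-\<^sup>1 w\<close> of each trivialisation are smooth in every other trivialisation.\<close>

definition vector_bundle ::
  "('p, 'e::euclidean_space) chart set \<Rightarrow> ('p, 'v::euclidean_space) triv set \<Rightarrow> bool" where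
  "vector_bundle A B \<longleftrightarrow>
     (\<Union>b\<in>B. fst b) = points A \<and>
     (\<forall>(U, t)\<in>B. openin (man_topology A) U \<and>
        (\<forall>x\<in>U. linear (t x) \<and> bij (t x)) \<and>
        (\<forall>w. smooth_section A B U (\<lambda>x. inv (t x) w)))"

definition triv_at :: "('p, 'v) triv set \<Rightarrow> 'p \<Rightarrow> 'p \<Rightarrow> 'v \<Rightarrow> 'v" where
  "triv_at B p = snd (SOME b. b \<in> B \<and> p \<in> fst b)"

definition dual_triv ::
  "('p \<Rightarrow> 'v \<Rightarrow> 'v) \<Rightarrow> 'p \<Rightarrow> ('v::real_normed_vector \<Rightarrow>\<^sub>L real) \<Rightarrow> ('v \<Rightarrow>\<^sub>L real)" where
  "dual_triv t = (\<lambda>x f. f o\<^sub>L Blinfun (inv (t x)))"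

definition dual_bundle ::
  "('p, 'v::real_normed_vector) triv set \<Rightarrow> ('p, 'v \<Rightarrow>\<^sub>L real) triv set" where
  "dual_bundle B = (\<lambda>(U, t). (U, dual_triv t)) ` B"

definition sum_bundle :: "('p, 'v) triv set \<Rightarrow> ('p, 'w) triv set \<Rightarrow> ('p, 'v \<times> 'w) triv set" where
  "sum_bundle B C = (\<lambda>((U, t), (U', t')). (U \<inter> U', \<lambda>x (v, w). (t x v, t' x w))) ` (B \<times> C)"

definition smooth_hom ::
  "('p, 'e::euclidean_space) chart set \<Rightarrow> ('p, 'v::real_normed_vector) triv set \<Rightarrow>
   ('p, 'w::real_normed_vector) triv set \<Rightarrow> ('p \<Rightarrow> 'v \<Rightarrow> 'w) \<Rightarrow> bool" where
  "smooth_hom A B C \<Phi> \<longleftrightarrow>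
     (\<forall>p\<in>points A. linear (\<Phi> p)) \<and>
     (\<forall>(U, t)\<in>B. \<forall>w. smooth_section A C U (\<lambda>x. \<Phi> x (inv (t x) w)))"

definition subbundle ::
  "('p, 'e::euclidean_space) chart set \<Rightarrow> ('p, 'v::real_normed_vector) triv set \<Rightarrow>
   ('p \<Rightarrow> 'v set) \<Rightarrow> bool" where
  "subbundle A B E \<longleftrightarrow>
     (\<forall>p\<in>points A. \<exists>U k s. openin (man_topology A) U \<and> p \<in> U \<and>
        (\<forall>i<k::nat. smooth_section A B U (s i)) \<and>
        (\<forall>q\<in>U. inj_on (\<lambda>i. s i q) {..<k} \<and> independent ((\<lambda>i. s i q) ` {..<k}) \<and>
                span ((\<lambda>i. s i q) ` {..<k}) = E q))"

definition section_of ::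
  "('p, 'e::euclidean_space) chart set \<Rightarrow> ('p, 'v::real_normed_vector) triv set \<Rightarrow>
   ('p \<Rightarrow> 'v set) \<Rightarrow> 'p set \<Rightarrow> ('p \<Rightarrow> 'v) \<Rightarrow> bool" where
  "section_of A B E U s \<longleftrightarrow> smooth_section A B U s \<and> (\<forall>p\<in>U. s p \<in> E p)"

text \<open>An isomorphism of the bundle \<open>B\<close> onto the sub-bundle \<open>E\<close> of \<open>C\<close>.\<close>

definition bundle_iso_onto ::
  "('p, 'e::euclidean_space) chart set \<Rightarrow> ('p, 'v::real_normed_vector) triv set \<Rightarrow>
   ('p, 'w::real_normed_vector) triv set \<Rightarrow> ('p \<Rightarrow> 'w set) \<Rightarrow> ('p \<Rightarrow> 'v \<Rightarrow> 'w) \<Rightarrow> bool" where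
  "bundle_iso_onto A B C E \<Phi> \<longleftrightarrow>
     smooth_hom A B C \<Phi> \<and> (\<forall>p\<in>points A. bij_betw (\<Phi> p) UNIV (E p))"


section \<open>Tangent bundle and calculus on a manifold\<close>

text \<open>The tangent space at \<open>p\<close> is identified with the model space through \<open>chart_at A p\<close>.
  A chart \<open>c\<close> gives a trivialisation of the tangent bundle by the differential of the
  coordinate change from \<open>chart_at A q\<close> to \<open>c\<close>.\<close>

definition tcoord :: "('p, 'e::euclidean_space) chart set \<Rightarrow> ('p, 'e) chart \<Rightarrow> 'p \<Rightarrow> 'e \<Rightarrow> 'e" where
  "tcoord A c q =
     frechet_derivative (snd c \<circ> chart_inv (chart_at A q)) (at (snd (chart_at A q) q))"

definition tangent_bundle :: "('p, 'e::euclidean_space) chart set \<Rightarrow> ('p, 'e) triv set" where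
  "tangent_bundle A = (\<lambda>c. (fst c, tcoord A c)) ` A"

text \<open>Differential of a map between manifolds, and of a real function.\<close>

definition tdiff ::
  "('p, 'e::euclidean_space) chart set \<Rightarrow> ('q, 'd::euclidean_space) chart set \<Rightarrow> ('p \<Rightarrow> 'q) \<Rightarrow>
   'p \<Rightarrow> 'e \<Rightarrow> 'd" where
  "tdiff A A' f p =
     frechet_derivative (snd (chart_at A' (f p)) \<circ> f \<circ> chart_inv (chart_at A p))
       (at (snd (chart_at A p) p))"

definition dfun ::
  "('p, 'e::euclidean_space) chart set \<Rightarrow> ('p \<Rightarrow> real) \<Rightarrow> 'p \<Rightarrow> 'e \<Rightarrow>\<^sub>L real" where
  "dfun A f p =
     Blinfun (frechet_derivative (f \<circ> chart_inv (chart_at A p)) (at (snd (chart_at A p) p)))"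

text \<open>Lie bracket and Lie derivative of a 1-form, computed at \<open>p\<close> in \<open>chart_at A p\<close>
  (in which the tangent coordinates at \<open>p\<close> are the identity):
  $[X,Y] = DY(X) - DX(Y)$ and $(\mathcal L_X\eta)(Z) = (D\eta(X))(Z) + \eta(DX(Z))$.\<close>

definition vf_rep ::
  "('p, 'e::euclidean_space) chart set \<Rightarrow> 'p \<Rightarrow> ('p \<Rightarrow> 'e) \<Rightarrow> 'e \<Rightarrow> 'e" where
  "vf_rep A p X = local_rep (chart_at A p) (tcoord A (chart_at A p)) X"

definition form_rep ::
  "('p, 'e::euclidean_space) chart set \<Rightarrow> 'p \<Rightarrow> ('p \<Rightarrow> 'e \<Rightarrow>\<^sub>L real) \<Rightarrow> 'e \<Rightarrow> 'e \<Rightarrow>\<^sub>L real" where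
  "form_rep A p \<eta> = local_rep (chart_at A p) (dual_triv (tcoord A (chart_at A p))) \<eta>"

definition lie_bracket ::
  "('p, 'e::euclidean_space) chart set \<Rightarrow> ('p \<Rightarrow> 'e) \<Rightarrow> ('p \<Rightarrow> 'e) \<Rightarrow> 'p \<Rightarrow> 'e" where
  "lie_bracket A X Y p =
     (let u = snd (chart_at A p) p in
        frechet_derivative (vf_rep A p Y) (at u) (X p) -
        frechet_derivative (vf_rep A p X) (at u) (Y p))"

definition lie_deriv_form ::
  "('p, 'e::euclidean_space) chart set \<Rightarrow> ('p \<Rightarrow> 'e) \<Rightarrow> ('p \<Rightarrow> 'e \<Rightarrow>\<^sub>L real) \<Rightarrow> 'p \<Rightarrow> 'e \<Rightarrow>\<^sub>L real"
  where
  "lie_deriv_form A X \<eta> p =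
     (let u = snd (chart_at A p) p in
        frechet_derivative (form_rep A p \<eta>) (at u) (X p) +
        (\<eta> p o\<^sub>L Blinfun (frechet_derivative (vf_rep A p X) (at u))))"

definition vector_field ::
  "('p, 'e::euclidean_space) chart set \<Rightarrow> 'p set \<Rightarrow> ('p \<Rightarrow> 'e) \<Rightarrow> bool" where
  "vector_field A U X \<longleftrightarrow> smooth_section A (tangent_bundle A) U X"


section \<open>Connections\<close>

text \<open>A connection on a sub-bundle \<open>E\<close> of \<open>B\<close> (on \<open>B\<close> itself when \<open>E = (\<lambda>_. UNIV)\<close>), as an operator
  on the sheaf of local sections: \<open>nab s p X\<close> is $(\nabla_X s)(p)$ for a tangent vector \<open>X\<close> at \<open>p\<close>.
  Sections over \<open>U\<close> are represented by total functions whose values outside \<open>U\<close> are irrelevant,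
  which is what the locality clause says.\<close>

type_synonym ('p, 'e, 'v) conn = "('p \<Rightarrow> 'v) \<Rightarrow> 'p \<Rightarrow> 'e \<Rightarrow> 'v"

definition connection ::
  "('p, 'e::euclidean_space) chart set \<Rightarrow> ('p, 'v::real_normed_vector) triv set \<Rightarrow>
   ('p \<Rightarrow> 'v set) \<Rightarrow> ('p, 'e, 'v) conn \<Rightarrow> bool" where
  "connection A B E nab \<longleftrightarrow>
     (\<forall>U. openin (man_topology A) U \<longrightarrow>
       (\<forall>s. section_of A B E U s \<longrightarrow>
          (\<forall>p\<in>U. linear (nab s p)) \<and>
          (\<forall>X. vector_field A U X \<longrightarrow> section_of A B E U (\<lambda>p. nab s p (X p)))) \<and>
       (\<forall>s s'. section_of A B E U s \<and> section_of A B E U s' \<and> (\<forall>p\<in>U. s p = s' p) \<longrightarrow>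
          (\<forall>p\<in>U. nab s p = nab s' p)) \<and>
       (\<forall>s s'. section_of A B E U s \<and> section_of A B E U s' \<longrightarrow>
          (\<forall>p\<in>U. \<forall>X. nab (\<lambda>q. s q + s' q) p X = nab s p X + nab s' p X)) \<and>
       (\<forall>f s. smooth_fun A U f \<and> section_of A B E U s \<longrightarrow>
          (\<forall>p\<in>U. \<forall>X. nab (\<lambda>q. f q *\<^sub>R s q) p X = dfun A f p X *\<^sub>R s p + f p *\<^sub>R nab s p X)))"

definition flat ::
  "('p, 'e::euclidean_space) chart set \<Rightarrow> ('p, 'v::real_normed_vector) triv set \<Rightarrow>
   ('p \<Rightarrow> 'v set) \<Rightarrow> ('p, 'e, 'v) conn \<Rightarrow> bool" where
  "flat A B E nab \<longleftrightarrow>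
     (\<forall>U X Y s. openin (man_topology A) U \<and> vector_field A U X \<and> vector_field A U Y \<and>
        section_of A B E U s \<longrightarrow>
        (\<forall>p\<in>U. nab (\<lambda>q. nab s q (Y q)) p (X p) - nab (\<lambda>q. nab s q (X q)) p (Y p)
                - nab s p (lie_bracket A X Y p) = 0))"

definition flat_connection ::
  "('p, 'e::euclidean_space) chart set \<Rightarrow> ('p, 'v::real_normed_vector) triv set \<Rightarrow>
   ('p \<Rightarrow> 'v set) \<Rightarrow> ('p, 'e, 'v) conn \<Rightarrow> bool" where
  "flat_connection A B E nab \<longleftrightarrow> connection A B E nab \<and> flat A B E nab"

text \<open>The dual connection, $(\nabla^\vee_X f)(v) = X(f(s)) - f(\nabla_X s)$, where \<open>s\<close> is the section through
  \<open>v\<close> that is constant in the trivialisation at \<open>p\<close>.\<close>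

definition dual_conn ::
  "('p, 'e::euclidean_space) chart set \<Rightarrow> ('p, 'v::euclidean_space) triv set \<Rightarrow>
   ('p, 'e, 'v) conn \<Rightarrow> ('p, 'e, 'v \<Rightarrow>\<^sub>L real) conn" where
  "dual_conn A B nab f p X =
     Blinfun (\<lambda>v. let s = (\<lambda>x. inv (triv_at B p x) (triv_at B p p v)) in
                    dfun A (\<lambda>x. f x (s x)) p X - f p (nab s p X))"

text \<open>The pullback connection $(f^*\nabla)_w\,\sigma$ at \<open>q\<close>, for a section \<open>\<sigma>\<close> of $f^*B$ (so that
  \<open>\<sigma> q\<close> lies in the fibre of \<open>B\<close> at \<open>f q\<close>). With the local frame \<open>e\<^sub>b\<close> of \<open>B\<close> of the trivialisation
  at \<open>f q\<close> and $\sigma = \sum_b \sigma^b\, f^* e_b$, it is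
  $\sum_b d\sigma^b(w)\, e_b + \sigma^b\, \nabla_{df(w)} e_b$.\<close>

definition pullback_conn ::
  "('q, 'd::euclidean_space) chart set \<Rightarrow> ('p, 'e::euclidean_space) chart set \<Rightarrow>
   ('p, 'v::euclidean_space) triv set \<Rightarrow> ('p, 'e, 'v) conn \<Rightarrow> ('q \<Rightarrow> 'p) \<Rightarrow> ('q, 'd, 'v) conn"
  where
  "pullback_conn X A B nab f \<sigma> q w =
     (let t = triv_at B (f q); e = (\<lambda>b x. inv (t x) b); \<sigma>c = (\<lambda>b q'. t (f q') (\<sigma> q') \<bullet> b) in
        \<Sum>b\<in>Basis. dfun X (\<sigma>c b) q w *\<^sub>R e b (f q) + \<sigma>c b q *\<^sub>R nab (e b) (f q) (tdiff X A f q w))"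

text \<open>Transport of a connection on \<open>B\<close> along a bundle isomorphism \<open>\<Phi>\<close> from \<open>B\<close> onto a
  sub-bundle of another bundle.\<close>

definition transport_conn :: "('p \<Rightarrow> 'v \<Rightarrow> 'w) \<Rightarrow> ('p, 'e, 'v) conn \<Rightarrow> ('p, 'e, 'w) conn" where
  "transport_conn \<Phi> nab \<delta> p X = \<Phi> p (nab (\<lambda>q. inv (\<Phi> q) (\<delta> q)) p X)"


section \<open>Generalized complex and Dirac structures\<close>

abbreviation gen_bundle :: "('p, 'w::real_normed_vector) triv set \<Rightarrow> ('p, 'w \<times> ('w \<Rightarrow>\<^sub>L real)) triv set"
  where "gen_bundle W \<equiv> sum_bundle W (dual_bundle W)"

definition pairing :: "'w::real_normed_vector \<times> ('w \<Rightarrow>\<^sub>L real) \<Rightarrow> 'w \<times> ('w \<Rightarrow>\<^sub>L real) \<Rightarrow> real" where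
  "pairing a b = - (1/2) * (snd a (fst b) + snd b (fst a))"

definition gen_almost_complex ::
  "('p, 'e::euclidean_space) chart set \<Rightarrow> ('p, 'w::euclidean_space) triv set \<Rightarrow>
   ('p \<Rightarrow> 'w \<times> ('w \<Rightarrow>\<^sub>L real) \<Rightarrow> 'w \<times> ('w \<Rightarrow>\<^sub>L real)) \<Rightarrow> bool" where
  "gen_almost_complex A W J \<longleftrightarrow>
     smooth_hom A (gen_bundle W) (gen_bundle W) J \<and>
     (\<forall>p\<in>points A. (\<forall>a b. pairing (J p a) (J p b) = pairing a b) \<and> (\<forall>a. J p (J p a) = - a))"

definition courant ::
  "('p, 'e::euclidean_space) chart set \<Rightarrow> ('p \<Rightarrow> 'e \<times> ('e \<Rightarrow>\<^sub>L real)) \<Rightarrow>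
   ('p \<Rightarrow> 'e \<times> ('e \<Rightarrow>\<^sub>L real)) \<Rightarrow> 'p \<Rightarrow> 'e \<times> ('e \<Rightarrow>\<^sub>L real)" where
  "courant A a b p =
     (let X = (\<lambda>q. fst (a q)); \<xi> = (\<lambda>q. snd (a q)); Y = (\<lambda>q. fst (b q)); \<eta> = (\<lambda>q. snd (b q)) in
        (lie_bracket A X Y p,
         lie_deriv_form A X \<eta> p - lie_deriv_form A Y \<xi> p
           + (1/2) *\<^sub>R dfun A (\<lambda>q. \<xi> q (Y q) - \<eta> q (X q)) p))"

text \<open>An element $a + ib$ of the complexification of a real vector space is the pair \<open>(a, b)\<close>;
  likewise for bundles. Multiplication by $i$ is \<open>(a, b) \<mapsto> (-b, a)\<close>.\<close>

definition courant_cplx ::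
  "('p, 'e::euclidean_space) chart set \<Rightarrow>
   ('p \<Rightarrow> ('e \<times> ('e \<Rightarrow>\<^sub>L real)) \<times> ('e \<times> ('e \<Rightarrow>\<^sub>L real))) \<Rightarrow>
   ('p \<Rightarrow> ('e \<times> ('e \<Rightarrow>\<^sub>L real)) \<times> ('e \<times> ('e \<Rightarrow>\<^sub>L real))) \<Rightarrow>
   'p \<Rightarrow> ('e \<times> ('e \<Rightarrow>\<^sub>L real)) \<times> ('e \<times> ('e \<Rightarrow>\<^sub>L real))" where
  "courant_cplx A z w p =
     (let a = fst \<circ> z; b = snd \<circ> z; c = fst \<circ> w; d = snd \<circ> w in
        (courant A a c p - courant A b d p, courant A a d p + courant A b c p))"

definition plus_i_eigenbundle :: "('p \<Rightarrow> 'g \<Rightarrow> 'g::real_vector) \<Rightarrow> 'p \<Rightarrow> ('g \<times> 'g) set" where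
  "plus_i_eigenbundle J p = {(a, b). (J p a, J p b) = (- b, a)}"

definition integrable_gac ::
  "('p, 'e::euclidean_space) chart set \<Rightarrow>
   ('p \<Rightarrow> 'e \<times> ('e \<Rightarrow>\<^sub>L real) \<Rightarrow> 'e \<times> ('e \<Rightarrow>\<^sub>L real)) \<Rightarrow> bool" where
  "integrable_gac N J \<longleftrightarrow>
     (let G = gen_bundle (tangent_bundle N); L = plus_i_eigenbundle J in
      \<forall>U z w. openin (man_topology N) U \<and>
        section_of N (sum_bundle G G) L U z \<and> section_of N (sum_bundle G G) L U w \<longrightarrow>
        section_of N (sum_bundle G G) L U (courant_cplx N z w))"

definition isotropic :: "('w::real_normed_vector \<times> ('w \<Rightarrow>\<^sub>L real)) set \<Rightarrow> bool" where
  "isotropic S \<longleftrightarrow> subspace S \<and> (\<forall>a\<in>S. \<forall>b\<in>S. pairing a b = 0)"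

definition maximally_isotropic :: "('w::real_normed_vector \<times> ('w \<Rightarrow>\<^sub>L real)) set \<Rightarrow> bool" where
  "maximally_isotropic S \<longleftrightarrow> isotropic S \<and> (\<forall>T. isotropic T \<and> S \<subseteq> T \<longrightarrow> T = S)"

definition almost_dirac ::
  "('p, 'e::euclidean_space) chart set \<Rightarrow> ('p \<Rightarrow> ('e \<times> ('e \<Rightarrow>\<^sub>L real)) set) \<Rightarrow> bool" where
  "almost_dirac A E \<longleftrightarrow>
     subbundle A (gen_bundle (tangent_bundle A)) E \<and> (\<forall>p\<in>points A. maximally_isotropic (E p))"

text \<open>Sections over arbitrary open sets are considered, in particular global ones.\<close>

definition dirac ::
  "('p, 'e::euclidean_space) chart set \<Rightarrow> ('p \<Rightarrow> ('e \<times> ('e \<Rightarrow>\<^sub>L real)) set) \<Rightarrow> bool" where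
  "dirac A E \<longleftrightarrow> almost_dirac A E \<and>
     (let G = gen_bundle (tangent_bundle A) in
      \<forall>U a b. openin (man_topology A) U \<and> section_of A G E U a \<and> section_of A G E U b \<longrightarrow>
        section_of A G E U (courant A a b))"


section \<open>Semi-flat structures on the total space\<close>

definition total_space ::
  "('m, 'e) chart set \<Rightarrow> ('m, 'v) triv set \<Rightarrow> ('m \<times> 'v, 'e \<times> 'v) chart set" where
  "total_space M V = (\<lambda>((U, \<phi>), (U', t)). ((U \<inter> U') \<times> UNIV, \<lambda>(x, v). (\<phi> x, t x v))) ` (M \<times> V)"

text \<open>The inclusion \<open>j\<close> of the vertical bundle: the differential at \<open>v\<close> of the inclusion of the
  fibre at \<open>x\<close> into the total space, \<open>q = (x, v)\<close>.\<close>

definition vert ::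
  "('m, 'e::euclidean_space) chart set \<Rightarrow> ('m, 'v::euclidean_space) triv set \<Rightarrow>
   'm \<times> 'v \<Rightarrow> 'v \<Rightarrow> 'e \<times> 'v" where
  "vert M V q =
     frechet_derivative (\<lambda>s. snd (chart_at (total_space M V) q) (fst q, s)) (at (snd q))"

definition dproj ::
  "('m, 'e::euclidean_space) chart set \<Rightarrow> ('m, 'v::euclidean_space) triv set \<Rightarrow>
   'm \<times> 'v \<Rightarrow> 'e \<times> 'v \<Rightarrow> 'e" where
  "dproj M V q = tdiff (total_space M V) M fst q"

text \<open>$D = (\pi^*\nabla)(S)$; the projection $\pi$ is \<open>fst\<close> and the tautological section $S$ is \<open>snd\<close>.\<close>

definition vproj ::
  "('m, 'e::euclidean_space) chart set \<Rightarrow> ('m, 'v::euclidean_space) triv set \<Rightarrow>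
   ('m, 'e, 'v) conn \<Rightarrow> 'm \<times> 'v \<Rightarrow> 'e \<times> 'v \<Rightarrow> 'v" where
  "vproj M V nab q = pullback_conn (total_space M V) M V nab fst snd q"

definition hlift ::
  "('m, 'e::euclidean_space) chart set \<Rightarrow> ('m, 'v::euclidean_space) triv set \<Rightarrow>
   ('m, 'e, 'v) conn \<Rightarrow> 'm \<times> 'v \<Rightarrow> 'e \<Rightarrow> 'e \<times> 'v" where
  "hlift M V nab q Y = (THE w. dproj M V q w = Y \<and> vproj M V nab q w = 0)"

text \<open>The fibre of $(V\oplus T_M)\oplus(V\oplus T_M)^\vee$ is \<open>('v \<times> 'e) \<times> (('v \<times> 'e) \<Rightarrow>\<^sub>L real)\<close>; a pair
  $(f,\xi)\in V^\vee\oplus T_M^\vee$ is the functional $(v,X)\mapsto f(v)+\xi(X)$.\<close>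

definition Fmap ::
  "('m, 'e::euclidean_space) chart set \<Rightarrow> ('m, 'v::euclidean_space) triv set \<Rightarrow>
   ('m, 'e, 'v) conn \<Rightarrow> 'm \<times> 'v \<Rightarrow>
   ('e \<times> 'v) \<times> (('e \<times> 'v) \<Rightarrow>\<^sub>L real) \<Rightarrow> ('v \<times> 'e) \<times> (('v \<times> 'e) \<Rightarrow>\<^sub>L real)" where
  "Fmap M V nab q = (\<lambda>(w, \<xi>).
     ((vproj M V nab q w, dproj M V q w),
      ((\<xi> o\<^sub>L Blinfun (vert M V q)) o\<^sub>L fst_blinfun) +
      ((\<xi> o\<^sub>L Blinfun (hlift M V nab q)) o\<^sub>L snd_blinfun)))"

definition incl_V :: "'v::real_normed_vector \<Rightarrow> ('v \<times> 'e::real_normed_vector) \<times> (('v \<times> 'e) \<Rightarrow>\<^sub>L real)"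
  where "incl_V v = ((v, 0), 0)"

definition incl_Vdual ::
  "('v::real_normed_vector \<Rightarrow>\<^sub>L real) \<Rightarrow> ('v \<times> 'e::real_normed_vector) \<times> (('v \<times> 'e) \<Rightarrow>\<^sub>L real)"
  where "incl_Vdual f = ((0, 0), f o\<^sub>L fst_blinfun)"

definition incl_T ::
  "'e::real_normed_vector \<times> ('e \<Rightarrow>\<^sub>L real) \<Rightarrow> ('v::real_normed_vector \<times> 'e) \<times> (('v \<times> 'e) \<Rightarrow>\<^sub>L real)"
  where "incl_T = (\<lambda>(X, \<xi>). ((0, X), \<xi> o\<^sub>L snd_blinfun))"

definition adapted ::
  "('m, 'e::euclidean_space) chart set \<Rightarrow>
   ('m \<Rightarrow> ('v::euclidean_space \<times> 'e) \<times> (('v \<times> 'e) \<Rightarrow>\<^sub>L real) \<Rightarrow> ('v \<times> 'e) \<times> (('v \<times> 'e) \<Rightarrow>\<^sub>L real)) \<Rightarrow> bool"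
  where
  "adapted M J \<longleftrightarrow>
     (\<forall>p\<in>points M. J p ` {incl_V v + incl_Vdual f |v f. True} = range incl_T)"

definition semi_flat_gac ::
  "('m, 'e::euclidean_space) chart set \<Rightarrow> ('m, 'v::euclidean_space) triv set \<Rightarrow> ('m, 'e, 'v) conn \<Rightarrow>
   ('m \<Rightarrow> ('v \<times> 'e) \<times> (('v \<times> 'e) \<Rightarrow>\<^sub>L real) \<Rightarrow> ('v \<times> 'e) \<times> (('v \<times> 'e) \<Rightarrow>\<^sub>L real)) \<Rightarrow>
   ('m \<times> 'v \<Rightarrow> ('e \<times> 'v) \<times> (('e \<times> 'v) \<Rightarrow>\<^sub>L real) \<Rightarrow> ('e \<times> 'v) \<times> (('e \<times> 'v) \<Rightarrow>\<^sub>L real)) \<Rightarrow> bool"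
  where
  "semi_flat_gac M V nab J \<J> \<longleftrightarrow>
     gen_almost_complex M (sum_bundle V (tangent_bundle M)) J \<and> adapted M J \<and>
     gen_almost_complex (total_space M V) (tangent_bundle (total_space M V)) \<J> \<and>
     (\<forall>q\<in>points (total_space M V). \<J> q = inv (Fmap M V nab q) \<circ> J (fst q) \<circ> Fmap M V nab q)"

definition semi_flat_gc ::
  "('m, 'e::euclidean_space) chart set \<Rightarrow> ('m, 'v::euclidean_space) triv set \<Rightarrow> ('m, 'e, 'v) conn \<Rightarrow>
   ('m \<Rightarrow> ('v \<times> 'e) \<times> (('v \<times> 'e) \<Rightarrow>\<^sub>L real) \<Rightarrow> ('v \<times> 'e) \<times> (('v \<times> 'e) \<Rightarrow>\<^sub>L real)) \<Rightarrow>
   ('m \<times> 'v \<Rightarrow> ('e \<times> 'v) \<times> (('e \<times> 'v) \<Rightarrow>\<^sub>L real) \<Rightarrow> ('e \<times> 'v) \<times> (('e \<times> 'v) \<Rightarrow>\<^sub>L real)) \<Rightarrow> bool"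
  where
  "semi_flat_gc M V nab J \<J> \<longleftrightarrow> semi_flat_gac M V nab J \<J> \<and> integrable_gac (total_space M V) \<J>"

text \<open>$\Delta=J(V)$ and $\widehat\Delta=J(V^\vee)$ as subsets of the fibres of $T_M\oplus T_M^\vee$, together with
  the restrictions of $J$ to $V$ and $V^\vee$ as maps into $T_M\oplus T_M^\vee$.\<close>

definition Delta ::
  "('m \<Rightarrow> ('v \<times> 'e) \<times> (('v \<times> 'e) \<Rightarrow>\<^sub>L real) \<Rightarrow>
     ('v::real_normed_vector \<times> 'e::real_normed_vector) \<times> (('v \<times> 'e) \<Rightarrow>\<^sub>L real)) \<Rightarrow>
   'm \<Rightarrow> ('e \<times> ('e \<Rightarrow>\<^sub>L real)) set" where
  "Delta J p = incl_T -` (J p ` range incl_V)"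

definition Delta_hat ::
  "('m \<Rightarrow> ('v \<times> 'e) \<times> (('v \<times> 'e) \<Rightarrow>\<^sub>L real) \<Rightarrow>
     ('v::real_normed_vector \<times> 'e::real_normed_vector) \<times> (('v \<times> 'e) \<Rightarrow>\<^sub>L real)) \<Rightarrow>
   'm \<Rightarrow> ('e \<times> ('e \<Rightarrow>\<^sub>L real)) set" where
  "Delta_hat J p = incl_T -` (J p ` range incl_Vdual)"

definition J_V ::
  "('m \<Rightarrow> ('v \<times> 'e) \<times> (('v \<times> 'e) \<Rightarrow>\<^sub>L real) \<Rightarrow>
     ('v::real_normed_vector \<times> 'e::real_normed_vector) \<times> (('v \<times> 'e) \<Rightarrow>\<^sub>L real)) \<Rightarrow>
   'm \<Rightarrow> 'v \<Rightarrow> 'e \<times> ('e \<Rightarrow>\<^sub>L real)" where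
  "J_V J p v = inv incl_T (J p (incl_V v))"

definition J_Vdual ::
  "('m \<Rightarrow> ('v \<times> 'e) \<times> (('v \<times> 'e) \<Rightarrow>\<^sub>L real) \<Rightarrow>
     ('v::real_normed_vector \<times> 'e::real_normed_vector) \<times> (('v \<times> 'e) \<Rightarrow>\<^sub>L real)) \<Rightarrow>
   'm \<Rightarrow> ('v \<Rightarrow>\<^sub>L real) \<Rightarrow> 'e \<times> ('e \<Rightarrow>\<^sub>L real)" where
  "J_Vdual J p f = inv incl_T (J p (incl_Vdual f))"

end

theory Submission
  imports Defs
begin

text \<open>Write $\bar a$ for the lift $F^{-1}(\pi^* a)$ of a section $a$ of $(V\oplus T_M)\oplus(V\oplus T_M)^\vee$.
  If $a = Js$ with $s$ a section of $V$, then $\bar a + i\bar s$ is a section of the $+i$-eigenbundle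
  of \<open>\<J>\<close>. For $b = Js'$, and along the zero section of the total space, one computes
  $[\bar a,\bar b] = \overline{[a,b]}$, $[\bar a,\bar s'] = \overline{\nabla_a s'}$ and $[\bar s,\bar s'] = 0$, where
  $\nabla_a$ is the derivative along the vector field part of $a$. Hence integrability at a point of
  the zero section says $[a,b] = J(\nabla_a s' - \nabla_b s)$, so $\Delta = J(V)$ is closed under the
  bracket; smoothness of the bracket comes for free, since the right hand side is smooth. The same
  computation with $\nabla^\vee$ applies to $V^\vee$. All curvature terms are linear in the fibre
  coordinate and vanish along the zero section, so flatness enters only through the transported
  connections.\<close>

text \<open>The obstacle is that \<open>chart_at\<close> jumps from point to point: the bracket, the
  Lie derivative and \<open>dfun\<close> are each defined at p in the chart chosen for p, so none
  can be differentiated or compared between points before it is rewritten in one chart fixed near p.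
  That rewriting produces second derivatives of transition maps, and their symmetry is what removes
  them. On the total space everything is read in bundle charts with fibre coordinate k. If A(Y) is
  the connection matrix in the trivialisation, the horizontal lift of Y has components (Y, - A(Y)
  k), and D sends a vector (w, m) to m + A(w) k. Differentiating at k = 0 leaves A undifferentiated:
  the bracket of the lift of X with the vertical lift of s is ds(X) + A(X) s, the covariant
  derivative, while every derivative of A is multiplied by k. The eigenbundle condition on a pair
  (real part, imaginary part) says that J carries the imaginary part to the real part; the imaginary
  part of the bracket is the sum of the two mixed brackets, and antisymmetry gives the second its
  minus sign.\<close>

section \<open>Finite-dimensional normed spaces\<close>

text \<open>The fibres of $T_M\oplus T_M^\vee$ carry the operator norm on the dual part, hence are not an
  \<^class>\<open>euclidean_space\<close>; the class below covers them. Its axiom is \<open>ex_nat_coords\<close> with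
  \<^const>\<open>bounded_linear\<close> expanded, as that constant is not available inside the class declaration.\<close>

class finite_coords = real_normed_vector +
  assumes ex_nat_coords_expanded: "\<exists>n (e::nat \<Rightarrow> 'a) (c::nat \<Rightarrow> 'a \<Rightarrow> real).
    (\<forall>i<n. (\<forall>x y. c i (x + y) = c i x + c i y) \<and> (\<forall>r x. c i (r *\<^sub>R x) = r *\<^sub>R c i x) \<and>
      (\<exists>K. \<forall>x. \<bar>c i x\<bar> \<le> norm x * K)) \<and> (\<forall>x. x = sum (\<lambda>i. c i x *\<^sub>R e i) {..<n})"

lemma bounded_linear_real_iff:
  fixes c :: "'a::real_normed_vector \<Rightarrow> real"
  shows "bounded_linear c \<longleftrightarrow> (\<forall>x y. c (x + y) = c x + c y) \<and> (\<forall>r x. c (r *\<^sub>R x) = r *\<^sub>R c x) \<and>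
    (\<exists>K. \<forall>x. \<bar>c x\<bar> \<le> norm x * K)"
  by (auto simp: bounded_linear_def bounded_linear_axioms_def linear_iff)

lemma ex_nat_coords: "\<exists>n (e::nat \<Rightarrow> 'a::finite_coords) (c::nat \<Rightarrow> 'a \<Rightarrow> real).
    (\<forall>i<n. bounded_linear (c i)) \<and> (\<forall>x. x = (\<Sum>i<n. c i x *\<^sub>R e i))"
  using ex_nat_coords_expanded unfolding bounded_linear_real_iff .

text \<open>The class numbers coordinates by naturals because its axiom can mention no second type
  variable. Products and operator spaces come with other finite index sets, and a bijection with an
  initial segment of the naturals renumbers them.\<close>

lemma ex_nat_coordsI:
  fixes e :: "'i \<Rightarrow> 'a::real_normed_vector"
  assumes "finite I" "\<And>i. i \<in> I \<Longrightarrow> bounded_linear (c i)" "\<And>x. x = (\<Sum>i\<in>I. c i x *\<^sub>R e i)"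
  shows "\<exists>n (e::nat \<Rightarrow> 'a) (c::nat \<Rightarrow> 'a \<Rightarrow> real).
    (\<forall>i<n. bounded_linear (c i)) \<and> (\<forall>x. x = (\<Sum>i<n. c i x *\<^sub>R e i))"
proof -
  obtain h where h: "bij_betw h {..<card I} I"
    using ex_bij_betw_nat_finite[OF assms(1)] by (auto simp: atLeast0LessThan)
  have "\<forall>i<card I. bounded_linear (c (h i))"
    using h assms(2) by (auto simp: bij_betw_def)
  moreover have "x = (\<Sum>i<card I. c (h i) x *\<^sub>R e (h i))" for x
    using sum.reindex_bij_betw[OF h, of "\<lambda>i. c i x *\<^sub>R e i"] assms(3)[of x] by simp
  ultimately show ?thesis
    by (intro exI[of _ "card I"] exI[of _ "e \<circ> h"] exI[of _ "c \<circ> h"]) auto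
qed

lemma finite_coords_classI:
  assumes "\<exists>n (e::nat \<Rightarrow> 'a::real_normed_vector) (c::nat \<Rightarrow> 'a \<Rightarrow> real).
    (\<forall>i<n. bounded_linear (c i)) \<and> (\<forall>x. x = (\<Sum>i<n. c i x *\<^sub>R e i))"
  shows "OFCLASS('a, finite_coords_class)"
  using assms unfolding bounded_linear_real_iff by intro_classes

instance euclidean_space \<subseteq> finite_coords
  by (rule finite_coords_classI, rule ex_nat_coordsI[of Basis "\<lambda>b x. x \<bullet> b" "\<lambda>b. b"])
    (auto simp: euclidean_representation bounded_linear_inner_left)

instance prod :: (finite_coords, finite_coords) finite_coords
proof (rule finite_coords_classI)
  obtain n :: nat and e :: "nat \<Rightarrow> 'a" and c where
    1: "\<forall>i<n. bounded_linear (c i)" "\<And>x. x = (\<Sum>i<n. c i x *\<^sub>R e i)" using ex_nat_coords by blast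
  obtain m :: nat and d :: "nat \<Rightarrow> 'b" and a where
    2: "\<forall>i<m. bounded_linear (a i)" "\<And>x. x = (\<Sum>i<m. a i x *\<^sub>R d i)" using ex_nat_coords by blast
  \<comment> \<open>The index set is the disjoint union of those of the factors, each basis vector
    being padded by 0.\<close>
  let ?E = "\<lambda>i. case i of Inl i \<Rightarrow> (e i, 0) | Inr i \<Rightarrow> (0, d i)"
  let ?C = "\<lambda>i x. case i of Inl i \<Rightarrow> c i (fst x) | Inr i \<Rightarrow> a i (snd x)"
  have *: "x = (\<Sum>i\<in>{..<n} <+> {..<m}. ?C i x *\<^sub>R ?E i)" for x
    using 1(2)[of "fst x"] 2(2)[of "snd x"]
    by (subst sum.Plus) (auto simp: prod_eq_iff fst_sum snd_sum)
  show "\<exists>n (e::nat \<Rightarrow> 'a \<times> 'b) (c::nat \<Rightarrow> 'a \<times> 'b \<Rightarrow> real).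
    (\<forall>i<n. bounded_linear (c i)) \<and> (\<forall>x. x = (\<Sum>i<n. c i x *\<^sub>R e i))"
  proof (rule ex_nat_coordsI[OF _ _ *])
    show "bounded_linear (?C i)" if "i \<in> {..<n} <+> {..<m}" for i
      using that 1(1) 2(1) bounded_linear_compose[OF _ bounded_linear_fst]
        bounded_linear_compose[OF _ bounded_linear_snd] by (cases i) auto
  qed simp
qed

lemma blinfun_representation:
  fixes f :: "'a::euclidean_space \<Rightarrow>\<^sub>L 'b::real_normed_vector"
  shows "f x = (\<Sum>b\<in>Basis. (x \<bullet> b) *\<^sub>R f b)"
proof -
  have "f x = f (\<Sum>b\<in>Basis. (x \<bullet> b) *\<^sub>R b)" by (simp add: euclidean_representation)
  then show ?thesis by (simp add: blinfun.sum_right blinfun.scaleR_right)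
qed

instance blinfun :: (euclidean_space, finite_coords) finite_coords
proof (rule finite_coords_classI)
  obtain n :: nat and e :: "nat \<Rightarrow> 'b" and c where
    1: "\<forall>i<n. bounded_linear (c i)" "\<And>x. x = (\<Sum>i<n. c i x *\<^sub>R e i)" using ex_nat_coords by blast
  have bl: "bounded_linear (\<lambda>x. (x \<bullet> b) *\<^sub>R v)" for b :: 'a and v :: 'b
    by (intro bounded_linear_scaleR_left[THEN bounded_linear_compose] bounded_linear_inner_left)
  \<comment> \<open>Elementary matrices: \<open>?E (b, i)\<close> sends b to \<open>e i\<close> and
    the other basis vectors to 0, and the matching coefficient of f is the i-th coordinate of
    \<open>f b\<close>.\<close>
  let ?E = "\<lambda>(b::'a, i). Blinfun (\<lambda>x. (x \<bullet> b) *\<^sub>R e i)"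
  let ?C = "\<lambda>(b, i) f. c i (blinfun_apply f b)"
  have *: "f = (\<Sum>j\<in>Basis \<times> {..<n}. ?C j f *\<^sub>R ?E j)" for f
  proof (rule blinfun_eqI)
    fix x
    have "f x = (\<Sum>b\<in>Basis. (x \<bullet> b) *\<^sub>R (\<Sum>i<n. c i (f b) *\<^sub>R e i))"
      using blinfun_representation[of f x] 1(2) by simp
    moreover have "?C j f *\<^sub>R blinfun_apply (?E j) x = (case j of (b, i) \<Rightarrow> (x \<bullet> b) *\<^sub>R (c i (f b) *\<^sub>R e i))" for j
      by (cases j) (simp add: bounded_linear_Blinfun_apply[OF bl] mult.commute)
    ultimately show "f x = (\<Sum>j\<in>Basis \<times> {..<n}. ?C j f *\<^sub>R ?E j) x"
      by (simp only: blinfun.sum_left blinfun.scaleR_left scaleR_sum_right sum.cartesian_product)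
  qed
  show "\<exists>n (e::nat \<Rightarrow> 'a \<Rightarrow>\<^sub>L 'b) c.
    (\<forall>i<n. bounded_linear (c i :: _ \<Rightarrow> real)) \<and> (\<forall>x. x = (\<Sum>i<n. c i x *\<^sub>R e i))"
  proof (rule ex_nat_coordsI[OF _ _ *])
    show "bounded_linear (?C j)" if "j \<in> Basis \<times> {..<n}" for j
      using that 1(1) bounded_linear_compose[OF _ blinfun.bounded_linear_left] by (cases j) auto
  qed simp
qed

text \<open>Expanding the argument in coordinates writes f as a finite sum of bounded functionals
  times fixed vectors.\<close>

lemma linear_imp_bounded_linear:
  fixes f :: "'a::finite_coords \<Rightarrow> 'b::real_normed_vector"
  assumes "linear f" shows "bounded_linear f"
proof -
  obtain n :: nat and e :: "nat \<Rightarrow> 'a" and c where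
    1: "\<forall>i<n. bounded_linear (c i)" "\<And>x. x = (\<Sum>i<n. c i x *\<^sub>R e i)" using ex_nat_coords by blast
  have "f = (\<lambda>x. \<Sum>i<n. c i x *\<^sub>R f (e i))"
  proof
    fix x
    have "f x = f (\<Sum>i<n. c i x *\<^sub>R e i)" using 1(2) by metis
    then show "f x = (\<Sum>i<n. c i x *\<^sub>R f (e i))"
      by (simp add: linear_sum[OF assms] linear_scale[OF assms])
  qed
  moreover have "bounded_linear (\<lambda>x. \<Sum>i<n. c i x *\<^sub>R f (e i))"
    using 1(1) by (intro bounded_linear_sum bounded_linear_scaleR_left[THEN bounded_linear_compose]) auto
  ultimately show ?thesis by metis
qed

lemma Blinfun_linear_apply:
  fixes f :: "'a::finite_coords \<Rightarrow> 'b::real_normed_vector"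
  shows "linear f \<Longrightarrow> blinfun_apply (Blinfun f) = f"
  by (simp add: linear_imp_bounded_linear bounded_linear_Blinfun_apply)

section \<open>Calculus of smooth maps\<close>

lemma frechet_derivative_eqI:
  "(f has_derivative f') (at x) \<Longrightarrow> frechet_derivative f (at x) = f'"
  using frechet_derivative_at by metis

text \<open>\<open>frechet_derivative\<close> chooses among all derivatives, so two functions with
  the same set of derivatives at x, even the empty one, receive the same value. Differentiability
  therefore does not enter.\<close>

lemma frechet_derivative_cong_open:
  assumes "open S" "x \<in> S" "\<And>y. y \<in> S \<Longrightarrow> f y = g y"
  shows "frechet_derivative f (at x) = frechet_derivative g (at x)"
proof -
  have "(f has_derivative D) (at x) \<longleftrightarrow> (g has_derivative D) (at x)" for D
    using assms by (metis has_derivative_transform_within_open)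
  then show ?thesis by (simp add: frechet_derivative_def)
qed

lemma differentiable_cong_open:
  assumes "open S" "x \<in> S" "\<And>y. y \<in> S \<Longrightarrow> f y = g y"
  shows "f differentiable (at x) \<longleftrightarrow> g differentiable (at x)"
  using assms unfolding differentiable_def by (metis has_derivative_transform_within_open)

lemma Ck_on_cong:
  assumes "open S" "\<And>x. x \<in> S \<Longrightarrow> f x = g x"
  shows "Ck_on k S f \<longleftrightarrow> Ck_on k S g"
  using assms(2)
proof (induction k arbitrary: f g)
  case 0
  then show ?case by (simp cong: continuous_on_cong)
next
  case (Suc k)
  have "Ck_on k S (\<lambda>x. frechet_derivative f (at x) v) = Ck_on k S (\<lambda>x. frechet_derivative g (at x) v)" for v
    by (rule Suc.IH) (metis Suc.prems assms(1) frechet_derivative_cong_open)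
  moreover have "(\<forall>x\<in>S. f differentiable (at x)) \<longleftrightarrow> (\<forall>x\<in>S. g differentiable (at x))"
    using differentiable_cong_open[OF assms(1), of _ f g] Suc.prems by blast
  ultimately show ?case by simp
qed

lemma Ck_on_subset: "Ck_on k S f \<Longrightarrow> T \<subseteq> S \<Longrightarrow> Ck_on k T f"
  by (induction k arbitrary: f) (auto intro: continuous_on_subset)

lemma Ck_on_continuous: "Ck_on k S f \<Longrightarrow> continuous_on S f"
  by (cases k) (auto intro: differentiable_imp_continuous_on simp: differentiable_on_def differentiable_at_withinI)

lemma Ck_on_Suc: "Ck_on (Suc k) S f \<Longrightarrow> Ck_on k S f"
proof (induction k arbitrary: f)
  case 0
  then show ?case using Ck_on_continuous[of 1] by simp
next
  case (Suc k)
  then show ?case by (metis Ck_on.simps(2))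
qed

text \<open>The derivatives in \<open>Ck_on\<close> are taken in the ambient space, so a
  neighbourhood of each point decides the matter.\<close>

lemma Ck_on_local:
  assumes "\<And>x. x \<in> S \<Longrightarrow> \<exists>T. open T \<and> x \<in> T \<and> Ck_on k T f"
  shows "Ck_on k S f"
  using assms
proof (induction k arbitrary: f)
  case 0
  then have "\<forall>x\<in>S. isCont f x"
    by (meson Ck_on.simps(1) continuous_on_eq_continuous_at)
  then show ?case by (simp add: continuous_at_imp_continuous_on)
next
  case (Suc k)
  have "Ck_on k S (\<lambda>x. frechet_derivative f (at x) v)" for v
    by (rule Suc.IH) (use Suc.prems in \<open>force\<close>)
  then show ?case using Suc.prems by fastforce
qed

lemma Ck_on_const [intro, simp]: "Ck_on k S (\<lambda>x. c)"
  by (induction k arbitrary: c) auto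

lemma Ck_on_bounded_linear:
  assumes L: "bounded_linear L" and S: "open S" and f: "Ck_on k S f"
  shows "Ck_on k S (\<lambda>x. L (f x))"
  using f
proof (induction k arbitrary: f)
  case 0
  then show ?case using L by (simp add: bounded_linear.continuous_on)
next
  case (Suc k)
  have hd: "((\<lambda>x. L (f x)) has_derivative (\<lambda>v. L (frechet_derivative f (at x) v))) (at x)" if "x \<in> S" for x
    using Suc.prems that by (intro bounded_linear.has_derivative[OF L]) (simp add: frechet_derivative_works)
  have "Ck_on k S (\<lambda>x. frechet_derivative (\<lambda>x. L (f x)) (at x) v)" for v
  proof (subst Ck_on_cong[OF S])
    show "frechet_derivative (\<lambda>x. L (f x)) (at x) v = L (frechet_derivative f (at x) v)" if "x \<in> S" for x
      by (simp add: frechet_derivative_eqI[OF hd[OF that]])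
    show "Ck_on k S (\<lambda>x. L (frechet_derivative f (at x) v))"
      using Suc by simp
  qed
  then show ?case using hd by (auto simp: differentiable_def)
qed

lemma Ck_on_add:
  assumes S: "open S" and "Ck_on k S f" "Ck_on k S g"
  shows "Ck_on k S (\<lambda>x. f x + g x)"
  using assms(2,3)
proof (induction k arbitrary: f g)
  case 0
  then show ?case by (simp add: continuous_on_add)
next
  case (Suc k)
  have hd: "((\<lambda>x. f x + g x) has_derivative
      (\<lambda>v. frechet_derivative f (at x) v + frechet_derivative g (at x) v)) (at x)" if "x \<in> S" for x
    using Suc.prems that by (intro has_derivative_add) (simp_all add: frechet_derivative_works)
  have "Ck_on k S (\<lambda>x. frechet_derivative (\<lambda>x. f x + g x) (at x) v)" for v
  proof (subst Ck_on_cong[OF S])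
    show "frechet_derivative (\<lambda>x. f x + g x) (at x) v =
        frechet_derivative f (at x) v + frechet_derivative g (at x) v" if "x \<in> S" for x
      by (simp add: frechet_derivative_eqI[OF hd[OF that]])
    show "Ck_on k S (\<lambda>x. frechet_derivative f (at x) v + frechet_derivative g (at x) v)"
      using Suc by simp
  qed
  then show ?case using hd by (auto simp: differentiable_def)
qed

lemma Ck_on_bilinear:
  assumes P: "bounded_bilinear P" and S: "open S" and "Ck_on k S f" "Ck_on k S g"
  shows "Ck_on k S (\<lambda>x. P (f x) (g x))"
  using assms(3,4)
proof (induction k arbitrary: f g)
  case 0
  then show ?case using P by (simp add: bounded_bilinear.continuous_on)
next
  case (Suc k)
  have hd: "((\<lambda>x. P (f x) (g x)) has_derivative
      (\<lambda>v. P (f x) (frechet_derivative g (at x) v) + P (frechet_derivative f (at x) v) (g x))) (at x)"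
    if "x \<in> S" for x
    using Suc.prems that by (intro bounded_bilinear.FDERIV[OF P]) (simp_all add: frechet_derivative_works)
  have "Ck_on k S (\<lambda>x. frechet_derivative (\<lambda>x. P (f x) (g x)) (at x) v)" for v
  proof (subst Ck_on_cong[OF S])
    show "frechet_derivative (\<lambda>x. P (f x) (g x)) (at x) v =
        P (f x) (frechet_derivative g (at x) v) + P (frechet_derivative f (at x) v) (g x)" if "x \<in> S" for x
      by (simp add: frechet_derivative_eqI[OF hd[OF that]])
    show "Ck_on k S (\<lambda>x. P (f x) (frechet_derivative g (at x) v) + P (frechet_derivative f (at x) v) (g x))"
      \<comment> \<open>The product rule also contains the undifferentiated factors; their class
        \<open>Suc k\<close> is lowered to k before the induction hypothesis applies.\<close>
      using Suc.prems Suc.prems[THEN Ck_on_Suc] by (intro Ck_on_add[OF S] Suc.IH) auto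
  qed
  then show ?case using hd by (auto simp: differentiable_def)
qed

lemma Ck_on_sum:
  assumes "open S" "\<And>i. i \<in> I \<Longrightarrow> Ck_on k S (f i)"
  shows "Ck_on k S (\<lambda>x. \<Sum>i\<in>I. f i x)"
  using assms(2) by (induction I rule: infinite_finite_induct) (auto intro: Ck_on_add assms(1))

lemma Ck_on_ident [intro, simp]: "Ck_on k S (\<lambda>x. x)"
  by (cases k) auto

lemma Ck_on_Pair:
  assumes "open S" "Ck_on k S f" "Ck_on k S g"
  shows "Ck_on k S (\<lambda>x. (f x, g x))"
proof -
  have "Ck_on k S (\<lambda>x. (f x, 0) + (0, g x))"
    by (intro Ck_on_add assms Ck_on_bounded_linear[of "\<lambda>x. (x, 0)"] Ck_on_bounded_linear[of "Pair 0"])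
      (auto intro: bounded_linear_Pair bounded_linear_ident bounded_linear_zero)
  then show ?thesis by simp
qed

text \<open>By the chain rule the derivative of g at \<open>f x\<close> is applied to a vector that
  moves with x, whereas \<open>Ck_on\<close> speaks of fixed directions. Coordinates of the middle
  space turn this into a sum of products of a coordinate of Df with a derivative of g in a fixed
  direction, composed with f; the latter is covered by induction.\<close>

lemma Ck_on_compose:
  fixes g :: "'b::finite_coords \<Rightarrow> 'c::real_normed_vector"
  assumes S: "open S" and "Ck_on k S f" "Ck_on k T g" and T: "f ` S \<subseteq> T"
  shows "Ck_on k S (\<lambda>x. g (f x))"
  using assms(2,3)
proof (induction k arbitrary: g)
  case 0
  then show ?case using T by (auto intro: continuous_on_compose2)
next
  case (Suc k)
  obtain n :: nat and e :: "nat \<Rightarrow> 'b" and c where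
    c: "\<forall>i<n. bounded_linear (c i)" "\<And>x. x = (\<Sum>i<n. c i x *\<^sub>R e i)" using ex_nat_coords by blast
  let ?D = "\<lambda>x v. frechet_derivative g (at (f x)) (frechet_derivative f (at x) v)"
  have hd: "((\<lambda>x. g (f x)) has_derivative ?D x) (at x)" if "x \<in> S" for x
    using Suc.prems that T by (intro has_derivative_compose[of f _ x UNIV g])
      (auto simp: frechet_derivative_works[symmetric])
  have eq: "?D x v = (\<Sum>i<n. c i (frechet_derivative f (at x) v) *\<^sub>R frechet_derivative g (at (f x)) (e i))"
    if "x \<in> S" for x v
  proof -
    have l: "linear (frechet_derivative g (at (f x)))"
      using Suc.prems that T by (intro linear_frechet_derivative) auto
    have "?D x v = frechet_derivative g (at (f x)) (\<Sum>i<n. c i (frechet_derivative f (at x) v) *\<^sub>R e i)"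
      using c(2) by metis
    then show ?thesis by (simp add: linear_sum[OF l] linear_scale[OF l])
  qed
  have "Ck_on k S (\<lambda>x. frechet_derivative (\<lambda>x. g (f x)) (at x) v)" for v
  proof (subst Ck_on_cong[OF S])
    show "frechet_derivative (\<lambda>x. g (f x)) (at x) v = 
      (\<Sum>i<n. c i (frechet_derivative f (at x) v) *\<^sub>R frechet_derivative g (at (f x)) (e i))" if "x \<in> S" for x
      using frechet_derivative_eqI[OF hd[OF that]] eq[OF that] by simp
    show "Ck_on k S (\<lambda>x. \<Sum>i<n. c i (frechet_derivative f (at x) v) *\<^sub>R frechet_derivative g (at (f x)) (e i))"
      using Suc.prems c(1) Ck_on_Suc[OF Suc.prems(1)]
      by (intro Ck_on_sum Ck_on_bilinear[OF bounded_bilinear_scaleR] S Ck_on_bounded_linear[of "c _"] Suc.IH)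
        auto
  qed
  then show ?case using hd by (auto simp: differentiable_def)
qed

lemma smooth_on_cong:
  assumes "open S" "\<And>x. x \<in> S \<Longrightarrow> f x = g x"
  shows "smooth_on S f \<longleftrightarrow> smooth_on S g"
  unfolding smooth_on_def using Ck_on_cong[OF assms(1), of f g] assms(2) by blast

lemma smooth_on_transform:
  "open S \<Longrightarrow> smooth_on S f \<Longrightarrow> (\<And>x. x \<in> S \<Longrightarrow> f x = g x) \<Longrightarrow> smooth_on S g"
  using smooth_on_cong[of S f g] by blast

lemma smooth_on_subset: "smooth_on S f \<Longrightarrow> T \<subseteq> S \<Longrightarrow> smooth_on T f"
  unfolding smooth_on_def using Ck_on_subset by blast

lemma smooth_on_local:
  assumes "\<And>x. x \<in> S \<Longrightarrow> \<exists>T. open T \<and> x \<in> T \<and> smooth_on T f"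
  shows "smooth_on S f"
  unfolding smooth_on_def using assms[unfolded smooth_on_def] by (intro allI Ck_on_local) blast

lemma smooth_on_continuous: "smooth_on S f \<Longrightarrow> continuous_on S f"
  using Ck_on_continuous smooth_on_def by blast

lemma smooth_on_differentiable: "smooth_on S f \<Longrightarrow> x \<in> S \<Longrightarrow> f differentiable (at x)"
  unfolding smooth_on_def using Ck_on.simps(2)[of 0 S f] by blast

lemma smooth_on_has_derivative:
  "smooth_on S f \<Longrightarrow> x \<in> S \<Longrightarrow> (f has_derivative frechet_derivative f (at x)) (at x)"
  using smooth_on_differentiable frechet_derivative_works by blast

lemma smooth_on_const [intro, simp]: "smooth_on S (\<lambda>x. c)"
  by (simp add: smooth_on_def)

lemma smooth_on_ident [intro, simp]: "smooth_on S (\<lambda>x. x)"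
  by (simp add: smooth_on_def)

lemma smooth_on_bounded_linear:
  "bounded_linear L \<Longrightarrow> open S \<Longrightarrow> smooth_on S f \<Longrightarrow> smooth_on S (\<lambda>x. L (f x))"
  by (simp add: smooth_on_def Ck_on_bounded_linear)

lemma smooth_on_add: "open S \<Longrightarrow> smooth_on S f \<Longrightarrow> smooth_on S g \<Longrightarrow> smooth_on S (\<lambda>x. f x + g x)"
  by (simp add: smooth_on_def Ck_on_add)

lemma smooth_on_bilinear:
  "bounded_bilinear P \<Longrightarrow> open S \<Longrightarrow> smooth_on S f \<Longrightarrow> smooth_on S g \<Longrightarrow> smooth_on S (\<lambda>x. P (f x) (g x))"
  by (simp add: smooth_on_def Ck_on_bilinear)

lemma smooth_on_Pair: "open S \<Longrightarrow> smooth_on S f \<Longrightarrow> smooth_on S g \<Longrightarrow> smooth_on S (\<lambda>x. (f x, g x))"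
  by (simp add: smooth_on_def Ck_on_Pair)

lemma smooth_on_sum:
  "open S \<Longrightarrow> (\<And>i. i \<in> I \<Longrightarrow> smooth_on S (f i)) \<Longrightarrow> smooth_on S (\<lambda>x. \<Sum>i\<in>I. f i x)"
  by (simp add: smooth_on_def Ck_on_sum)

lemma smooth_on_compose:
  fixes g :: "'b::finite_coords \<Rightarrow> 'c::real_normed_vector"
  shows "open S \<Longrightarrow> smooth_on S f \<Longrightarrow> smooth_on T g \<Longrightarrow> f ` S \<subseteq> T \<Longrightarrow> smooth_on S (\<lambda>x. g (f x))"
  unfolding smooth_on_def using Ck_on_compose[of S _ f T g] by blast

lemma smooth_on_frechet_derivative:
  "smooth_on S f \<Longrightarrow> smooth_on S (\<lambda>x. frechet_derivative f (at x) v)"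
  unfolding smooth_on_def using Ck_on.simps(2) by blast

lemma smooth_on_coords:
  fixes f :: "'a::real_normed_vector \<Rightarrow> 'b::real_normed_vector" and c :: "'i \<Rightarrow> 'b \<Rightarrow> real"
  assumes "open S" "\<And>x. x = (\<Sum>i\<in>I. c i x *\<^sub>R e i)" "\<And>i. i \<in> I \<Longrightarrow> smooth_on S (\<lambda>x. c i (f x))"
  shows "smooth_on S f"
proof -
  have "smooth_on S (\<lambda>x. \<Sum>i\<in>I. c i (f x) *\<^sub>R e i)"
    using assms(1,3) by (intro smooth_on_sum smooth_on_bilinear[OF bounded_bilinear_scaleR]) auto
  then show ?thesis using assms(2) by simp
qed

text \<open>Bundle maps and frame changes are handled in this form: linear in the fibre and smooth
  on each fixed vector. Coordinates of \<open>f x\<close> reduce the claim to sums of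
  products.\<close>

lemma smooth_on_linear_family:
  fixes L :: "'a::real_normed_vector \<Rightarrow> 'b::finite_coords \<Rightarrow> 'c::real_normed_vector"
  assumes S: "open S" and L: "\<And>x. x \<in> S \<Longrightarrow> linear (L x)" "\<And>w. smooth_on S (\<lambda>x. L x w)"
    and f: "smooth_on S f"
  shows "smooth_on S (\<lambda>x. L x (f x))"
proof -
  obtain n :: nat and e :: "nat \<Rightarrow> 'b" and c where
    c: "\<forall>i<n. bounded_linear (c i)" "\<And>x. x = (\<Sum>i<n. c i x *\<^sub>R e i)" using ex_nat_coords by blast
  have "L x (f x) = (\<Sum>i<n. c i (f x) *\<^sub>R L x (e i))" if "x \<in> S" for x
  proof -
    have "L x (f x) = L x (\<Sum>i<n. c i (f x) *\<^sub>R e i)" using c(2) by metis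
    then show ?thesis using L(1)[OF that] by (simp add: linear_sum linear_scale)
  qed
  moreover have "smooth_on S (\<lambda>x. \<Sum>i<n. c i (f x) *\<^sub>R L x (e i))"
    using c(1) f L(2) S
    by (intro smooth_on_sum smooth_on_bilinear[OF bounded_bilinear_scaleR] smooth_on_bounded_linear[of "c _"]) auto
  ultimately show ?thesis
    using smooth_on_cong[OF S, of "\<lambda>x. L x (f x)" "\<lambda>x. \<Sum>i<n. c i (f x) *\<^sub>R L x (e i)"] by blast
qed

lemma smooth_on_frechet_derivative_apply:
  fixes f :: "'a::finite_coords \<Rightarrow> 'b::real_normed_vector"
  assumes "open S" "smooth_on S f" "smooth_on S X"
  shows "smooth_on S (\<lambda>x. frechet_derivative f (at x) (X x))"
proof (rule smooth_on_linear_family[OF assms(1) _ _ assms(3)])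
  show "linear (frechet_derivative f (at x))" if "x \<in> S" for x
    using assms(2) that by (intro linear_frechet_derivative smooth_on_differentiable)
qed (rule smooth_on_frechet_derivative[OF assms(2)])

text \<open>A functional on a Euclidean space is the combination of the coordinate functionals with
  its values on the basis as coefficients, so the operator norm brings in no further
  condition.\<close>

lemma smooth_on_blinfun:
  fixes f :: "'a::real_normed_vector \<Rightarrow> 'b::euclidean_space \<Rightarrow>\<^sub>L real"
  assumes "open S" "\<And>b. smooth_on S (\<lambda>x. f x b)"
  shows "smooth_on S f"
proof -
  have bl: "bounded_linear (\<lambda>x::'b. x \<bullet> b)" for b by (rule bounded_linear_inner_left)
  have "g = (\<Sum>b\<in>Basis. g b *\<^sub>R Blinfun (\<lambda>x. x \<bullet> b))" for g :: "'b \<Rightarrow>\<^sub>L real"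
    by (rule blinfun_eqI, subst blinfun_representation[of g])
      (simp add: blinfun.sum_left blinfun.scaleR_left bounded_linear_Blinfun_apply[OF bl] mult.commute)
  then show ?thesis by (rule smooth_on_coords[OF assms(1)]) (rule assms(2))
qed

section \<open>Symmetry of second derivatives\<close>

lemma has_real_derivative_along_line:
  fixes f :: "'a::real_normed_vector \<Rightarrow> real"
  assumes "f differentiable (at (a + t *\<^sub>R w))"
  shows "((\<lambda>t. f (a + t *\<^sub>R w)) has_real_derivative frechet_derivative f (at (a + t *\<^sub>R w)) w) (at t)"
proof -
  let ?D = "frechet_derivative f (at (a + t *\<^sub>R w))"
  have D: "(f has_derivative ?D) (at (a + t *\<^sub>R w))"
    using assms frechet_derivative_works by blast
  have "((\<lambda>t. f (a + t *\<^sub>R w)) has_derivative (\<lambda>s. ?D (s *\<^sub>R w))) (at t)"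
    by (rule has_derivative_compose[of "\<lambda>t. a + t *\<^sub>R w" "\<lambda>s. s *\<^sub>R w" t UNIV f, OF _ D])
      (auto intro!: derivative_eq_intros)
  moreover have "(\<lambda>s. ?D (s *\<^sub>R w)) = (*) (?D w)"
    using linear_scale[OF linear_frechet_derivative[OF assms]] by auto
  ultimately show ?thesis by (simp add: has_field_derivative_def)
qed

text \<open>Two applications of the mean value theorem: first along v, to the difference of two
  translates of f, then along w, to the v-derivative of f.\<close>

lemma second_difference:
  fixes f :: "'a::real_normed_vector \<Rightarrow> real"
  assumes f: "smooth_on S f" and S: "ball x r \<subseteq> S" and h: "0 < h" "h * (norm v + norm w) < r"
  shows "\<exists>p. dist p x \<le> h * (norm v + norm w) \<and>
    f (x + h *\<^sub>R v + h *\<^sub>R w) - f (x + h *\<^sub>R v) - f (x + h *\<^sub>R w) + f x =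
      h * h * frechet_derivative (\<lambda>y. frechet_derivative f (at y) v) (at p) w"
proof -
  have near: "dist (x + s *\<^sub>R v + t *\<^sub>R w) x \<le> h * (norm v + norm w)"
    if "0 \<le> s" "s \<le> h" "0 \<le> t" "t \<le> h" for s t
  proof -
    have "norm (s *\<^sub>R v + t *\<^sub>R w) \<le> s * norm v + t * norm w"
      using that norm_triangle_ineq[of "s *\<^sub>R v" "t *\<^sub>R w"] by simp
    also have "\<dots> \<le> h * norm v + h * norm w"
      using that by (intro add_mono mult_right_mono) auto
    finally show ?thesis by (simp add: dist_norm algebra_simps)
  qed
  have inS: "x + s *\<^sub>R v + t *\<^sub>R w \<in> S" if "0 \<le> s" "s \<le> h" "0 \<le> t" "t \<le> h" for s t
    using near[OF that] h S by (auto simp: dist_commute)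
  \<comment> \<open>The increment of \<open>?g\<close> over the interval from 0 to h is the second
    difference of f.\<close>
  let ?g = "\<lambda>s. f (x + h *\<^sub>R w + s *\<^sub>R v) - f (x + s *\<^sub>R v)"
  have "\<exists>z>0. z < h \<and> ?g h - ?g 0 = (h - 0) *
     (frechet_derivative f (at (x + h *\<^sub>R w + z *\<^sub>R v)) v - frechet_derivative f (at (x + z *\<^sub>R v)) v)"
  proof (rule MVT2)
    show "(?g has_real_derivative frechet_derivative f (at (x + h *\<^sub>R w + s *\<^sub>R v)) v -
        frechet_derivative f (at (x + s *\<^sub>R v)) v) (at s)" if "0 \<le> s" "s \<le> h" for s
      using inS[of s h] inS[of s 0] that h
      by (intro DERIV_diff has_real_derivative_along_line smooth_on_differentiable[OF f])
        (auto simp: ac_simps)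
  qed (use h in auto)
  then obtain s where s: "0 < s" "s < h" and gs: "?g h - ?g 0 = h *
     (frechet_derivative f (at (x + s *\<^sub>R v + h *\<^sub>R w)) v - frechet_derivative f (at (x + s *\<^sub>R v)) v)"
    by (auto simp: ac_simps)
  let ?k = "\<lambda>y. frechet_derivative f (at y) v"
  have "\<exists>z>0. z < h \<and> ?k (x + s *\<^sub>R v + h *\<^sub>R w) - ?k (x + s *\<^sub>R v + 0 *\<^sub>R w) = (h - 0) *
     frechet_derivative ?k (at (x + s *\<^sub>R v + z *\<^sub>R w)) w"
    using s h inS[of s]
    by (intro MVT2[of 0 h "\<lambda>t. ?k (x + s *\<^sub>R v + t *\<^sub>R w)"] has_real_derivative_along_line
        smooth_on_differentiable[OF smooth_on_frechet_derivative[OF f]]) auto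
  then obtain t where t: "0 < t" "t < h" and "?k (x + s *\<^sub>R v + h *\<^sub>R w) - ?k (x + s *\<^sub>R v) = h *
     frechet_derivative ?k (at (x + s *\<^sub>R v + t *\<^sub>R w)) w"
    by auto
  then show ?thesis
    using gs near[of s t] s by (intro exI[of _ "x + s *\<^sub>R v + t *\<^sub>R w"]) (simp add: ac_simps)
qed

text \<open>The second difference is unchanged when v and w are exchanged, so the two mixed
  derivatives agree at a pair of points p and q near x. As h shrinks both points tend to x, and
  continuity of the mixed derivatives finishes.\<close>

lemma second_derivative_symmetric_real:
  fixes f :: "'a::real_normed_vector \<Rightarrow> real"
  assumes S: "open S" "x \<in> S" and f: "smooth_on S f"
  shows "frechet_derivative (\<lambda>y. frechet_derivative f (at y) v) (at x) w =
    frechet_derivative (\<lambda>y. frechet_derivative f (at y) w) (at x) v"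
proof -
  define A where "A = (\<lambda>v w p. frechet_derivative (\<lambda>y. frechet_derivative f (at y) v) (at p) w)"
  have cont: "isCont (A v w) x" for v w
    using smooth_on_continuous[OF smooth_on_frechet_derivative[OF smooth_on_frechet_derivative[OF f]]] S
    by (auto simp: A_def continuous_on_eq_continuous_at)
  \<comment> \<open>The summand 0 gives the bound the form expected by
    \<open>field_le_epsilon\<close>.\<close>
  have "\<bar>A v w x - A w v x\<bar> \<le> 0 + e" if e: "0 < e" for e
  proof -
    obtain d1 where d1: "0 < d1" "\<And>y. dist y x < d1 \<Longrightarrow> dist (A v w y) (A v w x) < e / 2"
      using cont[of v w] e unfolding continuous_at_eps_delta by (meson half_gt_zero)
    obtain d2 where d2: "0 < d2" "\<And>y. dist y x < d2 \<Longrightarrow> dist (A w v y) (A w v x) < e / 2"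
      using cont[of w v] e unfolding continuous_at_eps_delta by (meson half_gt_zero)
    obtain r where r: "0 < r" "ball x r \<subseteq> S" using S open_contains_ball by blast
    \<comment> \<open>Within distance m of x both continuity estimates hold and the points stay in
      S.\<close>
    define m where "m = min r (min d1 d2)"
    \<comment> \<open>With this h the product h (|v| + |w|) is at most m / 2; the added 1 keeps the
      denominator positive when v and w both vanish.\<close>
    define h where "h = m / (2 * (norm v + norm w + 1))"
    have pos: "0 < norm v + norm w + 1" by (smt (verit) norm_ge_zero)
    have m: "0 < m" using r d1 d2 by (simp add: m_def)
    have h: "0 < h" using m pos by (simp add: h_def)
    have "h * (norm v + norm w) \<le> h * (norm v + norm w + 1)" using h by (intro mult_left_mono) auto
    also have "\<dots> = m / 2"
      unfolding h_def using pos by (metis nonzero_mult_divide_mult_cancel_right2 less_irrefl mult.commute times_divide_eq_left)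
    finally have hm: "h * (norm v + norm w) < m" using m by simp
    obtain p where p: "dist p x \<le> h * (norm v + norm w)"
      "f (x + h *\<^sub>R v + h *\<^sub>R w) - f (x + h *\<^sub>R v) - f (x + h *\<^sub>R w) + f x = h * h * A v w p"
      using second_difference[OF f r(2) h, of v w] hm unfolding A_def m_def by auto
    obtain q where q: "dist q x \<le> h * (norm w + norm v)"
      "f (x + h *\<^sub>R w + h *\<^sub>R v) - f (x + h *\<^sub>R w) - f (x + h *\<^sub>R v) + f x = h * h * A w v q"
      using second_difference[OF f r(2) h, of w v] hm unfolding A_def m_def by (auto simp: add.commute)
    have "h * h * A v w p = h * h * A w v q"
      unfolding p(2)[symmetric] q(2)[symmetric] by (simp add: ac_simps)
    then have "A v w p = A w v q" using h by simp
    moreover have "dist (A v w p) (A v w x) < e / 2"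
      using p hm by (intro d1) (auto simp: m_def)
    moreover have "dist (A w v q) (A w v x) < e / 2"
      using q hm by (intro d2) (auto simp: m_def add.commute)
    ultimately show ?thesis unfolding dist_real_def by arith
  qed
  then have "\<bar>A v w x - A w v x\<bar> \<le> 0" using field_le_epsilon by blast
  then show ?thesis by (simp add: A_def)
qed

lemma second_derivative_symmetric:
  fixes f :: "'a::real_normed_vector \<Rightarrow> 'b::euclidean_space"
  assumes S: "open S" "x \<in> S" and f: "smooth_on S f"
  shows "frechet_derivative (\<lambda>y. frechet_derivative f (at y) v) (at x) w =
    frechet_derivative (\<lambda>y. frechet_derivative f (at y) w) (at x) v"
proof (rule euclidean_eqI)
  fix b :: 'b
  have inner: "frechet_derivative (\<lambda>y. g y \<bullet> b) (at y) u = frechet_derivative g (at y) u \<bullet> b"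
    if "smooth_on S g" "y \<in> S" for g and y u :: 'a
    using frechet_derivative_eqI[OF has_derivative_inner_left[OF smooth_on_has_derivative[OF that]]]
    by simp
  have "frechet_derivative (\<lambda>y. frechet_derivative f (at y) v) (at x) w \<bullet> b =
      frechet_derivative (\<lambda>y. frechet_derivative (\<lambda>z. f z \<bullet> b) (at y) v) (at x) w" for v w
    unfolding inner[OF smooth_on_frechet_derivative[OF f] S(2), symmetric]
    by (rule arg_cong[where f = "\<lambda>D. D w"], rule frechet_derivative_cong_open[OF S]) (simp add: inner[OF f])
  moreover have "smooth_on S (\<lambda>z. f z \<bullet> b)"
    using f by (intro smooth_on_bounded_linear[OF bounded_linear_inner_left] S)
  ultimately show "frechet_derivative (\<lambda>y. frechet_derivative f (at y) v) (at x) w \<bullet> b =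
      frechet_derivative (\<lambda>y. frechet_derivative f (at y) w) (at x) v \<bullet> b"
    using second_derivative_symmetric_real[OF S] by metis
qed

section \<open>Atlases and smooth maps\<close>

text \<open>\<open>topology\<close> applied to a predicate can be unfolded only once the predicate
  is known to satisfy the axioms. Injectivity of the charts enters there: it makes taking images
  commute with intersections.\<close>

lemma openin_man_topology:
  assumes "\<And>c. c \<in> A \<Longrightarrow> inj_on (snd c) (fst c)" "\<And>c. c \<in> A \<Longrightarrow> open (snd c ` fst c)"
    and "\<And>c d. c \<in> A \<Longrightarrow> d \<in> A \<Longrightarrow> open (snd c ` (fst c \<inter> fst d))"
  shows "openin (man_topology A) S \<longleftrightarrow> S \<subseteq> points A \<and> (\<forall>c\<in>A. open (snd c ` (S \<inter> fst c)))"
proof -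
  have "istopology (\<lambda>S. S \<subseteq> points A \<and> (\<forall>c\<in>A. open (snd c ` (S \<inter> fst c))))"
    unfolding istopology_def
  proof (intro conjI allI impI ballI)
    fix S T c
    assume S: "S \<subseteq> points A \<and> (\<forall>c\<in>A. open (snd c ` (S \<inter> fst c)))"
      and T: "T \<subseteq> points A \<and> (\<forall>c\<in>A. open (snd c ` (T \<inter> fst c)))"
    show "S \<inter> T \<subseteq> points A" using S by blast
    assume c: "c \<in> A"
    have "snd c ` (S \<inter> T \<inter> fst c) = snd c ` (S \<inter> fst c) \<inter> snd c ` (T \<inter> fst c)"
      using assms(1)[OF c] by (auto simp: inj_on_def)
    then show "open (snd c ` (S \<inter> T \<inter> fst c))" using S T c by auto
  next
    fix K c
    assume K: "\<forall>S\<in>K. S \<subseteq> points A \<and> (\<forall>c\<in>A. open (snd c ` (S \<inter> fst c)))"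
    then show "\<Union>K \<subseteq> points A" by blast
    assume c: "c \<in> A"
    have "snd c ` (\<Union>K \<inter> fst c) = (\<Union>S\<in>K. snd c ` (S \<inter> fst c))" by blast
    then show "open (snd c ` (\<Union>K \<inter> fst c))" using K c by auto
  qed
  then show ?thesis by (simp add: man_topology_def topology_inverse')
qed

text \<open>Collects the compatibility conditions on charts, so that one development serves the base
  and, after \<open>atlas_total_space\<close>, the total space.\<close>

locale atlas =
  fixes A :: "('p, 'e::euclidean_space) chart set"
  assumes inj_chart: "c \<in> A \<Longrightarrow> inj_on (snd c) (fst c)"
    and open_chart_image: "c \<in> A \<Longrightarrow> open (snd c ` fst c)"
    and open_overlap: "c \<in> A \<Longrightarrow> d \<in> A \<Longrightarrow> open (snd c ` (fst c \<inter> fst d))"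
    and smooth_transition:
      "c \<in> A \<Longrightarrow> d \<in> A \<Longrightarrow> smooth_on (snd c ` (fst c \<inter> fst d)) (snd d \<circ> chart_inv c)"

lemma smooth_manifold_atlas: "smooth_manifold A \<Longrightarrow> atlas A"
  unfolding smooth_manifold_def atlas_def by blast

text \<open>\<open>smooth_fun\<close> with values in any normed space; it is applied to the
  coordinate expressions of sections.\<close>

definition smooth_map ::
  "('p, 'e::euclidean_space) chart set \<Rightarrow> 'p set \<Rightarrow> ('p \<Rightarrow> 'b::real_normed_vector) \<Rightarrow> bool" where
  "smooth_map A U f \<longleftrightarrow> (\<forall>c\<in>A. smooth_on (snd c ` (U \<inter> fst c)) (f \<circ> chart_inv c))"

lemma smooth_fun_iff_map: "smooth_fun A U f \<longleftrightarrow> smooth_map A U f"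
  by (simp add: smooth_fun_def smooth_map_def)

text \<open>Sections become vector-valued functions, one for each trivialisation, and charts need no
  longer be mentioned.\<close>

lemma smooth_section_iff:
  "smooth_section A B U s \<longleftrightarrow> (\<forall>(U', t)\<in>B. smooth_map A (U \<inter> U') (\<lambda>x. t x (s x)))"
  unfolding smooth_section_def smooth_map_def local_rep_def comp_def by blast

section \<open>Open sets of an atlas and closure properties of smooth maps\<close>

context atlas begin

lemma openin_iff: "openin (man_topology A) S \<longleftrightarrow> S \<subseteq> points A \<and> (\<forall>c\<in>A. open (snd c ` (S \<inter> fst c)))"
  by (rule openin_man_topology) (auto simp: inj_chart open_chart_image open_overlap)

lemma open_image: "openin (man_topology A) U \<Longrightarrow> c \<in> A \<Longrightarrow> open (snd c ` (U \<inter> fst c))"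
  by (simp add: openin_iff)

lemma openin_chart: "c \<in> A \<Longrightarrow> openin (man_topology A) (fst c)"
  unfolding openin_iff points_def by (metis Int_commute UN_upper open_overlap)

lemma openin_points: "openin (man_topology A) (points A)"
  unfolding openin_iff by (auto simp: points_def intro: open_chart_image
      simp: Int_absorb1[OF UN_upper])

lemma openin_subset_points: "openin (man_topology A) U \<Longrightarrow> U \<subseteq> points A"
  by (simp add: openin_iff)

lemma chart_inv_chart [simp]: "c \<in> A \<Longrightarrow> p \<in> fst c \<Longrightarrow> chart_inv c (snd c p) = p"
  by (simp add: chart_inv_def inj_chart)

lemma chart_at: "p \<in> points A \<Longrightarrow> chart_at A p \<in> A \<and> p \<in> fst (chart_at A p)"
  unfolding chart_at_def points_def by (rule someI_ex) blast

lemma chart_in_points: "c \<in> A \<Longrightarrow> p \<in> fst c \<Longrightarrow> p \<in> points A"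
  by (auto simp: points_def)

lemma smooth_mapD: "smooth_map A U f \<Longrightarrow> c \<in> A \<Longrightarrow> smooth_on (snd c ` (U \<inter> fst c)) (f \<circ> chart_inv c)"
  by (simp add: smooth_map_def)

lemma smooth_map_subset: "smooth_map A U f \<Longrightarrow> V \<subseteq> U \<Longrightarrow> smooth_map A V f"
  unfolding smooth_map_def by (meson Int_mono image_mono order_refl smooth_on_subset)

lemma smooth_map_cong:
  assumes U: "openin (man_topology A) U" and "\<And>p. p \<in> U \<Longrightarrow> f p = g p"
  shows "smooth_map A U f \<longleftrightarrow> smooth_map A U g"
proof -
  have "smooth_on (snd c ` (U \<inter> fst c)) (f \<circ> chart_inv c) \<longleftrightarrow> smooth_on (snd c ` (U \<inter> fst c)) (g \<circ> chart_inv c)"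
    if "c \<in> A" for c
    by (rule smooth_on_cong[OF open_image[OF U that]]) (use assms(2) that in auto)
  then show ?thesis unfolding smooth_map_def by blast
qed

text \<open>One chart near each point is enough, since any other chart differs from it by a smooth
  transition map.\<close>

lemma smooth_map_chartI:
  assumes "\<And>p. p \<in> U \<Longrightarrow> \<exists>W c. openin (man_topology A) W \<and> c \<in> A \<and> p \<in> W \<inter> fst c \<and>
      smooth_on (snd c ` (W \<inter> fst c)) (f \<circ> chart_inv c)"
  shows "smooth_map A U f"
  unfolding smooth_map_def
proof (intro ballI smooth_on_local)
  fix d u assume d: "d \<in> A" and "u \<in> snd d ` (U \<inter> fst d)"
  then obtain p where p: "p \<in> U" "p \<in> fst d" "u = snd d p" by blast
  obtain W c where W: "openin (man_topology A) W" "c \<in> A" "p \<in> W \<inter> fst c"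
    "smooth_on (snd c ` (W \<inter> fst c)) (f \<circ> chart_inv c)" using assms[OF p(1)] by blast
  let ?T = "snd d ` (W \<inter> fst c \<inter> fst d)"
  have op: "open ?T" using W d openin_chart by (intro open_image openin_Int)
  have "smooth_on ?T (\<lambda>u. (f \<circ> chart_inv c) ((snd c \<circ> chart_inv d) u))"
  proof (rule smooth_on_compose[OF op _ W(4)])
    show "smooth_on ?T (snd c \<circ> chart_inv d)"
      by (rule smooth_on_subset[OF smooth_transition[OF d W(2)]]) blast
    show "(snd c \<circ> chart_inv d) ` ?T \<subseteq> snd c ` (W \<inter> fst c)"
      using d by auto
  qed
  moreover have "(f \<circ> chart_inv c) ((snd c \<circ> chart_inv d) u) = (f \<circ> chart_inv d) u" if "u \<in> ?T" for u
    using that d W(2) by auto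
  ultimately have "smooth_on ?T (f \<circ> chart_inv d)" by (rule smooth_on_transform[OF op])
  then show "\<exists>T. open T \<and> u \<in> T \<and> smooth_on T (f \<circ> chart_inv d)"
    using op p W(3) by (intro exI[of _ ?T]) auto
qed

lemma smooth_map_local:
  assumes "\<And>p. p \<in> U \<Longrightarrow> \<exists>W. openin (man_topology A) W \<and> p \<in> W \<and> smooth_map A W f"
    and "U \<subseteq> points A"
  shows "smooth_map A U f"
proof (rule smooth_map_chartI)
  fix p assume "p \<in> U"
  then obtain W where "openin (man_topology A) W" "p \<in> W" "smooth_map A W f" using assms by blast
  then show "\<exists>W c. openin (man_topology A) W \<and> c \<in> A \<and> p \<in> W \<inter> fst c \<and>
      smooth_on (snd c ` (W \<inter> fst c)) (f \<circ> chart_inv c)"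
    using chart_at[of p] \<open>p \<in> U\<close> assms(2) smooth_mapD by blast
qed

lemma smooth_map_const [simp, intro]: "smooth_map A U (\<lambda>x. k)"
  by (simp add: smooth_map_def comp_def)

lemma smooth_map_bounded_linear:
  "bounded_linear L \<Longrightarrow> openin (man_topology A) U \<Longrightarrow> smooth_map A U f \<Longrightarrow> smooth_map A U (\<lambda>x. L (f x))"
  using smooth_on_bounded_linear[OF _ open_image] by (fastforce simp: smooth_map_def comp_def)

lemma smooth_map_add:
  "openin (man_topology A) U \<Longrightarrow> smooth_map A U f \<Longrightarrow> smooth_map A U g \<Longrightarrow> smooth_map A U (\<lambda>x. f x + g x)"
  using smooth_on_add[OF open_image] by (fastforce simp: smooth_map_def comp_def)

lemma smooth_map_bilinear:
  "bounded_bilinear P \<Longrightarrow> openin (man_topology A) U \<Longrightarrow> smooth_map A U f \<Longrightarrow> smooth_map A U g \<Longrightarrow>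
    smooth_map A U (\<lambda>x. P (f x) (g x))"
  using smooth_on_bilinear[OF _ open_image] by (fastforce simp: smooth_map_def comp_def)

lemma smooth_map_Pair:
  "openin (man_topology A) U \<Longrightarrow> smooth_map A U f \<Longrightarrow> smooth_map A U g \<Longrightarrow> smooth_map A U (\<lambda>x. (f x, g x))"
  using smooth_on_Pair[OF open_image] by (fastforce simp: smooth_map_def comp_def)

lemma smooth_map_sum:
  "openin (man_topology A) U \<Longrightarrow> (\<And>i. i \<in> I \<Longrightarrow> smooth_map A U (f i)) \<Longrightarrow> smooth_map A U (\<lambda>x. \<Sum>i\<in>I. f i x)"
  unfolding smooth_map_def comp_def by (intro ballI smooth_on_sum open_image) auto

lemma smooth_map_scaleR:
  "openin (man_topology A) U \<Longrightarrow> smooth_map A U f \<Longrightarrow> smooth_map A U g \<Longrightarrow> smooth_map A U (\<lambda>x. f x *\<^sub>R g x)"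
  by (rule smooth_map_bilinear[OF bounded_bilinear_scaleR])

lemma smooth_map_minus: "openin (man_topology A) U \<Longrightarrow> smooth_map A U f \<Longrightarrow> smooth_map A U (\<lambda>x. - f x)"
  by (rule smooth_map_bounded_linear) (auto intro: bounded_linear_minus bounded_linear_ident)

lemma smooth_map_diff:
  "openin (man_topology A) U \<Longrightarrow> smooth_map A U f \<Longrightarrow> smooth_map A U g \<Longrightarrow> smooth_map A U (\<lambda>x. f x - g x)"
  using smooth_map_add[OF _ _ smooth_map_minus, of U f g] by simp

lemma smooth_map_linear_family:
  fixes L :: "'p \<Rightarrow> 'b::finite_coords \<Rightarrow> 'c::real_normed_vector"
  assumes U: "openin (man_topology A) U" and L: "\<And>x. x \<in> U \<Longrightarrow> linear (L x)" "\<And>w. smooth_map A U (\<lambda>x. L x w)"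
    and f: "smooth_map A U f"
  shows "smooth_map A U (\<lambda>x. L x (f x))"
  unfolding smooth_map_def
proof
  fix c assume c: "c \<in> A"
  have "smooth_on (snd c ` (U \<inter> fst c)) (\<lambda>u. L (chart_inv c u) ((f \<circ> chart_inv c) u))"
  proof (rule smooth_on_linear_family[OF open_image[OF U c]])
    show "linear (L (chart_inv c u))" if "u \<in> snd c ` (U \<inter> fst c)" for u
      using that L(1) c by auto
    show "smooth_on (snd c ` (U \<inter> fst c)) (\<lambda>u. L (chart_inv c u) w)" for w
      using smooth_mapD[OF L(2) c] by (simp add: comp_def)
  qed (rule smooth_mapD[OF f c])
  then show "smooth_on (snd c ` (U \<inter> fst c)) ((\<lambda>x. L x (f x)) \<circ> chart_inv c)"
    by (simp add: comp_def)
qed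

lemma smooth_map_blinfun:
  fixes f :: "'p \<Rightarrow> 'b::euclidean_space \<Rightarrow>\<^sub>L real"
  assumes U: "openin (man_topology A) U" "\<And>b. smooth_map A U (\<lambda>x. f x b)"
  shows "smooth_map A U f"
  unfolding smooth_map_def
proof
  fix c assume c: "c \<in> A"
  show "smooth_on (snd c ` (U \<inter> fst c)) (f \<circ> chart_inv c)"
    by (rule smooth_on_blinfun[OF open_image[OF U(1) c]])
      (use smooth_mapD[OF U(2) c] in \<open>simp add: comp_def\<close>)
qed

lemma smooth_map_has_derivative:
  assumes "smooth_map A U f" "p \<in> U" "c \<in> A" "p \<in> fst c"
  shows "((f \<circ> chart_inv c) has_derivative frechet_derivative (f \<circ> chart_inv c) (at (snd c p))) (at (snd c p))"
  using smooth_on_has_derivative[OF smooth_mapD[OF assms(1,3)]] assms(2,4) by blast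

lemma smooth_map_differentiable:
  assumes "smooth_map A U f" "p \<in> U" "c \<in> A" "p \<in> fst c"
  shows "(f \<circ> chart_inv c) differentiable (at (snd c p))"
  using smooth_map_has_derivative[OF assms] differentiable_def by blast

lemma smooth_map_chart: "c \<in> A \<Longrightarrow> smooth_map A (fst c) (snd c)"
  unfolding smooth_map_def using smooth_transition by (simp add: Int_commute)

section \<open>Derivatives in charts\<close>

lemma chart_change_derivative:
  assumes c: "c \<in> A" "p \<in> fst c" and d: "d \<in> A" "p \<in> fst d"
    and f: "(f \<circ> chart_inv c) differentiable (at (snd c p))"
  shows "((f \<circ> chart_inv d) has_derivative (\<lambda>w. frechet_derivative (f \<circ> chart_inv c) (at (snd c p))
      (frechet_derivative (snd c \<circ> chart_inv d) (at (snd d p)) w))) (at (snd d p))"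
proof (rule has_derivative_transform_within_open)
  have th: "((snd c \<circ> chart_inv d) has_derivative frechet_derivative (snd c \<circ> chart_inv d) (at (snd d p))) (at (snd d p))"
    by (rule smooth_map_has_derivative[OF smooth_map_chart[OF c(1)]]) (use c d in auto)
  have eq: "(snd c \<circ> chart_inv d) (snd d p) = snd c p" using d by simp
  show "((\<lambda>u. (f \<circ> chart_inv c) ((snd c \<circ> chart_inv d) u)) has_derivative (\<lambda>w. frechet_derivative (f \<circ> chart_inv c) (at (snd c p))
      (frechet_derivative (snd c \<circ> chart_inv d) (at (snd d p)) w))) (at (snd d p))"
    by (rule has_derivative_compose[OF th]) (use f[unfolded frechet_derivative_works] eq in \<open>simp only:\<close>)
  show "open (snd d ` (fst d \<inter> fst c))" using c d open_overlap by blast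
  show "snd d p \<in> snd d ` (fst d \<inter> fst c)" using c d by blast
  show "(f \<circ> chart_inv c) ((snd c \<circ> chart_inv d) u) = (f \<circ> chart_inv d) u"
    if "u \<in> snd d ` (fst d \<inter> fst c)" for u
    using that c d by auto
qed

text \<open>Frees \<open>dfun\<close> from the chart chosen at p: any chart c computes it, with
  \<open>tcoord\<close> translating the tangent vector. With c held fixed the result can be followed
  as p moves.\<close>

lemma dfun_chart:
  assumes c: "c \<in> A" "p \<in> fst c" and f: "(f \<circ> chart_inv c) differentiable (at (snd c p))"
  shows "dfun A f p w = frechet_derivative (f \<circ> chart_inv c) (at (snd c p)) (tcoord A c p w)"
proof -
  have d: "chart_at A p \<in> A" "p \<in> fst (chart_at A p)" using chart_at chart_in_points c by blast+
  have "((f \<circ> chart_inv (chart_at A p)) has_derivative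
      (\<lambda>w. frechet_derivative (f \<circ> chart_inv c) (at (snd c p)) (tcoord A c p w))) (at (snd (chart_at A p) p))"
    unfolding tcoord_def by (rule chart_change_derivative[OF c d f])
  then show ?thesis
    unfolding dfun_def
    by (simp add: frechet_derivative_eqI bounded_linear_Blinfun_apply has_derivative_bounded_linear)
qed

text \<open>Cocycle rule for tangent coordinates: by the chain rule, going from
  \<open>chart_at A p\<close> to d directly is the same as going through c.\<close>

lemma tcoord_transition:
  assumes c: "c \<in> A" "p \<in> fst c" and d: "d \<in> A" "p \<in> fst d"
  shows "tcoord A d p w = frechet_derivative (snd d \<circ> chart_inv c) (at (snd c p)) (tcoord A c p w)"
proof -
  have a: "chart_at A p \<in> A" "p \<in> fst (chart_at A p)" using chart_at chart_in_points c by blast+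
  have "(snd d \<circ> chart_inv c) differentiable (at (snd c p))"
    by (rule smooth_map_differentiable[OF smooth_map_chart[OF d(1)] d(2) c])
  from chart_change_derivative[OF c a this] show ?thesis
    unfolding tcoord_def by (simp add: frechet_derivative_eqI)
qed

lemma frechet_derivative_chart_self:
  assumes c: "c \<in> A" "p \<in> fst c"
  shows "frechet_derivative (snd c \<circ> chart_inv c) (at (snd c p)) = (\<lambda>w. w)"
proof -
  have "frechet_derivative (snd c \<circ> chart_inv c) (at (snd c p)) = frechet_derivative (\<lambda>u. u) (at (snd c p))"
    by (rule frechet_derivative_cong_open[OF open_chart_image[OF c(1)]]) (use c in auto)
  then show ?thesis by simp
qed

lemma tcoord_chart_at: "p \<in> points A \<Longrightarrow> tcoord A (chart_at A p) p = (\<lambda>w. w)"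
  unfolding tcoord_def using chart_at frechet_derivative_chart_self by blast

lemma linear_tcoord:
  assumes c: "c \<in> A" "p \<in> fst c"
  shows "linear (tcoord A c p)"
  unfolding tcoord_def using chart_at[OF chart_in_points[OF c]]
  by (intro linear_frechet_derivative smooth_map_differentiable[OF smooth_map_chart[OF c(1)] c(2)]) auto

lemma bij_tcoord:
  assumes c: "c \<in> A" "p \<in> fst c"
  shows "bij (tcoord A c p)"
proof (rule o_bij)
  let ?a = "chart_at A p"
  \<comment> \<open>The inverse is the differential of the reverse transition; the chain rule shows
    this on both sides.\<close>
  let ?g = "frechet_derivative (snd ?a \<circ> chart_inv c) (at (snd c p))"
  have p: "p \<in> points A" and a: "?a \<in> A" "p \<in> fst ?a" using chart_at chart_in_points c by blast+
  show "?g \<circ> tcoord A c p = id"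
    using tcoord_transition[OF c a] tcoord_chart_at[OF p] by (auto simp: fun_eq_iff)
  have "(snd c \<circ> chart_inv ?a) differentiable at (snd ?a p)"
    by (rule smooth_map_differentiable[OF smooth_map_chart[OF c(1)] c(2) a])
  from frechet_derivative_eqI[OF chart_change_derivative[OF a c this]]
  show "tcoord A c p \<circ> ?g = id"
    using frechet_derivative_chart_self[OF c] by (auto simp: fun_eq_iff tcoord_def)
qed

end

section \<open>Bundles with finite-dimensional fibres\<close>

lemma linear_inv_bij:
  assumes "linear f" "bij f" shows "linear (inv f)"
proof -
  have s: "f (inv f y) = y" for y using assms(2) by (simp add: bij_is_surj surj_f_inv_f)
  have "inv f (x + y) = inv f x + inv f y" for x y
    by (rule injD[OF bij_is_inj[OF assms(2)]]) (simp add: s linear_add[OF assms(1)])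
  moreover have "inv f (r *\<^sub>R x) = r *\<^sub>R inv f x" for r x
    by (rule injD[OF bij_is_inj[OF assms(2)]]) (simp add: s linear_scale[OF assms(1)])
  ultimately show ?thesis by (rule linearI)
qed

lemma bij_inv_simps:
  assumes "bij f" shows "f (inv f y) = y" "inv f (f x) = x"
  using assms by (simp_all add: bij_is_surj surj_f_inv_f bij_is_inj)

text \<open>\<open>vector_bundle\<close> over the wider class of fibres, so that dual bundles and
  sums with them, normed by the operator norm, are covered too.\<close>

definition smooth_bundle ::
  "('p, 'e::euclidean_space) chart set \<Rightarrow> ('p, 'v::finite_coords) triv set \<Rightarrow> bool" where
  "smooth_bundle A B \<longleftrightarrow>
     (\<Union>b\<in>B. fst b) = points A \<and>
     (\<forall>(U, t)\<in>B. openin (man_topology A) U \<and>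
        (\<forall>x\<in>U. linear (t x) \<and> bij (t x)) \<and>
        (\<forall>w. smooth_section A B U (\<lambda>x. inv (t x) w)))"

lemma vector_bundle_smooth_bundle: "vector_bundle A B \<Longrightarrow> smooth_bundle A B"
  by (simp add: vector_bundle_def smooth_bundle_def)

lemma smooth_sectionD:
  "smooth_section A B U s \<Longrightarrow> (U', t) \<in> B \<Longrightarrow> smooth_map A (U \<inter> U') (\<lambda>x. t x (s x))"
  by (auto simp: smooth_section_iff)

lemma smooth_section_subset: "smooth_section A B U s \<Longrightarrow> W \<subseteq> U \<Longrightarrow> smooth_section A B W s"
  unfolding smooth_section_def by (blast intro: smooth_on_subset)

lemma smooth_bundle_triv:
  assumes "smooth_bundle A B" "(U, t) \<in> B"
  shows "openin (man_topology A) U" "x \<in> U \<Longrightarrow> linear (t x)" "x \<in> U \<Longrightarrow> bij (t x)"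
    "smooth_section A B U (\<lambda>x. inv (t x) w)"
  using assms unfolding smooth_bundle_def by blast+

lemma smooth_bundle_cover:
  assumes "smooth_bundle A B" "p \<in> points A"
  obtains U t where "(U, t) \<in> B" "p \<in> U"
proof -
  have "p \<in> (\<Union>b\<in>B. fst b)" using assms unfolding smooth_bundle_def by simp
  then obtain b where "b \<in> B" "p \<in> fst b" by blast
  then show ?thesis using that[of "fst b" "snd b"] by simp
qed

lemma dual_triv_apply:
  fixes t :: "'p \<Rightarrow> 'v::finite_coords \<Rightarrow> 'v"
  assumes "linear (t x)" "bij (t x)"
  shows "dual_triv t x f v = f (inv (t x) v)"
  using linear_inv_bij[OF assms] by (simp add: dual_triv_def Blinfun_linear_apply)

lemma inv_dual_triv:
  fixes t :: "'p \<Rightarrow> 'v::finite_coords \<Rightarrow> 'v"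
  assumes "linear (t x)" "bij (t x)"
  shows "bij (dual_triv t x)" "inv (dual_triv t x) f = f o\<^sub>L Blinfun (t x)"
proof -
  let ?g = "\<lambda>f::'v \<Rightarrow>\<^sub>L real. f o\<^sub>L Blinfun (t x)"
  have 1: "dual_triv t x (?g f) = f" "?g (dual_triv t x f) = f" for f
    by (rule blinfun_eqI; simp add: dual_triv_apply[of t x, OF assms] Blinfun_linear_apply[OF assms(1)]
        bij_inv_simps[OF assms(2)])+
  show "bij (dual_triv t x)" by (rule o_bij[of ?g]) (auto simp: fun_eq_iff 1)
  then show "inv (dual_triv t x) f = ?g f" by (metis 1(1) bij_inv_simps(2))
qed

lemma linear_dual_triv: "linear (dual_triv t x)"
  unfolding dual_triv_def by (rule linearI; rule blinfun_eqI; simp add: blinfun.add_left blinfun.scaleR_left)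

lemma inv_pair_map:
  assumes "bij f" "bij g"
  shows "bij (\<lambda>(v, w). (f v, g w))" "inv (\<lambda>(v, w). (f v, g w)) z = (inv f (fst z), inv g (snd z))"
proof -
  show b: "bij (\<lambda>(v, w). (f v, g w))"
    by (rule o_bij[of "\<lambda>(v, w). (inv f v, inv g w)"]) (auto simp: fun_eq_iff bij_inv_simps assms)
  show "inv (\<lambda>(v, w). (f v, g w)) z = (inv f (fst z), inv g (snd z))"
    by (rule inv_f_eq[OF bij_is_inj[OF b]]) (auto simp: bij_inv_simps assms)
qed

lemma linear_pair_map: "linear f \<Longrightarrow> linear g \<Longrightarrow> linear (\<lambda>(v, w). (f v, g w))"
  by (rule linearI) (auto simp: linear_add linear_scale split: prod.split)

lemma sum_bundleI: "(U, t) \<in> B \<Longrightarrow> (U', t') \<in> C \<Longrightarrow> (U \<inter> U', \<lambda>x (v, w). (t x v, t' x w)) \<in> sum_bundle B C"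
  unfolding sum_bundle_def by force

lemma sum_bundleE:
  assumes "(W, r) \<in> sum_bundle B C"
  obtains U t U' t' where "(U, t) \<in> B" "(U', t') \<in> C" "W = U \<inter> U'" "r = (\<lambda>x (v, w). (t x v, t' x w))"
  using assms unfolding sum_bundle_def by auto

lemma dual_bundleI: "(U, t) \<in> B \<Longrightarrow> (U, dual_triv t) \<in> dual_bundle B"
  unfolding dual_bundle_def by force

lemma dual_bundleE:
  assumes "(U, r) \<in> dual_bundle B"
  obtains t where "(U, t) \<in> B" "r = dual_triv t"
  using assms unfolding dual_bundle_def by auto

section \<open>Smooth sections, bundle maps, dual and sum bundles\<close>

context atlas begin

lemma smooth_map_transform:
  "openin (man_topology A) U \<Longrightarrow> smooth_map A U f \<Longrightarrow> (\<And>p. p \<in> U \<Longrightarrow> f p = g p) \<Longrightarrow> smooth_map A U g"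
  using smooth_map_cong[of U f g] by blast

text \<open>The bundle axioms give smoothness of a frame change on constant vectors only; linearity
  in the fibre extends it to vectors that vary smoothly.\<close>

lemma smooth_bundle_frame_change:
  assumes "smooth_bundle A B" "(U, t) \<in> B" "(U', t') \<in> B" "smooth_map A W f"
    "openin (man_topology A) W" "W \<subseteq> U \<inter> U'"
  shows "smooth_map A W (\<lambda>x. t' x (inv (t x) (f x)))"
proof (rule smooth_map_linear_family[OF assms(5) _ _ assms(4)])
  show "linear (\<lambda>w. t' x (inv (t x) w))" if "x \<in> W" for x
    using linear_compose[OF linear_inv_bij, of "t x" "t' x"] smooth_bundle_triv(2,3)[OF assms(1,2), of x]
      smooth_bundle_triv(2)[OF assms(1,3), of x] assms(6) that
    by (auto simp: comp_def)
  show "smooth_map A W (\<lambda>x. t' x (inv (t x) w))" for w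
    by (rule smooth_map_subset[OF smooth_sectionD[OF smooth_bundle_triv(4)[OF assms(1,2)] assms(3)] assms(6)])
qed

text \<open>The definition tests a section in every trivialisation. One near each point is enough,
  because frame changes are smooth.\<close>

lemma smooth_sectionI:
  assumes B: "smooth_bundle A B" and U: "openin (man_topology A) U"
    and loc: "\<And>p. p \<in> U \<Longrightarrow> \<exists>W U' t. openin (man_topology A) W \<and> (U', t) \<in> B \<and> p \<in> W \<inter> U' \<and>
      smooth_map A (W \<inter> U') (\<lambda>x. t x (s x))"
  shows "smooth_section A B U s"
  unfolding smooth_section_iff
proof clarify
  fix U2 t2 assume t2: "(U2, t2) \<in> B"
  note o2 = smooth_bundle_triv(1)[OF B t2]
  show "smooth_map A (U \<inter> U2) (\<lambda>x. t2 x (s x))"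
  proof (rule smooth_map_local)
    show "U \<inter> U2 \<subseteq> points A" using openin_subset_points[OF U] by blast
    fix p assume p: "p \<in> U \<inter> U2"
    then obtain W U' t where W: "openin (man_topology A) W" "(U', t) \<in> B" "p \<in> W \<inter> U'"
      "smooth_map A (W \<inter> U') (\<lambda>x. t x (s x))" using loc by blast
    let ?W = "W \<inter> U' \<inter> U2"
    have oW: "openin (man_topology A) ?W" using W smooth_bundle_triv(1)[OF B] t2 by (auto intro: openin_Int)
    have "smooth_map A ?W (\<lambda>x. t2 x (inv (t x) (t x (s x))))"
      by (rule smooth_bundle_frame_change[OF B W(2) t2 smooth_map_subset[OF W(4)] oW]) auto
    then have "smooth_map A ?W (\<lambda>x. t2 x (s x))"
      by (rule smooth_map_transform[OF oW]) (simp add: bij_inv_simps[OF smooth_bundle_triv(3)[OF B W(2)]])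
    then show "\<exists>W. openin (man_topology A) W \<and> p \<in> W \<and> smooth_map A W (\<lambda>x. t2 x (s x))"
      using oW W(3) p by blast
  qed
qed

lemma smooth_section_transform:
  assumes "smooth_bundle A B" "openin (man_topology A) U" "smooth_section A B U s"
    "\<And>p. p \<in> U \<Longrightarrow> s p = s' p"
  shows "smooth_section A B U s'"
  unfolding smooth_section_iff
proof clarify
  fix U' t assume t: "(U', t) \<in> B"
  show "smooth_map A (U \<inter> U') (\<lambda>x. t x (s' x))"
    by (rule smooth_map_transform[OF _ smooth_sectionD[OF assms(3) t]])
      (use assms smooth_bundle_triv(1)[OF assms(1) t] in auto)
qed

lemma smooth_section_add:
  assumes B: "smooth_bundle A B" and U: "openin (man_topology A) U"
    and s: "smooth_section A B U s" "smooth_section A B U s'"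
  shows "smooth_section A B U (\<lambda>x. s x + s' x)"
  unfolding smooth_section_iff
proof clarify
  fix U' t assume t: "(U', t) \<in> B"
  have o: "openin (man_topology A) (U \<inter> U')" using U smooth_bundle_triv(1)[OF B t] by blast
  show "smooth_map A (U \<inter> U') (\<lambda>x. t x (s x + s' x))"
    by (rule smooth_map_transform[OF o smooth_map_add[OF o smooth_sectionD[OF s(1) t] smooth_sectionD[OF s(2) t]]])
      (simp add: linear_add[OF smooth_bundle_triv(2)[OF B t]])
qed

lemma smooth_section_scaleR:
  assumes B: "smooth_bundle A B" and U: "openin (man_topology A) U"
    and s: "smooth_map A U f" "smooth_section A B U s"
  shows "smooth_section A B U (\<lambda>x. f x *\<^sub>R s x)"
  unfolding smooth_section_iff
proof clarify
  fix U' t assume t: "(U', t) \<in> B"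
  have o: "openin (man_topology A) (U \<inter> U')" using U smooth_bundle_triv(1)[OF B t] by blast
  show "smooth_map A (U \<inter> U') (\<lambda>x. t x (f x *\<^sub>R s x))"
    by (rule smooth_map_transform[OF o smooth_map_scaleR[OF o smooth_map_subset[OF s(1)] smooth_sectionD[OF s(2) t]]])
      (auto simp: linear_scale[OF smooth_bundle_triv(2)[OF B t]])
qed

lemma smooth_section_minus:
  assumes "smooth_bundle A B" "openin (man_topology A) U" "smooth_section A B U s"
  shows "smooth_section A B U (\<lambda>x. - s x)"
  using smooth_section_scaleR[OF assms(1,2) smooth_map_const[of _ "-1"] assms(3)] by simp

lemma smooth_section_diff:
  assumes "smooth_bundle A B" "openin (man_topology A) U" "smooth_section A B U s" "smooth_section A B U s'"
  shows "smooth_section A B U (\<lambda>x. s x - s' x)"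
  using smooth_section_add[OF assms(1-3) smooth_section_minus[OF assms(1,2,4)]] by simp

lemma smooth_section_zero:
  assumes "smooth_bundle A B" "openin (man_topology A) U"
  shows "smooth_section A B U (\<lambda>x. 0)"
  unfolding smooth_section_iff
proof clarify
  fix U' t assume t: "(U', t) \<in> B"
  have o: "openin (man_topology A) (U \<inter> U')" using assms smooth_bundle_triv(1)[OF assms(1) t] by blast
  show "smooth_map A (U \<inter> U') (\<lambda>x. t x 0)"
    by (rule smooth_map_transform[OF o smooth_map_const[of _ 0]])
      (auto simp: linear_0[OF smooth_bundle_triv(2)[OF assms(1) t]])
qed

lemma smooth_section_sum:
  assumes "smooth_bundle A B" "openin (man_topology A) U" "\<And>i. i \<in> I \<Longrightarrow> smooth_section A B U (s i)"
  shows "smooth_section A B U (\<lambda>x. \<Sum>i\<in>I. s i x)"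
  using assms(3)
  by (induction I rule: infinite_finite_induct)
    (auto intro: smooth_section_zero[OF assms(1,2)] smooth_section_add[OF assms(1,2)])

text \<open>\<open>smooth_hom\<close> tests \<Phi> on frame sections only. Inserting
  \<open>t x\<close> and its inverse shows a general section as the frame applied to its smooth
  coordinates, on which \<Phi> acts as a smooth linear family.\<close>

lemma smooth_hom_apply:
  assumes B: "smooth_bundle A B" and C: "smooth_bundle A C" and h: "smooth_hom A B C \<Phi>"
    and U: "openin (man_topology A) U" and s: "smooth_section A B U s"
  shows "smooth_section A C U (\<lambda>x. \<Phi> x (s x))"
proof (rule smooth_sectionI[OF C U])
  fix p assume p: "p \<in> U"
  have pA: "p \<in> points A" using p openin_subset_points[OF U] by blast
  obtain U1 t where t: "(U1, t) \<in> B" "p \<in> U1" using smooth_bundle_cover[OF B pA] by blast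
  obtain U2 r where r: "(U2, r) \<in> C" "p \<in> U2" using smooth_bundle_cover[OF C pA] by blast
  let ?W = "U \<inter> U1 \<inter> U2"
  note o = smooth_bundle_triv(1)[OF B t(1)] smooth_bundle_triv(1)[OF C r(1)]
  have oW: "openin (man_topology A) ?W" using U o by blast
  have "smooth_map A ?W (\<lambda>x. r x (\<Phi> x (inv (t x) (t x (s x)))))"
  proof (rule smooth_map_linear_family[OF oW, of "\<lambda>x w. r x (\<Phi> x (inv (t x) w))"])
    show "linear (\<lambda>w. r x (\<Phi> x (inv (t x) w)))" if "x \<in> ?W" for x
    proof -
      have "linear (\<Phi> x)" using h that openin_subset_points[OF U] unfolding smooth_hom_def by blast
      then show ?thesis
        using linear_compose[OF linear_compose[OF linear_inv_bij]] smooth_bundle_triv(2,3)[OF B t(1)]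
          smooth_bundle_triv(2)[OF C r(1)] that
        by (fastforce simp: comp_def)
    qed
    have "smooth_section A C U1 (\<lambda>x. \<Phi> x (inv (t x) w))" for w
      using h t unfolding smooth_hom_def by blast
    then show "smooth_map A ?W (\<lambda>x. r x (\<Phi> x (inv (t x) w)))" for w
      by (rule smooth_map_subset[OF smooth_sectionD[OF _ r(1)]]) auto
    show "smooth_map A ?W (\<lambda>x. t x (s x))"
      by (rule smooth_map_subset[OF smooth_sectionD[OF s t(1)]]) auto
  qed
  then have "smooth_map A ?W (\<lambda>x. r x (\<Phi> x (s x)))"
    by (rule smooth_map_transform[OF oW]) (simp add: bij_inv_simps[OF smooth_bundle_triv(3)[OF B t(1)]])
  then show "\<exists>W U' t. openin (man_topology A) W \<and> (U', t) \<in> C \<and> p \<in> W \<inter> U' \<and>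
      smooth_map A (W \<inter> U') (\<lambda>x. t x (\<Phi> x (s x)))"
    using oW p t r by (intro exI[of _ "?W"] exI[of _ U2] exI[of _ r]) (simp add: Int_absorb2)
qed

lemma smooth_homI:
  assumes "smooth_bundle A B" "\<And>p. p \<in> points A \<Longrightarrow> linear (\<Phi> p)"
    and "\<And>U s. openin (man_topology A) U \<Longrightarrow> smooth_section A B U s \<Longrightarrow> smooth_section A C U (\<lambda>x. \<Phi> x (s x))"
  shows "smooth_hom A B C \<Phi>"
  unfolding smooth_hom_def
proof (intro conjI ballI)
  fix b assume b: "b \<in> B"
  obtain U t where t: "b = (U, t)" "(U, t) \<in> B" using b by (cases b) simp
  show "case b of (U, t) \<Rightarrow> \<forall>w. smooth_section A C U (\<lambda>x. \<Phi> x (inv (t x) w))"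
    using assms(3)[OF smooth_bundle_triv(1,4)[OF assms(1) t(2)]] t(1) by simp
qed (rule assms(2))

lemma smooth_bundle_dual:
  fixes B :: "('p, 'v::euclidean_space) triv set"
  assumes B: "smooth_bundle A B" shows "smooth_bundle A (dual_bundle B)"
  unfolding smooth_bundle_def
proof (intro conjI ballI)
  show "(\<Union>b\<in>dual_bundle B. fst b) = points A"
    using B unfolding smooth_bundle_def dual_bundle_def by (simp add: case_prod_beta)
  fix b assume "b \<in> dual_bundle B"
  then obtain U t where t: "(U, t) \<in> B" "b = (U, dual_triv t)" by (metis dual_bundleE surj_pair)
  note lb = smooth_bundle_triv[OF B]
  have "smooth_section A (dual_bundle B) U (\<lambda>x. inv (dual_triv t x) f)" for f
    unfolding smooth_section_iff
  proof clarify
    fix U' r assume "(U', r) \<in> dual_bundle B"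
    then obtain t' where t': "(U', t') \<in> B" "r = dual_triv t'" by (rule dual_bundleE)
    have o: "openin (man_topology A) (U \<inter> U')" using lb(1) t t' by blast
    show "smooth_map A (U \<inter> U') (\<lambda>x. r x (inv (dual_triv t x) f))"
    proof (rule smooth_map_blinfun[OF o])
      fix b
      \<comment> \<open>In the dual bundle the change of frame from t to t' is composition with the
        change from t' back to t.\<close>
      have "smooth_map A (U \<inter> U') (\<lambda>x. f (t x (inv (t' x) b)))"
        by (intro smooth_map_bounded_linear[OF blinfun.bounded_linear_right o]
            smooth_bundle_frame_change[OF B t'(1) t(1)] o) auto
      then show "smooth_map A (U \<inter> U') (\<lambda>x. blinfun_apply (r x (inv (dual_triv t x) f)) b)"
        by (rule smooth_map_transform[OF o])
          (auto simp: t'(2) dual_triv_apply inv_dual_triv lb(2,3)[OF t(1)] lb(2,3)[OF t'(1)] Blinfun_linear_apply)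
    qed
  qed
  then show "case b of (U, t) \<Rightarrow> openin (man_topology A) U \<and> (\<forall>x\<in>U. linear (t x) \<and> bij (t x)) \<and>
        (\<forall>w. smooth_section A (dual_bundle B) U (\<lambda>x. inv (t x) w))"
    using lb t by (auto simp: linear_dual_triv inv_dual_triv)
qed

lemma smooth_section_sum_bundle_iff:
  assumes B: "smooth_bundle A B" and C: "smooth_bundle A C" and U: "openin (man_topology A) U"
  shows "smooth_section A (sum_bundle B C) U s \<longleftrightarrow>
    smooth_section A B U (\<lambda>x. fst (s x)) \<and> smooth_section A C U (\<lambda>x. snd (s x))"
proof (intro iffI conjI)
  assume s: "smooth_section A (sum_bundle B C) U s"
  have ex: "\<exists>U1 t U2 r. (U1, t) \<in> B \<and> (U2, r) \<in> C \<and> p \<in> U1 \<inter> U2 \<and> openin (man_topology A) (U \<inter> (U1 \<inter> U2)) \<and>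
      smooth_map A (U \<inter> (U1 \<inter> U2)) (\<lambda>x. (t x (fst (s x)), r x (snd (s x))))" if p: "p \<in> U" for p
  proof -
    have pA: "p \<in> points A" using p openin_subset_points[OF U] by blast
    obtain U1 t where t: "(U1, t) \<in> B" "p \<in> U1" using smooth_bundle_cover[OF B pA] by blast
    obtain U2 r where r: "(U2, r) \<in> C" "p \<in> U2" using smooth_bundle_cover[OF C pA] by blast
    show ?thesis
      using smooth_sectionD[OF s sum_bundleI[OF t(1) r(1)]] t r U
        smooth_bundle_triv(1)[OF B t(1)] smooth_bundle_triv(1)[OF C r(1)]
      by (intro exI[of _ U1] exI[of _ t] exI[of _ U2] exI[of _ r]) (auto simp: case_prod_beta)
  qed
  show "smooth_section A B U (\<lambda>x. fst (s x))"
  proof (rule smooth_sectionI[OF B U])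
    fix p assume p: "p \<in> U"
    obtain U1 t U2 r where *: "(U1, t) \<in> B" "p \<in> U1 \<inter> U2" "openin (man_topology A) (U \<inter> (U1 \<inter> U2))"
      "smooth_map A (U \<inter> (U1 \<inter> U2)) (\<lambda>x. (t x (fst (s x)), r x (snd (s x))))" "(U2, r) \<in> C" using ex[OF p] by blast
    have "smooth_map A (U \<inter> (U1 \<inter> U2)) (\<lambda>x. t x (fst (s x)))"
      using smooth_map_bounded_linear[OF bounded_linear_fst *(3,4)] by simp
    moreover have "U \<inter> (U1 \<inter> U2) \<inter> U1 = U \<inter> (U1 \<inter> U2)" by blast
    ultimately show "\<exists>W U' t. openin (man_topology A) W \<and> (U', t) \<in> B \<and> p \<in> W \<inter> U' \<and>
      smooth_map A (W \<inter> U') (\<lambda>x. t x (fst (s x)))"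
      using * p by (intro exI[of _ "U \<inter> (U1 \<inter> U2)"] exI[of _ U1] exI[of _ t]) simp
  qed
  show "smooth_section A C U (\<lambda>x. snd (s x))"
  proof (rule smooth_sectionI[OF C U])
    fix p assume p: "p \<in> U"
    obtain U1 t U2 r where *: "(U2, r) \<in> C" "p \<in> U1 \<inter> U2" "openin (man_topology A) (U \<inter> (U1 \<inter> U2))"
      "smooth_map A (U \<inter> (U1 \<inter> U2)) (\<lambda>x. (t x (fst (s x)), r x (snd (s x))))" "(U1, t) \<in> B" using ex[OF p] by blast
    have "smooth_map A (U \<inter> (U1 \<inter> U2)) (\<lambda>x. r x (snd (s x)))"
      using smooth_map_bounded_linear[OF bounded_linear_snd *(3,4)] by simp
    moreover have "U \<inter> (U1 \<inter> U2) \<inter> U2 = U \<inter> (U1 \<inter> U2)" by blast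
    ultimately show "\<exists>W U' t. openin (man_topology A) W \<and> (U', t) \<in> C \<and> p \<in> W \<inter> U' \<and>
      smooth_map A (W \<inter> U') (\<lambda>x. t x (snd (s x)))"
      using * p by (intro exI[of _ "U \<inter> (U1 \<inter> U2)"] exI[of _ U2] exI[of _ r]) simp
  qed
next
  assume s: "smooth_section A B U (\<lambda>x. fst (s x)) \<and> smooth_section A C U (\<lambda>x. snd (s x))"
  show "smooth_section A (sum_bundle B C) U s"
    unfolding smooth_section_iff
  proof clarify
    fix W q assume "(W, q) \<in> sum_bundle B C"
    then obtain U1 t U2 r where *: "(U1, t) \<in> B" "(U2, r) \<in> C" "W = U1 \<inter> U2" "q = (\<lambda>x (v, w). (t x v, r x w))"
      by (rule sum_bundleE)
    have o: "openin (man_topology A) (U \<inter> W)"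
      using U *(3) smooth_bundle_triv(1)[OF B *(1)] smooth_bundle_triv(1)[OF C *(2)] by blast
    have "smooth_map A (U \<inter> W) (\<lambda>x. (t x (fst (s x)), r x (snd (s x))))"
      using s *(3) by (intro smooth_map_Pair[OF o] smooth_map_subset[OF smooth_sectionD[OF _ *(1)]]
        smooth_map_subset[OF smooth_sectionD[OF _ *(2)]]) auto
    then show "smooth_map A (U \<inter> W) (\<lambda>x. q x (s x))" by (simp add: *(4) case_prod_beta)
  qed
qed

lemma smooth_bundle_sum:
  assumes B: "smooth_bundle A B" and C: "smooth_bundle A C" shows "smooth_bundle A (sum_bundle B C)"
  unfolding smooth_bundle_def
proof (intro conjI ballI)
  have "(\<Union>b\<in>sum_bundle B C. fst b) = (\<Union>z\<in>B \<times> C. fst (fst z) \<inter> fst (snd z))"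
    unfolding sum_bundle_def by (simp add: case_prod_beta)
  also have "\<dots> = (\<Union>b\<in>B. fst b) \<inter> (\<Union>c\<in>C. fst c)"
    unfolding Sigma_def by simp
  also have "\<dots> = points A" using B C unfolding smooth_bundle_def by simp
  finally show "(\<Union>b\<in>sum_bundle B C. fst b) = points A" .
  fix b assume "b \<in> sum_bundle B C"
  then obtain W q where q: "b = (W, q)" "(W, q) \<in> sum_bundle B C" by (cases b) simp
  from q(2) obtain U t U' r where t: "(U, t) \<in> B" and r: "(U', r) \<in> C"
    and Wq: "W = U \<inter> U'" "q = (\<lambda>x (v, w). (t x v, r x w))" by (rule sum_bundleE)
  have b: "b = (U \<inter> U', \<lambda>x (v, w). (t x v, r x w))" using q(1) Wq by simp
  note lb = smooth_bundle_triv[OF B t] and lc = smooth_bundle_triv[OF C r]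
  have o: "openin (man_topology A) (U \<inter> U')" using lb(1) lc(1) by blast
  have "smooth_section A (sum_bundle B C) (U \<inter> U') (\<lambda>x. inv (\<lambda>(v, w). (t x v, r x w)) z)" for z
  proof -
    note eq = inv_pair_map(2)[OF lb(3) lc(3), of _ _ z]
    have "smooth_section A B (U \<inter> U') (\<lambda>x. fst (inv (\<lambda>(v, w). (t x v, r x w)) z))"
      by (rule smooth_section_transform[OF B o smooth_section_subset[OF lb(4)[of "fst z"]]]) (simp_all add: eq)
    moreover have "smooth_section A C (U \<inter> U') (\<lambda>x. snd (inv (\<lambda>(v, w). (t x v, r x w)) z))"
      by (rule smooth_section_transform[OF C o smooth_section_subset[OF lc(4)[of "snd z"]]]) (simp_all add: eq)
    ultimately show ?thesis by (simp add: smooth_section_sum_bundle_iff[OF B C o])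
  qed
  then show "case b of (U, t) \<Rightarrow> openin (man_topology A) U \<and> (\<forall>x\<in>U. linear (t x) \<and> bij (t x)) \<and>
        (\<forall>w. smooth_section A (sum_bundle B C) U (\<lambda>x. inv (t x) w))"
    using o by (auto simp: b lb lc intro!: linear_pair_map inv_pair_map)
qed

text \<open>In a trivialisation the pairing is the evaluation of one coordinate expression on the
  other: the inverse of t in \<open>dual_triv\<close> cancels t.\<close>

lemma smooth_section_dual_apply:
  fixes B :: "('p, 'v::euclidean_space) triv set"
  assumes B: "smooth_bundle A B" and U: "openin (man_topology A) U"
    and f: "smooth_section A (dual_bundle B) U f" and s: "smooth_section A B U s"
  shows "smooth_map A U (\<lambda>x. f x (s x))"
proof (rule smooth_map_local)
  fix p assume p: "p \<in> U"
  obtain U1 t where t: "(U1, t) \<in> B" "p \<in> U1" using smooth_bundle_cover[OF B] openin_subset_points[OF U] p by blast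
  have o: "openin (man_topology A) (U \<inter> U1)" using U smooth_bundle_triv(1)[OF B t(1)] by blast
  have "smooth_map A (U \<inter> U1) (\<lambda>x. blinfun_apply (dual_triv t x (f x)) (t x (s x)))"
    by (rule smooth_map_bilinear[OF bounded_bilinear_blinfun_apply o
          smooth_sectionD[OF f dual_bundleI[OF t(1)]] smooth_sectionD[OF s t(1)]])
  then have "smooth_map A (U \<inter> U1) (\<lambda>x. f x (s x))"
    by (rule smooth_map_transform[OF o])
      (simp add: dual_triv_apply smooth_bundle_triv[OF B t(1)] bij_inv_simps)
  then show "\<exists>W. openin (man_topology A) W \<and> p \<in> W \<and> smooth_map A W (\<lambda>x. f x (s x))"
    using o p t by blast
qed (rule openin_subset_points[OF U])

text \<open>The coordinate expression of f in the dual trivialisation, evaluated at w, is the value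
  of f on the frame section of w.\<close>

lemma smooth_section_dualI:
  fixes B :: "('p, 'v::euclidean_space) triv set" and f :: "'p \<Rightarrow> 'v \<Rightarrow>\<^sub>L real"
  assumes B: "smooth_bundle A B" and U: "openin (man_topology A) U"
    and f: "\<And>U' t w. (U', t) \<in> B \<Longrightarrow> smooth_map A (U \<inter> U') (\<lambda>x. f x (inv (t x) w))"
  shows "smooth_section A (dual_bundle B) U f"
  unfolding smooth_section_iff
proof clarify
  fix U' r assume "(U', r) \<in> dual_bundle B"
  then obtain t where t: "(U', t) \<in> B" "r = dual_triv t" by (rule dual_bundleE)
  have o: "openin (man_topology A) (U \<inter> U')" using U smooth_bundle_triv(1)[OF B t(1)] by blast
  show "smooth_map A (U \<inter> U') (\<lambda>x. r x (f x))"
  proof (rule smooth_map_blinfun[OF o])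
    show "smooth_map A (U \<inter> U') (\<lambda>x. r x (f x) b)" for b
      by (rule smooth_map_transform[OF o f[OF t(1), of b]])
        (simp add: t(2) dual_triv_apply smooth_bundle_triv[OF B t(1)])
  qed
qed

end

section \<open>Images of bundle isomorphisms\<close>

lemma connectionD:
  assumes "connection A B E nab" "openin (man_topology A) U" "section_of A B E U s"
  shows "p \<in> U \<Longrightarrow> linear (nab s p)"
    and "vector_field A U X \<Longrightarrow> section_of A B E U (\<lambda>p. nab s p (X p))"
    and "section_of A B E U s' \<Longrightarrow> (\<And>p. p \<in> U \<Longrightarrow> s p = s' p) \<Longrightarrow> p \<in> U \<Longrightarrow> nab s p = nab s' p"
    and "section_of A B E U s' \<Longrightarrow> p \<in> U \<Longrightarrow> nab (\<lambda>q. s q + s' q) p Y = nab s p Y + nab s' p Y"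
    and "smooth_fun A U f \<Longrightarrow> p \<in> U \<Longrightarrow>
      nab (\<lambda>q. f q *\<^sub>R s q) p Y = dfun A f p Y *\<^sub>R s p + f p *\<^sub>R nab s p Y"
  using assms(1)[unfolded connection_def, rule_format, OF assms(2)] assms(3) by simp_all

lemma section_of_UNIV: "section_of A B (\<lambda>_. UNIV) U s = smooth_section A B U s"
  unfolding section_of_def by simp

text \<open>\<open>subbundle\<close> asks for frames numbered by naturals. The vectors
  \<open>e i\<close> of the class span, so a maximal independent set is finite and can be
  numbered.\<close>

lemma ex_nat_basis:
  "\<exists>k (b::nat \<Rightarrow> 'a::finite_coords). inj_on b {..<k} \<and> independent (b ` {..<k}) \<and> span (b ` {..<k}) = UNIV"
proof -
  obtain n :: nat and e :: "nat \<Rightarrow> 'a" and c where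
    e: "\<And>x. x = (\<Sum>i<n. c i x *\<^sub>R e i)" using ex_nat_coords by blast
  have "x \<in> span (e ` {..<n})" for x
    by (subst e[of x]) (intro span_sum span_scale span_base, simp)
  then have sp: "span (e ` {..<n}) = UNIV" by blast
  obtain S :: "'a set" where S: "S \<subseteq> UNIV" "independent S" "UNIV \<subseteq> span S"
    by (rule maximal_independent_subset)
  have "finite S" using independent_span_bound[of "e ` {..<n}" S] S(2) sp by simp
  then obtain b where "bij_betw b {..<card S} S"
    using ex_bij_betw_nat_finite by (metis atLeast0LessThan)
  then show ?thesis using S(2,3) unfolding bij_betw_def by (metis top.extremum_uniqueI)
qed

context atlas begin

text \<open>A fibrewise injective bundle map carries a local frame of B to a local frame of its
  image.\<close>

lemma bundle_iso_onto_subbundle: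
  fixes B :: "('p, 'v::finite_coords) triv set"
  assumes B: "smooth_bundle A B" and iso: "bundle_iso_onto A B C E \<Phi>"
  shows "subbundle A C E"
  unfolding subbundle_def
proof
  fix p assume "p \<in> points A"
  then obtain U t where t: "(U, t) \<in> B" "p \<in> U" using smooth_bundle_cover[OF B] by blast
  note lb = smooth_bundle_triv[OF B t(1)]
  obtain k and b :: "nat \<Rightarrow> 'v" where
    b: "inj_on b {..<k}" "independent (b ` {..<k})" "span (b ` {..<k}) = UNIV"
    using ex_nat_basis[where 'a = 'v] by blast
  let ?s = "\<lambda>i x. \<Phi> x (inv (t x) (b i))"
  have "smooth_section A C U (?s i)" for i
    using iso t unfolding bundle_iso_onto_def smooth_hom_def by blast
  moreover have "inj_on (\<lambda>i. ?s i q) {..<k} \<and> independent ((\<lambda>i. ?s i q) ` {..<k}) \<and>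
      span ((\<lambda>i. ?s i q) ` {..<k}) = E q" if q: "q \<in> U" for q
  proof -
    let ?L = "\<lambda>v. \<Phi> q (inv (t q) v)"
    have qA: "q \<in> points A" using q openin_subset_points[OF lb(1)] by blast
    have bb: "bij_betw (\<Phi> q) UNIV (E q)" "linear (\<Phi> q)"
      using iso qA unfolding bundle_iso_onto_def smooth_hom_def by auto
    have "bij (inv (t q))" using lb(3)[OF q] by (rule bij_imp_bij_inv)
    then have L: "inj ?L" "range ?L = E q"
      using bij_betw_trans[OF _ bb(1), of "inv (t q)" UNIV] by (auto simp: bij_betw_def comp_def)
    have lin: "linear ?L"
      using linear_compose[OF linear_inv_bij[OF lb(2,3)[OF q]] bb(2)] by (simp add: comp_def)
    have im: "(\<lambda>i. ?s i q) ` {..<k} = ?L ` b ` {..<k}" by auto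
    have "inj_on (\<lambda>i. ?s i q) {..<k}"
      using b(1) L(1) by (auto simp: inj_on_def)
    moreover have "independent (?L ` b ` {..<k})"
      using b(2) linear_independent_injective_image[OF lin _ inj_on_subset[OF L(1)]] by auto
    moreover have "span (?L ` b ` {..<k}) = E q"
      using linear_span_image[OF lin, of "b ` {..<k}"] b(3) L(2) by simp
    ultimately show ?thesis unfolding im by blast
  qed
  ultimately show "\<exists>U k s. openin (man_topology A) U \<and> p \<in> U \<and> (\<forall>i<k::nat. smooth_section A C U (s i)) \<and>
    (\<forall>q\<in>U. inj_on (\<lambda>i. s i q) {..<k} \<and> independent ((\<lambda>i. s i q) ` {..<k}) \<and> span ((\<lambda>i. s i q) ` {..<k}) = E q)"
    using lb(1) t(2) by - (rule exI[of _ U], rule exI[of _ k], rule exI[of _ ?s], simp)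
qed

text \<open>Axioms and curvature pass through conjugation by \<Phi>. Smoothness of the pulled-back
  sections has to be assumed: \<open>inv (\<Phi> q)\<close> is meaningful on \<open>E q\<close>
  only, so it is not a bundle map on all of C to which \<open>smooth_hom\<close> could
  apply.\<close>

lemma flat_connection_transport:
  assumes B: "smooth_bundle A B" and C: "smooth_bundle A C"
    and iso: "bundle_iso_onto A B C E \<Phi>"
    and inv_smooth: "\<And>U \<delta>. openin (man_topology A) U \<Longrightarrow> section_of A C E U \<delta> \<Longrightarrow>
      smooth_section A B U (\<lambda>q. inv (\<Phi> q) (\<delta> q))"
    and nab: "flat_connection A B (\<lambda>_. UNIV) nab"
  shows "flat_connection A C E (transport_conn \<Phi> nab)"
proof -
  have hom: "smooth_hom A B C \<Phi>" and bij: "p \<in> points A \<Longrightarrow> bij_betw (\<Phi> p) UNIV (E p)" for p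
    using iso unfolding bundle_iso_onto_def by blast+
  have lin: "linear (\<Phi> p)" if "p \<in> points A" for p using hom that unfolding smooth_hom_def by blast
  have inE: "\<Phi> p v \<in> E p" if "p \<in> points A" for p v using bij[OF that] bij_betwE by blast
  have ii: "inv (\<Phi> p) (\<Phi> p v) = v" if "p \<in> points A" for p v
    using bij[OF that] by (simp add: bij_betw_def)
  have fi: "\<Phi> p (inv (\<Phi> p) y) = y" if "p \<in> points A" "y \<in> E p" for p y
    using bij[OF that(1)] that(2) by (simp add: bij_betw_def f_inv_into_f)
  have conn: "connection A B (\<lambda>_. UNIV) nab" and fl: "flat A B (\<lambda>_. UNIV) nab"
    using nab unfolding flat_connection_def by auto
  note sec = section_of_UNIV
  define I where "I = (\<lambda>\<delta> q. inv (\<Phi> q) (\<delta> q))"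
  have I: "smooth_section A B U (I \<delta>)" if "openin (man_topology A) U" "section_of A C E U \<delta>" for U \<delta>
    using inv_smooth[OF that] unfolding I_def .
  have T: "transport_conn \<Phi> nab \<delta> p X = \<Phi> p (nab (I \<delta>) p X)" for \<delta> p X
    unfolding transport_conn_def I_def ..
  have T_abs: "transport_conn \<Phi> nab \<delta> p = (\<lambda>X. \<Phi> p (nab (I \<delta>) p X))" for \<delta> p
    by (rule ext) (rule T)
  \<comment> \<open>Pulling back respects sums, multiples and \<Phi> over U only. Locality of
    \<open>nab\<close> absorbs the arbitrary values elsewhere.\<close>
  have loc: "nab s p = nab s' p" if "openin (man_topology A) U" "smooth_section A B U s"
    "smooth_section A B U s'" "\<And>p. p \<in> U \<Longrightarrow> s p = s' p" "p \<in> U" for U s s' p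
    using connectionD(3)[OF conn, unfolded sec] that by blast
  have sm: "smooth_section A B U (\<lambda>p. nab s p (X p))" if "openin (man_topology A) U" "smooth_section A B U s"
    "vector_field A U X" for U s X
    using connectionD(2)[OF conn, unfolded sec] that by blast
  show ?thesis
    unfolding flat_connection_def connection_def flat_def
  proof (intro conjI allI impI ballI)
    fix U assume U: "openin (man_topology A) U"
    note pA = subsetD[OF openin_subset_points[OF U]]
    {
      fix \<delta> assume d: "section_of A C E U \<delta>"
      fix p assume p: "p \<in> U"
      have "linear (nab (I \<delta>) p)" using connectionD(1)[OF conn U, unfolded sec, OF I[OF U d] p] .
      then show "linear (transport_conn \<Phi> nab \<delta> p)"
        using linear_compose[OF _ lin[OF pA[OF p]], of "nab (I \<delta>) p"] by (simp add: T_abs comp_def)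
    next
      fix \<delta> X assume d: "section_of A C E U \<delta>" and X: "vector_field A U X"
      show "section_of A C E U (\<lambda>p. transport_conn \<Phi> nab \<delta> p (X p))"
        unfolding section_of_def T
        using smooth_hom_apply[OF B C hom U sm[OF U I[OF U d] X]] inE pA by blast
    next
      fix \<delta> \<delta>' assume d: "section_of A C E U \<delta> \<and> section_of A C E U \<delta>' \<and> (\<forall>p\<in>U. \<delta> p = \<delta>' p)"
      fix p assume p: "p \<in> U"
      have "nab (I \<delta>) p = nab (I \<delta>') p"
        using d by (intro loc[OF U I[OF U] I[OF U] _ p]) (auto simp: I_def)
      then show "transport_conn \<Phi> nab \<delta> p = transport_conn \<Phi> nab \<delta>' p" by (auto simp: T)
    next
      fix \<delta> \<delta>' assume d: "section_of A C E U \<delta> \<and> section_of A C E U \<delta>'"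
      fix p X assume p: "p \<in> U"
      have eq: "I (\<lambda>q. \<delta> q + \<delta>' q) q = I \<delta> q + I \<delta>' q" if "q \<in> U" for q
      proof -
        have "\<delta> q + \<delta>' q = \<Phi> q (I \<delta> q + I \<delta>' q)"
          using d that fi[OF pA[OF that]] by (simp add: I_def linear_add[OF lin[OF pA[OF that]]] section_of_def)
        then show ?thesis using ii[OF pA[OF that]] by (simp add: I_def)
      qed
      have s: "smooth_section A B U (\<lambda>q. I \<delta> q + I \<delta>' q)"
        using d I[OF U] by (intro smooth_section_add[OF B U]) auto
      have "nab (I (\<lambda>q. \<delta> q + \<delta>' q)) p = nab (\<lambda>q. I \<delta> q + I \<delta>' q) p"
        by (rule loc[OF U smooth_section_transform[OF B U s] s eq p]) (simp add: eq)
      moreover have "nab (\<lambda>q. I \<delta> q + I \<delta>' q) p X = nab (I \<delta>) p X + nab (I \<delta>') p X"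
        using connectionD(4)[OF conn U, unfolded sec] I[OF U] d p by blast
      ultimately show "transport_conn \<Phi> nab (\<lambda>q. \<delta> q + \<delta>' q) p X =
          transport_conn \<Phi> nab \<delta> p X + transport_conn \<Phi> nab \<delta>' p X"
        by (simp add: T linear_add[OF lin[OF pA[OF p]]])
    next
      fix f \<delta> assume d: "smooth_fun A U f \<and> section_of A C E U \<delta>"
      fix p X assume p: "p \<in> U"
      have eq: "I (\<lambda>q. f q *\<^sub>R \<delta> q) q = f q *\<^sub>R I \<delta> q" if "q \<in> U" for q
      proof -
        have "f q *\<^sub>R \<delta> q = \<Phi> q (f q *\<^sub>R I \<delta> q)"
          using d that fi[OF pA[OF that]] by (simp add: I_def linear_scale[OF lin[OF pA[OF that]]] section_of_def)
        then show ?thesis using ii[OF pA[OF that]] by (simp add: I_def)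
      qed
      have s: "smooth_section A B U (\<lambda>q. f q *\<^sub>R I \<delta> q)"
        using d I[OF U] by (intro smooth_section_scaleR[OF B U]) (auto simp: smooth_fun_iff_map)
      have "nab (I (\<lambda>q. f q *\<^sub>R \<delta> q)) p = nab (\<lambda>q. f q *\<^sub>R I \<delta> q) p"
        by (rule loc[OF U smooth_section_transform[OF B U s] s eq p]) (simp add: eq)
      moreover have "nab (\<lambda>q. f q *\<^sub>R I \<delta> q) p X = dfun A f p X *\<^sub>R I \<delta> p + f p *\<^sub>R nab (I \<delta>) p X"
        using connectionD(5)[OF conn U, unfolded sec] I[OF U] d p by blast
      moreover have "\<Phi> p (I \<delta> p) = \<delta> p" using fi[OF pA[OF p]] d p by (simp add: I_def section_of_def)
      ultimately show "transport_conn \<Phi> nab (\<lambda>q. f q *\<^sub>R \<delta> q) p X =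
          dfun A f p X *\<^sub>R \<delta> p + f p *\<^sub>R transport_conn \<Phi> nab \<delta> p X"
        by (simp add: T linear_add[OF lin[OF pA[OF p]]] linear_scale[OF lin[OF pA[OF p]]])
    }
  next
    fix U X Y \<delta> p
    assume a: "openin (man_topology A) U \<and> vector_field A U X \<and> vector_field A U Y \<and> section_of A C E U \<delta>"
      and p: "p \<in> U"
    then have U: "openin (man_topology A) U" and d: "section_of A C E U \<delta>" by auto
    note pA = subsetD[OF openin_subset_points[OF U]]
    have eq: "nab (I (\<lambda>q. \<Phi> q (nab (I \<delta>) q (Z q)))) p = nab (\<lambda>q. nab (I \<delta>) q (Z q)) p"
      if "vector_field A U Z" for Z
    proof (rule loc[OF U _ sm[OF U I[OF U d] that] _ p])
      show "I (\<lambda>q. \<Phi> q (nab (I \<delta>) q (Z q))) q = nab (I \<delta>) q (Z q)" if "q \<in> U" for q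
        using ii[OF pA[OF that]] by (simp add: I_def)
      then show "smooth_section A B U (I (\<lambda>q. \<Phi> q (nab (I \<delta>) q (Z q))))"
        by (intro smooth_section_transform[OF B U sm[OF U I[OF U d] that]]) simp
    qed
    have "nab (\<lambda>q. nab (I \<delta>) q (Y q)) p (X p) - nab (\<lambda>q. nab (I \<delta>) q (X q)) p (Y p)
        - nab (I \<delta>) p (lie_bracket A X Y p) = 0"
      using fl a I[OF U d] p unfolding flat_def sec by blast
    then show "transport_conn \<Phi> nab (\<lambda>q. transport_conn \<Phi> nab \<delta> q (Y q)) p (X p) -
        transport_conn \<Phi> nab (\<lambda>q. transport_conn \<Phi> nab \<delta> q (X q)) p (Y p) -
        transport_conn \<Phi> nab \<delta> p (lie_bracket A X Y p) = 0"
      unfolding T using a by (simp add: eq linear_diff[OF lin[OF pA[OF p]], symmetric] linear_0[OF lin[OF pA[OF p]]])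
  qed
qed

end

section \<open>Tensors in charts\<close>

text \<open>Product rule for a moving linear map applied to a moving vector, with no topology on the
  linear maps: in coordinates it is the product rule for finitely many scalar multiples.\<close>

lemma has_derivative_linear_family:
  fixes L :: "'a::real_normed_vector \<Rightarrow> 'b::finite_coords \<Rightarrow> 'c::real_normed_vector"
  assumes S: "open S" "x0 \<in> S" and lin: "\<And>x. x \<in> S \<Longrightarrow> linear (L x)"
    and diff: "\<And>w. (\<lambda>x. L x w) differentiable (at x0)" and f: "(f has_derivative f') (at x0)"
  shows "((\<lambda>x. L x (f x)) has_derivative
    (\<lambda>h. frechet_derivative (\<lambda>x. L x (f x0)) (at x0) h + L x0 (f' h))) (at x0)"
proof -
  obtain n :: nat and e :: "nat \<Rightarrow> 'b" and c where
    c: "\<forall>i<n. bounded_linear (c i)" "\<And>x. x = (\<Sum>i<n. c i x *\<^sub>R e i)" using ex_nat_coords by blast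
  let ?D = "\<lambda>i. frechet_derivative (\<lambda>x. L x (e i)) (at x0)"
  have D: "((\<lambda>x. L x (e i)) has_derivative ?D i) (at x0)" for i
    using diff frechet_derivative_works by blast
  have Lw: "L x w = (\<Sum>i<n. c i w *\<^sub>R L x (e i))" if "x \<in> S" for x w
  proof -
    have "L x w = L x (\<Sum>i<n. c i w *\<^sub>R e i)" using c(2) by metis
    then show ?thesis by (simp add: linear_sum[OF lin[OF that]] linear_scale[OF lin[OF that]])
  qed
  have 1: "frechet_derivative (\<lambda>x. L x w) (at x0) = (\<lambda>h. \<Sum>i<n. c i w *\<^sub>R ?D i h)" for w
  proof (rule frechet_derivative_eqI, rule has_derivative_transform_within_open[OF _ S])
    show "((\<lambda>x. \<Sum>i<n. c i w *\<^sub>R L x (e i)) has_derivative (\<lambda>h. \<Sum>i<n. c i w *\<^sub>R ?D i h)) (at x0)"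
      by (intro has_derivative_sum has_derivative_scaleR_right D)
  qed (simp add: Lw)
  show ?thesis
  proof (rule has_derivative_transform_within_open[OF _ S])
    have "((\<lambda>x. c i (f x) *\<^sub>R L x (e i)) has_derivative (\<lambda>h. c i (f x0) *\<^sub>R ?D i h + c i (f' h) *\<^sub>R L x0 (e i))) (at x0)"
      if "i < n" for i
      using c(1) that by (intro has_derivative_scaleR D bounded_linear.has_derivative[OF _ f]) auto
    then have "((\<lambda>x. \<Sum>i<n. c i (f x) *\<^sub>R L x (e i)) has_derivative
        (\<lambda>h. \<Sum>i<n. c i (f x0) *\<^sub>R ?D i h + c i (f' h) *\<^sub>R L x0 (e i))) (at x0)"
      by (intro has_derivative_sum) auto
    then show "((\<lambda>x. \<Sum>i<n. c i (f x) *\<^sub>R L x (e i)) has_derivative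
        (\<lambda>h. frechet_derivative (\<lambda>x. L x (f x0)) (at x0) h + L x0 (f' h))) (at x0)"
      by (simp add: 1[of "f x0"] sum.distrib Lw[OF S(2), of "f' _"])
  qed (simp add: Lw)
qed

text \<open>Here x and y represent one vector field before and after the change of coordinates
  \<theta>. Differentiating their relation leaves a Hessian of \<theta>, the term that later has to
  cancel.\<close>

lemma pushforward_derivative:
  fixes \<theta> :: "'a::finite_coords \<Rightarrow> 'b::real_normed_vector"
  assumes S: "open S" "v0 \<in> S" and \<theta>: "smooth_on S \<theta>"
    and x: "(x has_derivative x') (at v0)" and y: "(y has_derivative y') (at (\<theta> v0))"
    and eq: "\<And>v. v \<in> S \<Longrightarrow> y (\<theta> v) = frechet_derivative \<theta> (at v) (x v)"
  shows "y' (frechet_derivative \<theta> (at v0) h) =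
    frechet_derivative (\<lambda>v. frechet_derivative \<theta> (at v) (x v0)) (at v0) h + frechet_derivative \<theta> (at v0) (x' h)"
proof -
  have "((\<lambda>v. y (\<theta> v)) has_derivative (\<lambda>h. y' (frechet_derivative \<theta> (at v0) h))) (at v0)"
    by (rule has_derivative_compose[OF smooth_on_has_derivative[OF \<theta> S(2)] y])
  moreover have "((\<lambda>v. y (\<theta> v)) has_derivative (\<lambda>h.
    frechet_derivative (\<lambda>v. frechet_derivative \<theta> (at v) (x v0)) (at v0) h + frechet_derivative \<theta> (at v0) (x' h))) (at v0)"
  proof (rule has_derivative_transform_within_open[OF _ S])
    show "((\<lambda>v. frechet_derivative \<theta> (at v) (x v)) has_derivative (\<lambda>h.
      frechet_derivative (\<lambda>v. frechet_derivative \<theta> (at v) (x v0)) (at v0) h + frechet_derivative \<theta> (at v0) (x' h))) (at v0)"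
      by (rule has_derivative_linear_family[OF S linear_frechet_derivative[OF smooth_on_differentiable[OF \<theta>]]
            smooth_on_differentiable[OF smooth_on_frechet_derivative[OF \<theta>] S(2)] x])
  qed (simp add: eq)
  ultimately have "(\<lambda>h. y' (frechet_derivative \<theta> (at v0) h)) = (\<lambda>h.
    frechet_derivative (\<lambda>v. frechet_derivative \<theta> (at v) (x v0)) (at v0) h + frechet_derivative \<theta> (at v0) (x' h))"
    by (rule has_derivative_unique)
  then show ?thesis by (rule fun_cong)
qed

lemma local_rep_comp: "local_rep c t s = (\<lambda>x. t x (s x)) \<circ> chart_inv c"
  by (simp add: local_rep_def comp_def)

context atlas begin

lemma tangent_bundleI: "c \<in> A \<Longrightarrow> (fst c, tcoord A c) \<in> tangent_bundle A"
  by (simp add: tangent_bundle_def)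

lemma tangent_bundleE:
  assumes "(U, t) \<in> tangent_bundle A"
  obtains c where "c \<in> A" "U = fst c" "t = tcoord A c"
  using assms unfolding tangent_bundle_def by auto

lemma bij_tcoord_simps:
  assumes "c \<in> A" "p \<in> fst c"
  shows "tcoord A c p (inv (tcoord A c p) w) = w" "inv (tcoord A c p) (tcoord A c p w) = w"
  using bij_inv_simps[OF bij_tcoord[OF assms]] .

lemma smooth_bundle_tangent: "smooth_bundle A (tangent_bundle A)"
  unfolding smooth_bundle_def
proof (intro conjI ballI)
  show "(\<Union>b\<in>tangent_bundle A. fst b) = points A"
    by (simp add: tangent_bundle_def points_def)
  fix b assume "b \<in> tangent_bundle A"
  then obtain c where c: "c \<in> A" "b = (fst c, tcoord A c)" by (auto simp: tangent_bundle_def)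
  have "smooth_section A (tangent_bundle A) (fst c) (\<lambda>x. inv (tcoord A c x) w)" for w
    unfolding smooth_section_iff
  proof clarify
    fix U t assume "(U, t) \<in> tangent_bundle A"
    then obtain d where d: "d \<in> A" "U = fst d" "t = tcoord A d" by (rule tangent_bundleE)
    have o: "openin (man_topology A) (fst c \<inter> fst d)" using c d openin_chart by blast
    have os: "open (snd c ` (fst c \<inter> fst d \<inter> fst c))" by (rule open_image[OF o c(1)])
    have "smooth_on (snd c ` (fst c \<inter> fst d \<inter> fst c)) (\<lambda>u. frechet_derivative (snd d \<circ> chart_inv c) (at u) w)"
      by (rule smooth_on_frechet_derivative[OF smooth_on_subset[OF smooth_transition[OF c(1) d(1)]]]) blast
    then have "smooth_on (snd c ` (fst c \<inter> fst d \<inter> fst c)) ((\<lambda>x. tcoord A d x (inv (tcoord A c x) w)) \<circ> chart_inv c)"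
      by (rule smooth_on_transform[OF os]) (use c d tcoord_transition[OF c(1) _ d(1)] bij_tcoord_simps[OF c(1)] in auto)
    then show "smooth_map A (fst c \<inter> U) (\<lambda>x. t x (inv (tcoord A c x) w))"
      unfolding d(2,3) by (intro smooth_map_chartI) (use o c in blast)
  qed
  then show "case b of (U, t) \<Rightarrow> openin (man_topology A) U \<and> (\<forall>x\<in>U. linear (t x) \<and> bij (t x)) \<and>
        (\<forall>w. smooth_section A (tangent_bundle A) U (\<lambda>x. inv (t x) w))"
    using c by (simp add: openin_chart linear_tcoord bij_tcoord)
qed

lemmas smooth_bundle_cotangent = smooth_bundle_dual[OF smooth_bundle_tangent]

lemma vector_field_rep:
  assumes "vector_field A U X" "c \<in> A"
  shows "smooth_on (snd c ` (U \<inter> fst c)) (local_rep c (tcoord A c) X)"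
  using smooth_mapD[OF smooth_sectionD[OF assms(1)[unfolded vector_field_def] tangent_bundleI[OF assms(2)]] assms(2)]
  by (simp add: local_rep_comp Int_assoc)

lemma form_rep_smooth:
  assumes "smooth_section A (dual_bundle (tangent_bundle A)) U \<eta>" "c \<in> A"
  shows "smooth_on (snd c ` (U \<inter> fst c)) (local_rep c (dual_triv (tcoord A c)) \<eta>)"
  using smooth_mapD[OF smooth_sectionD[OF assms(1) dual_bundleI[OF tangent_bundleI[OF assms(2)]]] assms(2)]
  by (simp add: local_rep_comp Int_assoc)

section \<open>Differentials of real functions\<close>

lemma dfun_has_derivative:
  assumes "smooth_map A U f" "p \<in> U" "p \<in> points A"
  shows "((f \<circ> chart_inv (chart_at A p)) has_derivative blinfun_apply (dfun A f p)) (at (snd (chart_at A p) p))"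
proof -
  note D = smooth_map_has_derivative[OF assms(1,2) conjunct1[OF chart_at[OF assms(3)]] conjunct2[OF chart_at[OF assms(3)]]]
  show ?thesis
    unfolding dfun_def bounded_linear_Blinfun_apply[OF has_derivative_bounded_linear[OF D]] by (rule D)
qed

lemma dfun_eqI:
  assumes "((f \<circ> chart_inv (chart_at A p)) has_derivative D) (at (snd (chart_at A p) p))"
  shows "dfun A f p w = D w"
  using assms by (simp add: dfun_def frechet_derivative_eqI bounded_linear_Blinfun_apply has_derivative_bounded_linear)

lemma dfun_cong:
  assumes W: "openin (man_topology A) W" "p \<in> W" and eq: "\<And>q. q \<in> W \<Longrightarrow> f q = g q"
  shows "dfun A f p = dfun A g p"
proof -
  have a: "chart_at A p \<in> A" "p \<in> fst (chart_at A p)"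
    using chart_at openin_subset_points[OF W(1)] W(2) by blast+
  have "frechet_derivative (f \<circ> chart_inv (chart_at A p)) (at (snd (chart_at A p) p)) =
      frechet_derivative (g \<circ> chart_inv (chart_at A p)) (at (snd (chart_at A p) p))"
    by (rule frechet_derivative_cong_open[OF open_image[OF W(1) a(1)]]) (use a W eq in auto)
  then show ?thesis by (simp add: dfun_def)
qed

lemma dfun_const: "dfun A (\<lambda>x. k) p w = 0"
  by (rule dfun_eqI) (simp add: comp_def)

lemma dfun_add:
  assumes "smooth_map A U f" "smooth_map A U g" "p \<in> U" "p \<in> points A"
  shows "dfun A (\<lambda>x. f x + g x) p w = dfun A f p w + dfun A g p w"
  using has_derivative_add[OF dfun_has_derivative[OF assms(1,3,4)] dfun_has_derivative[OF assms(2,3,4)]]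
  by (intro dfun_eqI) (simp add: comp_def)

lemma dfun_diff:
  assumes "smooth_map A U f" "smooth_map A U g" "p \<in> U" "p \<in> points A"
  shows "dfun A (\<lambda>x. f x - g x) p w = dfun A f p w - dfun A g p w"
  using has_derivative_diff[OF dfun_has_derivative[OF assms(1,3,4)] dfun_has_derivative[OF assms(2,3,4)]]
  by (intro dfun_eqI) (simp add: comp_def)

lemma dfun_mult:
  assumes "smooth_map A U f" "smooth_map A U g" "p \<in> U" "p \<in> points A"
  shows "dfun A (\<lambda>x. f x * g x) p w = f p * dfun A g p w + dfun A f p w * g p"
  using has_derivative_mult[OF dfun_has_derivative[OF assms(1,3,4)] dfun_has_derivative[OF assms(2,3,4)]]
    chart_at[OF assms(4)]
  by (intro dfun_eqI) (simp add: comp_def)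

lemma dfun_sum:
  assumes "\<And>i. i \<in> I \<Longrightarrow> smooth_map A U (f i)" "p \<in> U" "p \<in> points A"
  shows "dfun A (\<lambda>x. \<Sum>i\<in>I. f i x) p w = (\<Sum>i\<in>I. dfun A (f i) p w)"
proof (rule dfun_eqI)
  have "((\<lambda>u. \<Sum>i\<in>I. (f i \<circ> chart_inv (chart_at A p)) u) has_derivative (\<lambda>w. \<Sum>i\<in>I. dfun A (f i) p w))
      (at (snd (chart_at A p) p))"
    by (intro has_derivative_sum dfun_has_derivative[OF assms(1)] assms)
  then show "(((\<lambda>x. \<Sum>i\<in>I. f i x) \<circ> chart_inv (chart_at A p)) has_derivative (\<lambda>w. \<Sum>i\<in>I. dfun A (f i) p w))
      (at (snd (chart_at A p) p))" by (simp add: comp_def)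
qed

text \<open>At points near p \<open>dfun\<close> is defined in other charts;
  \<open>dfun_chart\<close> brings all of them back to \<open>chart_at A p\<close>, where
  derivatives of smooth functions are smooth.\<close>

lemma smooth_map_dfun:
  assumes U: "openin (man_topology A) U" and f: "smooth_map A U f" and X: "vector_field A U X"
  shows "smooth_map A U (\<lambda>p. dfun A f p (X p))"
proof (rule smooth_map_chartI)
  fix p assume p: "p \<in> U"
  then have c: "chart_at A p \<in> A" "p \<in> fst (chart_at A p)" using chart_at openin_subset_points[OF U] by blast+
  let ?c = "chart_at A p"
  have "smooth_on (snd ?c ` (U \<inter> fst ?c)) (\<lambda>u. frechet_derivative (f \<circ> chart_inv ?c) (at u) (local_rep ?c (tcoord A ?c) X u))"
    by (rule smooth_on_frechet_derivative_apply[OF open_image[OF U c(1)] smooth_mapD[OF f c(1)] vector_field_rep[OF X c(1)]])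
  then have "smooth_on (snd ?c ` (U \<inter> fst ?c)) ((\<lambda>p. dfun A f p (X p)) \<circ> chart_inv ?c)"
    by (rule smooth_on_transform[OF open_image[OF U c(1)]])
      (use c dfun_chart[OF c(1) _ smooth_map_differentiable[OF f _ c(1)]] in \<open>auto simp: local_rep_def\<close>)
  then show "\<exists>W c. openin (man_topology A) W \<and> c \<in> A \<and> p \<in> W \<inter> fst c \<and>
      smooth_on (snd c ` (W \<inter> fst c)) ((\<lambda>p. dfun A f p (X p)) \<circ> chart_inv c)"
    using U c p by blast
qed

section \<open>Brackets and Lie derivatives in an arbitrary chart\<close>

lemma rep_has_derivative:
  assumes "vector_field A U X" "c \<in> A" "p \<in> U" "p \<in> fst c"
  shows "(local_rep c (tcoord A c) X has_derivative frechet_derivative (local_rep c (tcoord A c) X) (at (snd c p))) (at (snd c p))"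
  using smooth_on_has_derivative[OF vector_field_rep[OF assms(1,2)]] assms by blast

lemma form_rep_has_derivative:
  assumes "smooth_section A (dual_bundle (tangent_bundle A)) U \<eta>" "c \<in> A" "p \<in> U" "p \<in> fst c"
  shows "(local_rep c (dual_triv (tcoord A c)) \<eta> has_derivative
    frechet_derivative (local_rep c (dual_triv (tcoord A c)) \<eta>) (at (snd c p))) (at (snd c p))"
  using smooth_on_has_derivative[OF form_rep_smooth[OF assms(1,2)]] assms by blast

text \<open>The transformation rule for first derivatives of a vector field: besides the expected
  term there is the Hessian of the transition map, applied to \<open>X p\<close> and h.\<close>

lemma rep_change:
  assumes X: "vector_field A U X" and U: "openin (man_topology A) U"
    and c: "c \<in> A" "p \<in> fst c" "p \<in> U"
  defines "a \<equiv> chart_at A p"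
  shows "frechet_derivative (local_rep c (tcoord A c) X) (at (snd c p)) (tcoord A c p h) =
    frechet_derivative (\<lambda>v. frechet_derivative (snd c \<circ> chart_inv a) (at v) (X p)) (at (snd a p)) h +
    tcoord A c p (frechet_derivative (local_rep a (tcoord A a) X) (at (snd a p)) h)"
proof -
  have pA: "p \<in> points A" using c chart_in_points by blast
  have a: "a \<in> A" "p \<in> fst a" using chart_at[OF pA] by (auto simp: a_def)
  let ?S = "snd a ` (U \<inter> fst a \<inter> fst c)"
  have S: "open ?S" "snd a p \<in> ?S"
    using open_image[of "U \<inter> fst c", OF openin_Int[OF U openin_chart[OF c(1)]] a(1)] a c
    by (auto simp: Int_ac)
  have \<theta>: "smooth_on ?S (snd c \<circ> chart_inv a)" by (rule smooth_on_subset[OF smooth_transition[OF a(1) c(1)]]) blast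
  have y: "(local_rep c (tcoord A c) X has_derivative frechet_derivative (local_rep c (tcoord A c) X) (at (snd c p)))
      (at ((snd c \<circ> chart_inv a) (snd a p)))"
    using rep_has_derivative[OF X c(1,3,2)] a by simp
  have eq: "local_rep c (tcoord A c) X ((snd c \<circ> chart_inv a) v) =
      frechet_derivative (snd c \<circ> chart_inv a) (at v) (local_rep a (tcoord A a) X v)" if "v \<in> ?S" for v
    using that a c tcoord_transition[OF a(1) _ c(1)] by (auto simp: local_rep_def)
  have t: "tcoord A c p = frechet_derivative (snd c \<circ> chart_inv a) (at (snd a p))"
    unfolding tcoord_def a_def ..
  have X0: "local_rep a (tcoord A a) X (snd a p) = X p"
    using a tcoord_chart_at[OF pA] by (simp add: local_rep_def a_def)
  show ?thesis
    using pushforward_derivative[OF S \<theta> rep_has_derivative[OF X a(1) c(3) a(2)] y eq, of h]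
    unfolding t[symmetric] X0 .
qed

lemma second_derivative_chart_symmetric:
  assumes c: "c \<in> A" "p \<in> fst c"
  defines "a \<equiv> chart_at A p"
  shows "frechet_derivative (\<lambda>v. frechet_derivative (snd c \<circ> chart_inv a) (at v) x) (at (snd a p)) y =
    frechet_derivative (\<lambda>v. frechet_derivative (snd c \<circ> chart_inv a) (at v) y) (at (snd a p)) x"
proof -
  have a: "a \<in> A" "p \<in> fst a" using chart_at[OF chart_in_points[OF c]] by (auto simp: a_def)
  show ?thesis
    by (rule second_derivative_symmetric[OF open_overlap[OF a(1) c(1)] _ smooth_transition[OF a(1) c(1)]])
      (use a c in blast)
qed

text \<open>The corrections of \<open>rep_change\<close> for Y along X and for X along Y are values
  of one symmetric Hessian, so they cancel in the difference.\<close>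

lemma lie_bracket_chart:
  assumes X: "vector_field A U X" and Y: "vector_field A U Y" and U: "openin (man_topology A) U"
    and c: "c \<in> A" "p \<in> fst c" "p \<in> U"
  shows "tcoord A c p (lie_bracket A X Y p) =
    frechet_derivative (local_rep c (tcoord A c) Y) (at (snd c p)) (tcoord A c p (X p)) -
    frechet_derivative (local_rep c (tcoord A c) X) (at (snd c p)) (tcoord A c p (Y p))"
  unfolding lie_bracket_def Let_def vf_rep_def
  by (simp add: linear_diff[OF linear_tcoord[OF c(1,2)]] rep_change[OF X U c] rep_change[OF Y U c]
      second_derivative_chart_symmetric[OF c(1,2), of "X p" "Y p"])

text \<open>Changing the chart in the derivative of \<eta> and in the derivative of X produces the
  same Hessian term, with opposite signs.\<close>

lemma lie_deriv_form_chart: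
  assumes X: "vector_field A U X" and \<eta>: "smooth_section A (dual_bundle (tangent_bundle A)) U \<eta>"
    and U: "openin (man_topology A) U" and c: "c \<in> A" "p \<in> fst c" "p \<in> U"
  shows "lie_deriv_form A X \<eta> p w =
    frechet_derivative (local_rep c (dual_triv (tcoord A c)) \<eta>) (at (snd c p)) (tcoord A c p (X p)) (tcoord A c p w) +
    \<eta> p (inv (tcoord A c p) (frechet_derivative (local_rep c (tcoord A c) X) (at (snd c p)) (tcoord A c p w)))"
proof -
  define a where "a = chart_at A p"
  have pA: "p \<in> points A" using c chart_in_points by blast
  have a: "a \<in> A" "p \<in> fst a" using chart_at[OF pA] by (auto simp: a_def)
  let ?S = "snd a ` (U \<inter> fst a \<inter> fst c)"
  have S: "open ?S" "snd a p \<in> ?S"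
    using open_image[of "U \<inter> fst c", OF openin_Int[OF U openin_chart[OF c(1)]] a(1)] a c
    by (auto simp: Int_ac)
  let ?\<theta> = "snd c \<circ> chart_inv a"
  have \<theta>: "smooth_on ?S ?\<theta>" by (rule smooth_on_subset[OF smooth_transition[OF a(1) c(1)]]) blast
  have t: "tcoord A c p = frechet_derivative ?\<theta> (at (snd a p))"
    unfolding tcoord_def a_def ..
  let ?fa = "local_rep a (dual_triv (tcoord A a)) \<eta>" and ?fc = "local_rep c (dual_triv (tcoord A c)) \<eta>"
  let ?D2 = "\<lambda>x y. frechet_derivative (\<lambda>v. frechet_derivative ?\<theta> (at v) x) (at (snd a p)) y"
  \<comment> \<open>Covectors transform by composition with the differential of the transition
    map.\<close>
  have fa: "blinfun_apply (?fa v) w = blinfun_apply (?fc (?\<theta> v)) (frechet_derivative ?\<theta> (at v) w)" if v: "v \<in> ?S" for v w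
  proof -
    obtain q where q: "q \<in> fst a" "q \<in> fst c" "v = snd a q" using v by blast
    have "inv (tcoord A a q) w = inv (tcoord A c q) (frechet_derivative ?\<theta> (at v) w)"
      using tcoord_transition[OF a(1) q(1) c(1) q(2), of "inv (tcoord A a q) w"] q a c
      by (metis bij_tcoord_simps)
    then show ?thesis
      using q a c by (simp add: local_rep_def dual_triv_apply linear_tcoord bij_tcoord)
  qed
  have dc: "(?fc has_derivative frechet_derivative ?fc (at (snd c p))) (at (?\<theta> (snd a p)))"
    using form_rep_has_derivative[OF \<eta> c(1,3,2)] a by simp
  \<comment> \<open>The evaluation of \<eta> on a fixed w is differentiated in both charts and the
    results are compared. The term with argument 0 is the derivative of the constant w in the
    product rule.\<close>
  have "((\<lambda>v. blinfun_apply (?fa v) w) has_derivative (\<lambda>h. ?fa (snd a p) 0 + frechet_derivative ?fa (at (snd a p)) h w)) (at (snd a p))"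
    by (rule bounded_bilinear.FDERIV[OF bounded_bilinear_blinfun_apply form_rep_has_derivative[OF \<eta> a(1) c(3) a(2)] has_derivative_const])
  moreover have "((\<lambda>v. blinfun_apply (?fa v) w) has_derivative (\<lambda>h.
      ?fc (?\<theta> (snd a p)) (?D2 w h) + frechet_derivative ?fc (at (snd c p)) (tcoord A c p h) (tcoord A c p w))) (at (snd a p))"
  proof (rule has_derivative_transform_within_open[OF _ S])
    show "((\<lambda>v. blinfun_apply (?fc (?\<theta> v)) (frechet_derivative ?\<theta> (at v) w)) has_derivative (\<lambda>h.
      ?fc (?\<theta> (snd a p)) (?D2 w h) + frechet_derivative ?fc (at (snd c p)) (tcoord A c p h) (tcoord A c p w))) (at (snd a p))"
      unfolding t
      by (rule bounded_bilinear.FDERIV[OF bounded_bilinear_blinfun_apply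
          has_derivative_compose[OF smooth_on_has_derivative[OF \<theta> S(2)] dc]
          smooth_on_has_derivative[OF smooth_on_frechet_derivative[OF \<theta>] S(2)]])
  qed (simp add: fa)
  ultimately have "(\<lambda>h. ?fa (snd a p) 0 + frechet_derivative ?fa (at (snd a p)) h w) =
      (\<lambda>h. ?fc (?\<theta> (snd a p)) (?D2 w h) + frechet_derivative ?fc (at (snd c p)) (tcoord A c p h) (tcoord A c p w))"
    by (rule has_derivative_unique)
  from fun_cong[OF this, of "X p"]
  have 1: "frechet_derivative ?fa (at (snd a p)) (X p) w =
      ?fc (snd c p) (?D2 w (X p)) + frechet_derivative ?fc (at (snd c p)) (tcoord A c p (X p)) (tcoord A c p w)"
    using a by simp
  have \<eta>p: "\<eta> p w = ?fc (snd c p) (tcoord A c p w)" for w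
    using c by (simp add: local_rep_def dual_triv_apply linear_tcoord bij_tcoord bij_tcoord_simps)
  have lX: "bounded_linear (frechet_derivative (local_rep a (tcoord A a) X) (at (snd a p)))"
    using has_derivative_bounded_linear[OF rep_has_derivative[OF X a(1) c(3) a(2)]] .
  have 2: "\<eta> p (frechet_derivative (local_rep a (tcoord A a) X) (at (snd a p)) w) =
      ?fc (snd c p) (frechet_derivative (local_rep c (tcoord A c) X) (at (snd c p)) (tcoord A c p w)) -
      ?fc (snd c p) (?D2 w (X p))"
    unfolding \<eta>p
    using rep_change[OF X U c, of w] second_derivative_chart_symmetric[OF c(1,2), of "X p" w]
    by (simp add: a_def[symmetric] blinfun.add_right[symmetric] blinfun.diff_right[symmetric])
  show ?thesis
    unfolding lie_deriv_form_def Let_def form_rep_def vf_rep_def a_def[symmetric]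
    using 1 2 c by (simp add: blinfun.add_left bounded_linear_Blinfun_apply[OF lX] \<eta>p bij_tcoord_simps)
qed

text \<open>The Hessian of g cancels by symmetry and only the derivatives of the two fields remain,
  which form the bracket. The curvature of the dual connection is computed from this.\<close>

lemma dfun_commutator:
  assumes X: "vector_field A U X" and Y: "vector_field A U Y" and U: "openin (man_topology A) U"
    and g: "smooth_map A U g" and p: "p \<in> U"
  shows "dfun A (\<lambda>q. dfun A g q (Y q)) p (X p) - dfun A (\<lambda>q. dfun A g q (X q)) p (Y p) =
    dfun A g p (lie_bracket A X Y p)"
proof -
  define a where "a = chart_at A p"
  have pA: "p \<in> points A" using p openin_subset_points[OF U] by blast
  have a: "a \<in> A" "p \<in> fst a" using chart_at[OF pA] by (auto simp: a_def)
  let ?S = "snd a ` (U \<inter> fst a)" and ?g = "g \<circ> chart_inv a"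
  have S: "open ?S" "snd a p \<in> ?S" using open_image[OF U a(1)] a p by auto
  have g': "smooth_on ?S ?g" by (rule smooth_mapD[OF g a(1)])
  have ta: "tcoord A a p = (\<lambda>w. w)" using tcoord_chart_at[OF pA] by (simp add: a_def)
  have Z: "dfun A (\<lambda>q. dfun A g q (Z q)) p w =
      frechet_derivative (\<lambda>v. frechet_derivative ?g (at v) (Z p)) (at (snd a p)) w +
      dfun A g p (frechet_derivative (local_rep a (tcoord A a) Z) (at (snd a p)) w)"
    if vZ: "vector_field A U Z" for Z w
  proof -
    have rZ: "local_rep a (tcoord A a) Z (snd a p) = Z p" using a by (simp add: local_rep_def ta)
    have "((\<lambda>v. frechet_derivative ?g (at v) (local_rep a (tcoord A a) Z v)) has_derivative
      (\<lambda>h. frechet_derivative (\<lambda>v. frechet_derivative ?g (at v) (local_rep a (tcoord A a) Z (snd a p))) (at (snd a p)) h +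
        frechet_derivative ?g (at (snd a p)) (frechet_derivative (local_rep a (tcoord A a) Z) (at (snd a p)) h)))
      (at (snd a p))"
      by (rule has_derivative_linear_family[OF S linear_frechet_derivative[OF smooth_on_differentiable[OF g']]
            smooth_on_differentiable[OF smooth_on_frechet_derivative[OF g'] S(2)]
            rep_has_derivative[OF vZ a(1) p a(2)]])
    then have "(((\<lambda>q. dfun A g q (Z q)) \<circ> chart_inv a) has_derivative
      (\<lambda>h. frechet_derivative (\<lambda>v. frechet_derivative ?g (at v) (Z p)) (at (snd a p)) h +
        frechet_derivative ?g (at (snd a p)) (frechet_derivative (local_rep a (tcoord A a) Z) (at (snd a p)) h)))
      (at (snd a p))"
      unfolding rZ
    proof (rule has_derivative_transform_within_open[OF _ S])
      fix v assume "v \<in> ?S"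
      then show "frechet_derivative ?g (at v) (local_rep a (tcoord A a) Z v) = ((\<lambda>q. dfun A g q (Z q)) \<circ> chart_inv a) v"
        using dfun_chart[OF a(1) _ smooth_map_differentiable[OF g _ a(1)]] a by (auto simp: local_rep_def)
    qed
    moreover have "frechet_derivative ?g (at (snd a p)) w = dfun A g p w" for w
      using dfun_chart[OF a smooth_map_differentiable[OF g p a]] by (simp add: ta)
    ultimately have "(((\<lambda>q. dfun A g q (Z q)) \<circ> chart_inv a) has_derivative
      (\<lambda>h. frechet_derivative (\<lambda>v. frechet_derivative ?g (at v) (Z p)) (at (snd a p)) h +
        dfun A g p (frechet_derivative (local_rep a (tcoord A a) Z) (at (snd a p)) h)))
      (at (snd a p))" by simp
    from dfun_eqI[OF this[unfolded a_def]] show ?thesis unfolding a_def .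
  qed
  show ?thesis
    unfolding Z[OF X] Z[OF Y] lie_bracket_def Let_def vf_rep_def a_def[symmetric]
    using second_derivative_symmetric[OF S g', of "X p" "Y p"] by (simp add: blinfun.diff_right)
qed

section \<open>Connections in frames and the dual connection\<close>

text \<open>Covectors at p can be compared on the values of local sections, which is how identities
  for the dual connection are proved.\<close>

lemma ex_section_through:
  assumes B: "smooth_bundle A B" and p: "p \<in> points A"
  obtains W s where "openin (man_topology A) W" "p \<in> W" "smooth_section A B W s" "s p = v"
proof -
  obtain U t where t: "(U, t) \<in> B" "p \<in> U" using smooth_bundle_cover[OF B p] by blast
  show ?thesis
    by (rule that[of U "\<lambda>x. inv (t x) (t p v)"])
      (use smooth_bundle_triv(1,4)[OF B t(1)] t bij_inv_simps[OF smooth_bundle_triv(3)[OF B t]] in auto)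
qed

lemma conn_zero:
  assumes B: "smooth_bundle A B" and conn: "connection A B (\<lambda>_. UNIV) nab" and p: "p \<in> points A"
  shows "nab (\<lambda>q. 0) p X = 0"
proof -
  have "smooth_section A B (points A) (\<lambda>x. 0)" by (rule smooth_section_zero[OF B openin_points])
  from connectionD(4)[OF conn openin_points, unfolded section_of_UNIV, OF this this p, of X]
  show ?thesis by simp
qed

lemma conn_sum:
  assumes B: "smooth_bundle A B" and conn: "connection A B (\<lambda>_. UNIV) nab"
    and U: "openin (man_topology A) U" "p \<in> U" and s: "\<And>i. i \<in> I \<Longrightarrow> smooth_section A B U (s i)"
  shows "nab (\<lambda>q. \<Sum>i\<in>I. s i q) p X = (\<Sum>i\<in>I. nab (s i) p X)"
proof -
  have pA: "p \<in> points A" using U openin_subset_points by blast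
  show ?thesis
    using s
  proof (induction I rule: infinite_finite_induct)
    case (insert i I)
    have "nab (\<lambda>q. s i q + (\<Sum>i\<in>I. s i q)) p X = nab (s i) p X + nab (\<lambda>q. \<Sum>i\<in>I. s i q) p X"
      by (rule connectionD(4)[OF conn U(1), unfolded section_of_UNIV, OF _ _ U(2)])
        (auto intro!: insert smooth_section_sum[OF B U(1)])
    then show ?case using insert by simp
  qed (simp_all add: conn_zero[OF B conn pA])
qed

lemma frame_expansion:
  fixes B :: "('p, 'v::euclidean_space) triv set"
  assumes B: "smooth_bundle A B" and t: "(U, t) \<in> B" and x: "x \<in> U"
  shows "v = (\<Sum>b\<in>Basis. (t x v \<bullet> b) *\<^sub>R inv (t x) b)"
proof -
  note lb = smooth_bundle_triv(2,3)[OF B t x]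
  have "inv (t x) (t x v) = inv (t x) (\<Sum>b\<in>Basis. (t x v \<bullet> b) *\<^sub>R b)" by (simp add: euclidean_representation)
  then show ?thesis
    by (simp add: linear_sum[OF linear_inv_bij[OF lb]] linear_scale[OF linear_inv_bij[OF lb]] bij_inv_simps[OF lb(2)])
qed

lemma frame_coord_smooth:
  fixes B :: "('p, 'v::euclidean_space) triv set"
  assumes U: "openin (man_topology A) U" and s: "smooth_section A B U s" and t: "(U', t) \<in> B"
    and W: "openin (man_topology A) W" "W \<subseteq> U \<inter> U'"
  shows "smooth_map A W (\<lambda>x. t x (s x) \<bullet> b)"
  by (rule smooth_map_bounded_linear[OF bounded_linear_inner_left W(1)
        smooth_map_subset[OF smooth_sectionD[OF s t] W(2)]])

text \<open>Leibniz rule in a local frame. The right-hand side has the shape of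
  \<open>pullback_conn\<close>, with which it is matched in \<open>vproj_tchart\<close>.\<close>

lemma conn_frame:
  fixes B :: "('p, 'v::euclidean_space) triv set"
  assumes B: "smooth_bundle A B" and conn: "connection A B (\<lambda>_. UNIV) nab"
    and U: "openin (man_topology A) U" "p \<in> U" and s: "smooth_section A B U s"
    and t: "(U', t) \<in> B" "p \<in> U'"
  shows "nab s p X = (\<Sum>b\<in>Basis. dfun A (\<lambda>x. t x (s x) \<bullet> b) p X *\<^sub>R inv (t p) b +
    (t p (s p) \<bullet> b) *\<^sub>R nab (\<lambda>x. inv (t x) b) p X)"
proof -
  let ?W = "U \<inter> U'"
  note o = smooth_bundle_triv(1)[OF B t(1)]
  have W: "openin (man_topology A) ?W" "p \<in> ?W" using U t o by auto
  have e: "smooth_section A B ?W (\<lambda>x. inv (t x) b)" for b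
    by (rule smooth_section_subset[OF smooth_bundle_triv(4)[OF B t(1)]]) simp
  have f: "smooth_map A ?W (\<lambda>x. t x (s x) \<bullet> b)" for b
    by (rule frame_coord_smooth[OF U(1) s t(1) W(1)]) simp
  have fe: "smooth_section A B ?W (\<lambda>x. (t x (s x) \<bullet> b) *\<^sub>R inv (t x) b)" for b
    by (rule smooth_section_scaleR[OF B W(1) f e])
  have "nab s p = nab (\<lambda>x. \<Sum>b\<in>Basis. (t x (s x) \<bullet> b) *\<^sub>R inv (t x) b) p"
    by (rule connectionD(3)[OF conn W(1), unfolded section_of_UNIV, OF smooth_section_subset[OF s] _ _ W(2)])
      (auto intro!: smooth_section_sum[OF B W(1)] fe frame_expansion[OF B t(1)])
  then have 1: "nab s p X = (\<Sum>b\<in>Basis. nab (\<lambda>x. (t x (s x) \<bullet> b) *\<^sub>R inv (t x) b) p X)"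
    using conn_sum[OF B conn W, where s = "\<lambda>b x. (t x (s x) \<bullet> b) *\<^sub>R inv (t x) b" and I = Basis] fe by simp
  have 2: "nab (\<lambda>x. (t x (s x) \<bullet> b) *\<^sub>R inv (t x) b) p X = dfun A (\<lambda>x. t x (s x) \<bullet> b) p X *\<^sub>R inv (t p) b +
    (t p (s p) \<bullet> b) *\<^sub>R nab (\<lambda>x. inv (t x) b) p X" for b
    using connectionD(5)[OF conn W(1), unfolded section_of_UNIV smooth_fun_iff_map, OF e f W(2)] .
  show ?thesis unfolding 1 2 ..
qed

text \<open>The left-hand side is tensorial in s: the derivatives of the coefficients of s occur in
  both terms and cancel, so only the value of s at p remains.\<close>

lemma dual_pairing_frame:
  fixes B :: "('p, 'v::euclidean_space) triv set"
  assumes B: "smooth_bundle A B" and conn: "connection A B (\<lambda>_. UNIV) nab"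
    and U: "openin (man_topology A) U" "p \<in> U" and s: "smooth_section A B U s"
    and f: "smooth_section A (dual_bundle B) U f" and t: "(U', t) \<in> B" "p \<in> U'"
  shows "dfun A (\<lambda>x. f x (s x)) p X - f p (nab s p X) = (\<Sum>b\<in>Basis. (t p (s p) \<bullet> b) *
    (dfun A (\<lambda>x. f x (inv (t x) b)) p X - f p (nab (\<lambda>x. inv (t x) b) p X)))"
proof -
  let ?W = "U \<inter> U'"
  note o = smooth_bundle_triv(1)[OF B t(1)]
  have W: "openin (man_topology A) ?W" "p \<in> ?W" using U t o by auto
  have pA: "p \<in> points A" using U openin_subset_points by blast
  have e: "smooth_section A B ?W (\<lambda>x. inv (t x) b)" for b
    by (rule smooth_section_subset[OF smooth_bundle_triv(4)[OF B t(1)]]) simp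
  have c: "smooth_map A ?W (\<lambda>x. t x (s x) \<bullet> b)" for b
    by (rule frame_coord_smooth[OF U(1) s t(1) W(1)]) simp
  have fe: "smooth_map A ?W (\<lambda>x. f x (inv (t x) b))" for b
    by (rule smooth_section_dual_apply[OF B W(1) smooth_section_subset[OF f] e]) simp
  have "f x (s x) = (\<Sum>b\<in>Basis. (t x (s x) \<bullet> b) * f x (inv (t x) b))" if "x \<in> ?W" for x
    using arg_cong[OF frame_expansion[OF B t(1), of x "s x"], of "blinfun_apply (f x)"] that
    by (simp add: blinfun.sum_right blinfun.scaleR_right)
  then have "dfun A (\<lambda>x. f x (s x)) p = dfun A (\<lambda>x. \<Sum>b\<in>Basis. (t x (s x) \<bullet> b) * f x (inv (t x) b)) p"
    by (rule dfun_cong[OF W])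
  also have "\<dots> X = (\<Sum>b\<in>Basis. dfun A (\<lambda>x. (t x (s x) \<bullet> b) * f x (inv (t x) b)) p X)"
    by (rule dfun_sum[OF _ W(2) pA]) (rule smooth_map_bilinear[OF bounded_bilinear_mult W(1) c fe])
  also have "\<dots> = (\<Sum>b\<in>Basis. (t p (s p) \<bullet> b) * dfun A (\<lambda>x. f x (inv (t x) b)) p X +
      dfun A (\<lambda>x. t x (s x) \<bullet> b) p X * f p (inv (t p) b))"
    by (simp add: dfun_mult[OF c fe W(2) pA])
  finally show ?thesis
    unfolding conn_frame[OF B conn U s t, of X]
    by (simp add: blinfun.sum_right blinfun.add_right blinfun.scaleR_right sum.distrib sum_subtractf algebra_simps)
qed

lemma triv_at:
  assumes "smooth_bundle A B" "p \<in> points A"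
  obtains U where "(U, triv_at B p) \<in> B" "p \<in> U"
proof -
  obtain U t where "(U, t) \<in> B" "p \<in> U" using smooth_bundle_cover[OF assms] by blast
  then have "\<exists>b. b \<in> B \<and> p \<in> fst b" by force
  from someI_ex[OF this] show ?thesis
    using that[of "fst (SOME b. b \<in> B \<and> p \<in> fst b)"] by (simp add: triv_at_def)
qed

text \<open>\<open>dual_conn\<close> is defined with the section that is constant in the
  trivialisation chosen at p. Tensoriality allows any section with the same value there.\<close>

lemma dual_conn_apply:
  fixes B :: "('p, 'v::euclidean_space) triv set"
  assumes B: "smooth_bundle A B" and conn: "connection A B (\<lambda>_. UNIV) nab"
    and U: "openin (man_topology A) U" "p \<in> U" and s: "smooth_section A B U s"
    and f: "smooth_section A (dual_bundle B) U f"
  shows "dual_conn A B nab f p X (s p) = dfun A (\<lambda>x. f x (s x)) p X - f p (nab s p X)"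
proof -
  have pA: "p \<in> points A" using U openin_subset_points by blast
  obtain U' where t: "(U', triv_at B p) \<in> B" "p \<in> U'" using triv_at[OF B pA] by blast
  define t where "t = triv_at B p"
  let ?W = "U \<inter> U'"
  note t = t[folded t_def]
  note o = smooth_bundle_triv(1)[OF B t(1)]
  have W: "openin (man_topology A) ?W" "p \<in> ?W" using U t o by auto
  have e: "smooth_section A B ?W (\<lambda>x. inv (t x) b)" for b
    by (rule smooth_section_subset[OF smooth_bundle_triv(4)[OF B t(1)]]) simp
  have fW: "smooth_section A (dual_bundle B) ?W f" by (rule smooth_section_subset[OF f]) simp
  note lb = smooth_bundle_triv(2,3)[OF B t]
  define \<omega> where "\<omega> = (\<lambda>b. dfun A (\<lambda>x. f x (inv (t x) b)) p X - f p (nab (\<lambda>x. inv (t x) b) p X))"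
  have "(\<lambda>v. dfun A (\<lambda>x. f x (inv (t x) (t p v))) p X - f p (nab (\<lambda>x. inv (t x) (t p v)) p X)) =
      (\<lambda>v. \<Sum>b\<in>Basis. (t p v \<bullet> b) * \<omega> b)"
  proof
    fix v
    show "dfun A (\<lambda>x. f x (inv (t x) (t p v))) p X - f p (nab (\<lambda>x. inv (t x) (t p v)) p X) =
        (\<Sum>b\<in>Basis. (t p v \<bullet> b) * \<omega> b)"
      unfolding dual_pairing_frame[OF B conn W e[of "t p v"] fW t, of X] by (simp add: \<omega>_def bij_inv_simps[OF lb(2)])
  qed
  \<comment> \<open>Linearity has to be known before \<open>Blinfun\<close> in the definition can be
    evaluated.\<close>
  moreover have "linear (\<lambda>v. \<Sum>b\<in>Basis. (t p v \<bullet> b) * \<omega> b)"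
    by (rule linearI) (simp_all add: linear_add[OF lb(1)] linear_scale[OF lb(1)] inner_add_left algebra_simps
        sum.distrib sum_distrib_left)
  ultimately have "dual_conn A B nab f p X (s p) = (\<Sum>b\<in>Basis. (t p (s p) \<bullet> b) * \<omega> b)"
    unfolding dual_conn_def Let_def t_def[symmetric] by (simp add: Blinfun_linear_apply)
  then show ?thesis
    unfolding dual_pairing_frame[OF B conn U s f t] by (simp add: \<omega>_def)
qed

lemma dual_conn_smooth:
  fixes B :: "('p, 'v::euclidean_space) triv set"
  assumes B: "smooth_bundle A B" and conn: "connection A B (\<lambda>_. UNIV) nab"
    and U: "openin (man_topology A) U" and f: "smooth_section A (dual_bundle B) U f"
    and X: "vector_field A U X"
  shows "smooth_section A (dual_bundle B) U (\<lambda>p. dual_conn A B nab f p (X p))"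
proof (rule smooth_section_dualI[OF B U])
  fix U' t w assume t: "(U', t) \<in> B"
  let ?W = "U \<inter> U'" and ?e = "\<lambda>x. inv (t x) w"
  have W: "openin (man_topology A) ?W" using U smooth_bundle_triv(1)[OF B t(1)] by auto
  have e: "smooth_section A B ?W ?e"
    by (rule smooth_section_subset[OF smooth_bundle_triv(4)[OF B t(1)]]) simp
  have fW: "smooth_section A (dual_bundle B) ?W f" by (rule smooth_section_subset[OF f]) simp
  have XW: "vector_field A ?W X" using X unfolding vector_field_def by (rule smooth_section_subset) simp
  have "smooth_map A ?W (\<lambda>x. dfun A (\<lambda>x. f x (?e x)) x (X x) - f x (nab ?e x (X x)))"
    using smooth_section_dual_apply[OF B W fW e]
      smooth_section_dual_apply[OF B W fW connectionD(2)[OF conn W, unfolded section_of_UNIV, OF e XW]]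
    by (intro smooth_map_diff smooth_map_dfun[OF W _ XW] W)
  then show "smooth_map A ?W (\<lambda>x. dual_conn A B nab f x (X x) (?e x))"
    by (rule smooth_map_transform[OF W]) (simp add: dual_conn_apply[OF B conn W _ e fW])
qed

text \<open>Each axiom is checked after pairing with a local section. The curvature of the dual
  connection is then minus the transpose of the curvature of \<open>nab\<close>.\<close>

lemma dual_conn_flat_connection:
  fixes B :: "('p, 'v::euclidean_space) triv set"
  assumes B: "smooth_bundle A B" and nab: "flat_connection A B (\<lambda>_. UNIV) nab"
  shows "flat_connection A (dual_bundle B) (\<lambda>_. UNIV) (dual_conn A B nab)"
proof -
  have conn: "connection A B (\<lambda>_. UNIV) nab" and fl: "flat A B (\<lambda>_. UNIV) nab"
    using nab unfolding flat_connection_def by auto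
  note Bd = smooth_bundle_dual[OF B]
  let ?D = "dual_conn A B nab"
  \<comment> \<open>Two covectors at p agree if they agree on values of local sections over
    arbitrarily small neighbourhoods.\<close>
  have eqI: "L = R" if p: "p \<in> U" and U: "openin (man_topology A) U"
    and eq: "\<And>W s. openin (man_topology A) W \<Longrightarrow> W \<subseteq> U \<Longrightarrow> p \<in> W \<Longrightarrow> smooth_section A B W s \<Longrightarrow>
      blinfun_apply L (s p) = blinfun_apply R (s p)"
    for p U L R
  proof (rule blinfun_eqI)
    fix v
    have pA: "p \<in> points A" using U p openin_subset_points by blast
    obtain W s where s: "openin (man_topology A) W" "p \<in> W" "smooth_section A B W s" "s p = v"
      using ex_section_through[OF B pA] by blast
    then have "blinfun_apply L (s p) = blinfun_apply R (s p)"
      by (intro eq[of "W \<inter> U"]) (use U p in \<open>auto intro: smooth_section_subset\<close>)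
    then show "blinfun_apply L v = blinfun_apply R v" using s by simp
  qed
  show ?thesis
    unfolding flat_connection_def connection_def flat_def section_of_UNIV smooth_fun_iff_map
  proof (intro conjI allI impI ballI)
    fix U assume U: "openin (man_topology A) U"
    note pA = subsetD[OF openin_subset_points[OF U]]
    {
      fix f assume f: "smooth_section A (dual_bundle B) U f"
      fix p assume p: "p \<in> U"
      show "linear (?D f p)"
      proof (rule linearI)
        fix X Y and r :: real
        show "?D f p (X + Y) = ?D f p X + ?D f p Y"
        proof (rule eqI[OF p U])
          fix W s assume W: "openin (man_topology A) W" "W \<subseteq> U" "p \<in> W" and s: "smooth_section A B W s"
          note a = dual_conn_apply[OF B conn W(1,3) s smooth_section_subset[OF f W(2)]]
          have "linear (nab s p)" by (rule connectionD(1)[OF conn W(1), unfolded section_of_UNIV, OF s W(3)])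
          then show "?D f p (X + Y) (s p) = (?D f p X + ?D f p Y) (s p)"
            by (simp add: a blinfun.add_left blinfun.add_right linear_add)
        qed
        show "?D f p (r *\<^sub>R X) = r *\<^sub>R ?D f p X"
        proof (rule eqI[OF p U])
          fix W s assume W: "openin (man_topology A) W" "W \<subseteq> U" "p \<in> W" and s: "smooth_section A B W s"
          note a = dual_conn_apply[OF B conn W(1,3) s smooth_section_subset[OF f W(2)]]
          have "linear (nab s p)" by (rule connectionD(1)[OF conn W(1), unfolded section_of_UNIV, OF s W(3)])
          then show "?D f p (r *\<^sub>R X) (s p) = (r *\<^sub>R ?D f p X) (s p)"
            by (simp add: a blinfun.scaleR_left blinfun.scaleR_right linear_scale algebra_simps)
        qed
      qed
    next
      fix f X assume f: "smooth_section A (dual_bundle B) U f" and X: "vector_field A U X"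
      show "smooth_section A (dual_bundle B) U (\<lambda>p. ?D f p (X p))"
        by (rule dual_conn_smooth[OF B conn U f X])
    next
      fix f f' assume ff: "smooth_section A (dual_bundle B) U f \<and> smooth_section A (dual_bundle B) U f' \<and> (\<forall>p\<in>U. f p = f' p)"
      fix p assume p: "p \<in> U"
      show "?D f p = ?D f' p"
      proof (rule ext, rule eqI[OF p U])
        fix X W s assume W: "openin (man_topology A) W" "W \<subseteq> U" "p \<in> W" and s: "smooth_section A B W s"
        have f: "smooth_section A (dual_bundle B) W f" "smooth_section A (dual_bundle B) W f'"
          using ff smooth_section_subset W(2) by blast+
        have "dfun A (\<lambda>x. f x (s x)) p = dfun A (\<lambda>x. f' x (s x)) p"
          by (rule dfun_cong[OF W(1,3)]) (use ff W in auto)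
        then show "?D f p X (s p) = ?D f' p X (s p)"
          using ff p by (simp add: dual_conn_apply[OF B conn W(1,3) s f(1)] dual_conn_apply[OF B conn W(1,3) s f(2)])
      qed
    next
      fix f f' assume ff: "smooth_section A (dual_bundle B) U f \<and> smooth_section A (dual_bundle B) U f'"
      fix p X assume p: "p \<in> U"
      show "?D (\<lambda>q. f q + f' q) p X = ?D f p X + ?D f' p X"
      proof (rule eqI[OF p U])
        fix W s assume W: "openin (man_topology A) W" "W \<subseteq> U" "p \<in> W" and s: "smooth_section A B W s"
        have f: "smooth_section A (dual_bundle B) W f" "smooth_section A (dual_bundle B) W f'"
          using ff smooth_section_subset W(2) by blast+
        note fs = smooth_section_dual_apply[OF B W(1) _ s]
        show "?D (\<lambda>q. f q + f' q) p X (s p) = (?D f p X + ?D f' p X) (s p)"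
          using dfun_add[OF fs[OF f(1)] fs[OF f(2)] W(3) pA[OF p], of X]
          by (simp add: dual_conn_apply[OF B conn W(1,3) s] f smooth_section_add[OF Bd W(1)] blinfun.add_left)
      qed
    next
      fix g :: "'p \<Rightarrow> real" and f assume ff: "smooth_map A U g \<and> smooth_section A (dual_bundle B) U f"
      fix p X assume p: "p \<in> U"
      show "?D (\<lambda>q. g q *\<^sub>R f q) p X = dfun A g p X *\<^sub>R f p + g p *\<^sub>R ?D f p X"
      proof (rule eqI[OF p U])
        fix W s assume W: "openin (man_topology A) W" "W \<subseteq> U" "p \<in> W" and s: "smooth_section A B W s"
        have f: "smooth_map A W g" "smooth_section A (dual_bundle B) W f"
          using ff smooth_section_subset smooth_map_subset W(2) by blast+
        note fs = smooth_section_dual_apply[OF B W(1) f(2) s]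
        show "?D (\<lambda>q. g q *\<^sub>R f q) p X (s p) = (dfun A g p X *\<^sub>R f p + g p *\<^sub>R ?D f p X) (s p)"
          using dfun_mult[OF f(1) fs W(3) pA[OF p], of X]
          by (simp add: dual_conn_apply[OF B conn W(1,3) s] f smooth_section_scaleR[OF Bd W(1)]
              blinfun.add_left blinfun.scaleR_left algebra_simps)
      qed
    }
  next
    fix U X Y f p
    assume a: "openin (man_topology A) U \<and> vector_field A U X \<and> vector_field A U Y \<and> smooth_section A (dual_bundle B) U f"
      and p: "p \<in> U"
    then have U: "openin (man_topology A) U" by simp
    note pA = subsetD[OF openin_subset_points[OF U]]
    show "?D (\<lambda>q. ?D f q (Y q)) p (X p) - ?D (\<lambda>q. ?D f q (X q)) p (Y p) - ?D f p (lie_bracket A X Y p) = 0"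
    proof (rule eqI[OF p U])
      fix W s assume W: "openin (man_topology A) W" "W \<subseteq> U" "p \<in> W" and s: "smooth_section A B W s"
      have f: "smooth_section A (dual_bundle B) W f" and X: "vector_field A W X" and Y: "vector_field A W Y"
        using a smooth_section_subset W(2) unfolding vector_field_def by blast+
      have ns: "smooth_section A B W (\<lambda>p. nab s p (Z p))" if "vector_field A W Z" for Z
        by (rule connectionD(2)[OF conn W(1), unfolded section_of_UNIV, OF s that])
      \<comment> \<open>The second covariant derivative paired with s. The two middle terms are
        exchanged when Z and Z' are, so antisymmetrising leaves a commutator on the function f(s)
        and the curvature of \<open>nab\<close>.\<close>
      have step: "?D (\<lambda>q. ?D f q (Z q)) p (Z' p) (s p) = dfun A (\<lambda>q. dfun A (\<lambda>x. f x (s x)) q (Z q)) p (Z' p)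
          - dfun A (\<lambda>q. f q (nab s q (Z q))) p (Z' p)
          - (dfun A (\<lambda>q. f q (nab s q (Z' q))) p (Z p) - f p (nab (\<lambda>q. nab s q (Z' q)) p (Z p)))"
        if Z: "vector_field A W Z" and Z': "vector_field A W Z'" for Z Z'
      proof -
        note fs = smooth_section_dual_apply[OF B W(1) f]
        have "dfun A (\<lambda>x. ?D f x (Z x) (s x)) p =
            dfun A (\<lambda>q. dfun A (\<lambda>x. f x (s x)) q (Z q) - f q (nab s q (Z q))) p"
          by (rule dfun_cong[OF W(1,3)]) (simp add: dual_conn_apply[OF B conn W(1) _ s f])
        then show ?thesis
          by (simp add: dual_conn_apply[OF B conn W(1,3) s dual_conn_smooth[OF B conn W(1) f Z]]
            dual_conn_apply[OF B conn W(1,3) ns[OF Z'] f]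
            dfun_diff[OF smooth_map_dfun[OF W(1) fs[OF s] Z] fs[OF ns[OF Z]] W(3) pA[OF p]])
      qed
      have "nab (\<lambda>q. nab s q (Y q)) p (X p) - nab (\<lambda>q. nab s q (X q)) p (Y p) - nab s p (lie_bracket A X Y p) = 0"
        using fl[unfolded flat_def section_of_UNIV, rule_format, of W X Y s p] W X Y s by blast
      from arg_cong[OF this, of "blinfun_apply (f p)"]
      have "f p (nab (\<lambda>q. nab s q (Y q)) p (X p)) - f p (nab (\<lambda>q. nab s q (X q)) p (Y p)) =
          f p (nab s p (lie_bracket A X Y p))"
        by (simp add: blinfun.diff_right)
      then show "(?D (\<lambda>q. ?D f q (Y q)) p (X p) - ?D (\<lambda>q. ?D f q (X q)) p (Y p) - ?D f p (lie_bracket A X Y p)) (s p)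
          = blinfun_apply 0 (s p)"
        using dfun_commutator[OF X Y W(1) smooth_section_dual_apply[OF B W(1) f s] W(3)]
        by (simp add: blinfun.diff_left step[OF X Y] step[OF Y X] dual_conn_apply[OF B conn W(1,3) s f])
    qed
  qed
qed

end

section \<open>The total space of a bundle with connection\<close>

text \<open>A member of \<open>total_space M V\<close>, named by the base chart and the
  trivialisation it is built from.\<close>

definition tchart :: "('m, 'e) chart \<Rightarrow> 'm set \<Rightarrow> ('m \<Rightarrow> 'v \<Rightarrow> 'v) \<Rightarrow> ('m \<times> 'v, 'e \<times> 'v) chart" where
  "tchart c U t = ((fst c \<inter> U) \<times> UNIV, \<lambda>(x, v). (snd c x, t x v))"

lemma fst_tchart [simp]: "fst (tchart c U t) = (fst c \<inter> U) \<times> UNIV"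
  and snd_tchart [simp]: "snd (tchart c U t) q = (snd c (fst q), t (fst q) (snd q))"
  by (simp_all add: tchart_def case_prod_beta)

lemma tchartI: "c \<in> M \<Longrightarrow> (U, t) \<in> V \<Longrightarrow> tchart c U t \<in> total_space M V"
  unfolding total_space_def tchart_def by (rule image_eqI[where x = "(c, U, t)"]) (auto split: prod.split)

lemma tchartE:
  assumes "C \<in> total_space M V"
  obtains c U t where "c \<in> M" "(U, t) \<in> V" "C = tchart c U t"
proof -
  obtain z where z: "z \<in> M \<times> V" "C = (\<lambda>((U, \<phi>), (U', t)). ((U \<inter> U') \<times> UNIV, \<lambda>(x, v). (\<phi> x, t x v))) z"
    using assms unfolding total_space_def by (elim imageE)
  obtain U \<phi> U' t where "z = ((U, \<phi>), (U', t))" by (metis prod.collapse)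
  then show ?thesis using z by (intro that[of "(U, \<phi>)" U' t]) (auto simp: tchart_def)
qed

lemma smooth_on_fst_pullback:
  fixes g :: "'a::finite_coords \<Rightarrow> 'c::real_normed_vector"
  assumes "open S" "smooth_on S g"
  shows "smooth_on (S \<times> (UNIV :: 'b::real_normed_vector set)) (\<lambda>z. g (fst z))"
  by (rule smooth_on_compose[OF open_Times[OF assms(1) open_UNIV]
        smooth_on_bounded_linear[OF bounded_linear_fst open_Times[OF assms(1) open_UNIV] smooth_on_ident] assms(2)]) auto

lemma smooth_on_snd: "open S \<Longrightarrow> smooth_on S snd"
  using smooth_on_bounded_linear[OF bounded_linear_snd _ smooth_on_ident] by blast

locale bundle_connection = atlas M for M :: "('m, 'e::euclidean_space) chart set" +
  fixes V :: "('m, 'v::euclidean_space) triv set" and nab :: "('m, 'e, 'v) conn"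
  assumes vbundle: "smooth_bundle M V" and conn: "connection M V (\<lambda>_. UNIV) nab"
begin

lemmas triv = smooth_bundle_triv[OF vbundle]

lemma triv_inv [simp]:
  assumes "(U, t) \<in> V" "x \<in> U"
  shows "t x (inv (t x) w) = w" "inv (t x) (t x w) = w"
  using bij_inv_simps[OF triv(3)[OF assms]] .

lemma linear_triv_inv: "(U, t) \<in> V \<Longrightarrow> x \<in> U \<Longrightarrow> linear (inv (t x))"
  using linear_inv_bij[OF triv(2,3)] .

lemma tchart_image:
  assumes "(U, t) \<in> V" "W \<subseteq> U"
  shows "snd (tchart c U t) ` (W \<times> UNIV) = snd c ` W \<times> UNIV"
proof (intro set_eqI iffI)
  fix z assume "z \<in> snd c ` W \<times> (UNIV :: 'v set)"
  then obtain x k where x: "x \<in> W" "z = (snd c x, k)" by auto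
  then have "z = snd (tchart c U t) (x, inv (t x) k)" using assms by auto
  then show "z \<in> snd (tchart c U t) ` (W \<times> UNIV)" using x by blast
qed auto

lemma inj_tchart: "c \<in> M \<Longrightarrow> (U, t) \<in> V \<Longrightarrow> inj_on (snd (tchart c U t)) (fst (tchart c U t))"
proof (rule inj_onI)
  fix q r assume c: "c \<in> M" and t: "(U, t) \<in> V" and q: "q \<in> fst (tchart c U t)" and r: "r \<in> fst (tchart c U t)"
    and eq: "snd (tchart c U t) q = snd (tchart c U t) r"
  have qU: "fst q \<in> fst c" "fst q \<in> U" "fst r \<in> fst c" using q r by auto
  have 1: "fst q = fst r" using inj_onD[OF inj_chart[OF c] _ qU(1,3)] eq by simp
  have "t (fst q) (snd q) = t (fst q) (snd r)" using eq 1 by simp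
  then have "snd q = snd r" by (rule injD[OF bij_is_inj[OF triv(3)[OF t qU(2)]]])
  then show "q = r" using 1 by (simp add: prod_eq_iff)
qed

lemma chart_inv_tchart [simp]:
  assumes "c \<in> M" "(U, t) \<in> V" "x \<in> fst c" "x \<in> U"
  shows "chart_inv (tchart c U t) (snd c x, k) = (x, inv (t x) k)"
  unfolding chart_inv_def by (rule inv_into_f_eq[OF inj_tchart]) (use assms in auto)

lemma openin_Int_charts:
  "openin (man_topology M) W \<Longrightarrow> c \<in> M \<Longrightarrow> (U, t) \<in> V \<Longrightarrow> openin (man_topology M) (W \<inter> (fst c \<inter> U))"
  using openin_chart triv(1) by blast

lemma points_total_space: "points (total_space M V) = points M \<times> UNIV"
proof (intro set_eqI iffI)
  fix q assume "q \<in> points (total_space M V)"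
  then obtain C where "C \<in> total_space M V" "q \<in> fst C" unfolding points_def by blast
  then show "q \<in> points M \<times> UNIV" by (elim tchartE) (auto simp: points_def)
next
  fix q :: "'m \<times> 'v" assume q: "q \<in> points M \<times> UNIV"
  then have "fst q \<in> points M" by auto
  then obtain U t c where *: "(U, t) \<in> V" "fst q \<in> U" "c \<in> M" "fst q \<in> fst c"
    using smooth_bundle_cover[OF vbundle] by (metis chart_at)
  then have "q \<in> fst (tchart c U t)" by (cases q) simp
  then show "q \<in> points (total_space M V)" using tchartI[OF *(3,1)] unfolding points_def by blast
qed

text \<open>A transition map pairs the base transition with a frame change applied to the fibre
  coordinate. The latter is linear in that coordinate and smooth in the base, so
  \<open>smooth_on_linear_family\<close> applies.\<close>

lemma atlas_total_space: "atlas (total_space M V)"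
proof
  fix C assume C: "C \<in> total_space M V"
  then obtain c U t where c: "c \<in> M" "(U, t) \<in> V" "C = tchart c U t" by (rule tchartE)
  show "inj_on (snd C) (fst C)" using inj_tchart c by simp
  have o: "openin (man_topology M) (fst c \<inter> U)" using openin_chart triv(1) c by blast
  have W: "open (snd c ` W \<times> (UNIV :: 'v set))" if "openin (man_topology M) W" "W \<subseteq> fst c" for W
    using open_image[OF that(1) c(1)] that(2) by (intro open_Times) (auto simp: Int_absorb2)
  show "open (snd C ` fst C)" using W[OF o] c tchart_image[of U t "fst c \<inter> U" c] by simp
  fix D assume D: "D \<in> total_space M V"
  then obtain d U' t' where d: "d \<in> M" "(U', t') \<in> V" "D = tchart d U' t'" by (rule tchartE)
  let ?W = "fst c \<inter> U \<inter> (fst d \<inter> U')"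
  have oW: "openin (man_topology M) ?W" using openin_Int_charts[OF o d(1,2)] .
  have CD: "fst C \<inter> fst D = ?W \<times> UNIV" using c d by auto
  have im: "snd C ` (fst C \<inter> fst D) = snd c ` ?W \<times> UNIV"
    unfolding CD using c tchart_image[of U t ?W c] by auto
  show "open (snd C ` (fst C \<inter> fst D))" unfolding im by (rule W[OF oW]) blast
  let ?S = "snd c ` ?W"
  have oS: "open ?S" using open_image[OF oW c(1)] by (simp add: Int_ac)
  have oSV: "open (?S \<times> (UNIV :: 'v set))" by (rule open_Times[OF oS open_UNIV])
  have 1: "smooth_on (?S \<times> (UNIV :: 'v set)) (\<lambda>z. (snd d \<circ> chart_inv c) (fst z))"
    by (rule smooth_on_fst_pullback[OF oS smooth_on_subset[OF smooth_transition[OF c(1) d(1)]]]) blast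
  let ?L = "\<lambda>u w. t' (chart_inv c u) (inv (t (chart_inv c u)) w)"
  have 2: "smooth_on (?S \<times> UNIV) (\<lambda>z. ?L (fst z) (snd z))"
  proof (rule smooth_on_linear_family[OF oSV _ _ smooth_on_snd[OF oSV]])
    show "linear (?L (fst z))" if z: "z \<in> ?S \<times> (UNIV :: 'v set)" for z
    proof -
      obtain x where x: "x \<in> ?W" "fst z = snd c x" using z by auto
      then show ?thesis
        using linear_compose[OF linear_triv_inv[OF c(2), of x] triv(2)[OF d(2), of x]] c(1) by (simp add: comp_def)
    qed
    fix w
    have "smooth_map M ?W (\<lambda>x. t' x (inv (t x) w))"
      by (rule smooth_bundle_frame_change[OF vbundle c(2) d(2) smooth_map_const oW]) blast
    from smooth_mapD[OF this c(1)] have "smooth_on ?S (\<lambda>u. ?L u w)" by (simp add: Int_ac comp_def)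
    then show "smooth_on (?S \<times> (UNIV :: 'v set)) (\<lambda>z. ?L (fst z) w)" by (rule smooth_on_fst_pullback[OF oS])
  qed
  have "smooth_on (?S \<times> UNIV) (\<lambda>z. ((snd d \<circ> chart_inv c) (fst z), ?L (fst z) (snd z)))"
    by (rule smooth_on_Pair[OF oSV 1 2])
  then show "smooth_on (snd C ` (fst C \<inter> fst D)) (snd D \<circ> chart_inv C)"
    unfolding im by (rule smooth_on_transform[OF oSV]) (use c d in auto)
qed

end

sublocale bundle_connection \<subseteq> N: atlas "total_space M V"
  by (rule atlas_total_space)

context bundle_connection begin

abbreviation N where "N \<equiv> total_space M V"

lemma openin_total_space:
  assumes W: "openin (man_topology M) W"
  shows "openin (man_topology N) (W \<times> UNIV)"
  unfolding N.openin_iff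
proof (intro conjI ballI)
  show "W \<times> UNIV \<subseteq> points N" using openin_subset_points[OF W] by (auto simp: points_total_space)
  fix C assume "C \<in> N"
  then obtain c U t where c: "c \<in> M" "(U, t) \<in> V" "C = tchart c U t" by (rule tchartE)
  have "W \<times> UNIV \<inter> fst C = (W \<inter> (fst c \<inter> U)) \<times> UNIV" using c by auto
  moreover have "open (snd c ` (W \<inter> (fst c \<inter> U)))"
    using open_image[OF openin_Int_charts[OF W c(1,2)] c(1)] by (simp add: Int_ac)
  moreover have "snd C ` ((W \<inter> (fst c \<inter> U)) \<times> UNIV) = snd c ` (W \<inter> (fst c \<inter> U)) \<times> UNIV"
    unfolding c(3) by (rule tchart_image[OF c(2)]) blast
  ultimately show "open (snd C ` (W \<times> UNIV \<inter> fst C))" by (simp only: open_Times open_UNIV)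
qed

lemma ex_tchart:
  assumes "p \<in> points M"
  obtains c U t where "c \<in> M" "(U, t) \<in> V" "p \<in> fst c" "p \<in> U"
proof -
  obtain U t where t: "(U, t) \<in> V" "p \<in> U" using smooth_bundle_cover[OF vbundle assms] by blast
  then show ?thesis using that[of "chart_at M p" U t] chart_at[OF assms] by blast
qed

text \<open>Objects lifted from the base live over sets containing whole fibres, whose images in
  bundle charts are products.\<close>

lemma smooth_map_total_spaceI:
  assumes W: "openin (man_topology M) W"
    and loc: "\<And>p. p \<in> W \<Longrightarrow> \<exists>W' c U t. openin (man_topology M) W' \<and> c \<in> M \<and> (U, t) \<in> V \<and> p \<in> W' \<and> W' \<subseteq> fst c \<inter> U \<and>
      smooth_on (snd c ` W' \<times> UNIV) (g \<circ> chart_inv (tchart c U t))"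
  shows "smooth_map N (W \<times> UNIV) g"
proof (rule N.smooth_map_chartI)
  fix q :: "'m \<times> 'v" assume q: "q \<in> W \<times> UNIV"
  then obtain W' c U t where *: "openin (man_topology M) W'" "c \<in> M" "(U, t) \<in> V" "fst q \<in> W'" "W' \<subseteq> fst c \<inter> U"
      "smooth_on (snd c ` W' \<times> UNIV) (g \<circ> chart_inv (tchart c U t))" using loc[of "fst q"] by auto
  have "W' \<times> UNIV \<inter> fst (tchart c U t) = W' \<times> UNIV" using *(5) by auto
  moreover have "snd (tchart c U t) ` (W' \<times> UNIV) = snd c ` W' \<times> UNIV" using tchart_image[OF *(3)] *(5) by blast
  ultimately have "smooth_on (snd (tchart c U t) ` (W' \<times> UNIV \<inter> fst (tchart c U t))) (g \<circ> chart_inv (tchart c U t))"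
    using *(6) by simp
  moreover have "q \<in> W' \<times> UNIV \<inter> fst (tchart c U t)" using *(4,5) by (cases q) auto
  ultimately show "\<exists>W C. openin (man_topology N) W \<and> C \<in> N \<and> q \<in> W \<inter> fst C \<and>
      smooth_on (snd C ` (W \<inter> fst C)) (g \<circ> chart_inv C)"
    using openin_total_space[OF *(1)] tchartI[OF *(2,3)] by blast
qed

lemma smooth_map_pullback:
  assumes W: "openin (man_topology M) W" and g: "smooth_map M W g"
  shows "smooth_map N (W \<times> UNIV) (\<lambda>q. g (fst q))"
proof (rule smooth_map_total_spaceI[OF W])
  fix p assume p: "p \<in> W"
  obtain c U t where c: "c \<in> M" "(U, t) \<in> V" "p \<in> fst c" "p \<in> U"
    using ex_tchart openin_subset_points[OF W] p by blast
  let ?W = "W \<inter> (fst c \<inter> U)"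
  have oW: "openin (man_topology M) ?W" by (rule openin_Int_charts[OF W c(1,2)])
  have oS: "open (snd c ` ?W)" using open_image[OF oW c(1)] by (simp add: Int_ac)
  have "smooth_on (snd c ` ?W) (g \<circ> chart_inv c)"
    by (rule smooth_on_subset[OF smooth_mapD[OF g c(1)]]) blast
  from smooth_on_fst_pullback[OF oS this]
  have "smooth_on (snd c ` ?W \<times> UNIV) ((\<lambda>q. g (fst q)) \<circ> chart_inv (tchart c U t))"
    by (rule smooth_on_transform[OF open_Times[OF oS open_UNIV]]) (use c in auto)
  then show "\<exists>W' c U t. openin (man_topology M) W' \<and> c \<in> M \<and> (U, t) \<in> V \<and> p \<in> W' \<and> W' \<subseteq> fst c \<inter> U \<and>
      smooth_on (snd c ` W' \<times> UNIV) ((\<lambda>q. g (fst q)) \<circ> chart_inv (tchart c U t))"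
    using oW c p by - (rule exI[of _ ?W], rule exI[of _ c], rule exI[of _ U], rule exI[of _ t], simp, blast)
qed

lemma smooth_map_fibre_coord:
  assumes t: "(U, t) \<in> V"
  shows "smooth_map N (U \<times> UNIV) (\<lambda>q. t (fst q) (snd q))"
proof (rule smooth_map_total_spaceI[OF triv(1)[OF t]])
  fix p assume p: "p \<in> U"
  have pM: "p \<in> points M" using openin_subset_points[OF triv(1)[OF t]] p by blast
  let ?c = "chart_at M p"
  have c: "?c \<in> M" "p \<in> fst ?c" using chart_at[OF pM] by auto
  let ?W = "fst ?c \<inter> U"
  have oW: "openin (man_topology M) ?W" using openin_chart[OF c(1)] triv(1)[OF t] by blast
  have oS: "open (snd ?c ` ?W \<times> (UNIV :: 'v set))" using open_image[OF oW c(1)] by (auto simp: Int_ac intro: open_Times)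
  have "smooth_on (snd ?c ` ?W \<times> UNIV) ((\<lambda>q. t (fst q) (snd q)) \<circ> chart_inv (tchart ?c U t))"
    by (rule smooth_on_transform[OF oS smooth_on_snd[OF oS]]) (use c t in auto)
  then show "\<exists>W' c U' t'. openin (man_topology M) W' \<and> c \<in> M \<and> (U', t') \<in> V \<and> p \<in> W' \<and> W' \<subseteq> fst c \<inter> U' \<and>
      smooth_on (snd c ` W' \<times> UNIV) ((\<lambda>q. t (fst q) (snd q)) \<circ> chart_inv (tchart c U' t'))"
    using oW c p t by (intro exI[of _ ?W] exI[of _ ?c] exI[of _ U] exI[of _ t]) simp
qed

text \<open>\<open>dproj\<close> and \<open>vert\<close> are defined through the chart chosen at the
  point of the total space. In any bundle chart they turn out to be projection to the base component
  and inclusion of the fibre component.\<close>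

lemma tcoord_tchart_fst_vert:
  assumes c: "c \<in> M" "p \<in> fst c" and t: "(U, t) \<in> V" "p \<in> U"
  shows "fst (tcoord N (tchart c U t) (p, v) w) = tcoord M c p (dproj M V (p, v) w)"
    and "tcoord N (tchart c U t) (p, v) (vert M V (p, v) k) = (0, t p k)"
proof -
  have pM: "p \<in> points M" using c chart_in_points by blast
  then have q: "(p, v) \<in> points N" by (simp add: points_total_space)
  \<comment> \<open>The chosen chart is some bundle chart, unrelated to c and t; everything is
    computed through the transition from it.\<close>
  obtain c0 U0 t0 where 0: "c0 \<in> M" "(U0, t0) \<in> V" "chart_at N (p, v) = tchart c0 U0 t0"
    using conjunct1[OF N.chart_at[OF q]] by (rule tchartE)
  have p0: "p \<in> fst c0" "p \<in> U0" using conjunct2[OF N.chart_at[OF q]] unfolding 0(3) by simp_all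
  let ?K = "tchart c0 U0 t0" and ?C = "tchart c U t"
  let ?W = "fst c0 \<inter> U0 \<inter> (fst c \<inter> U)"
  have oW: "openin (man_topology M) ?W" using openin_Int_charts[OF _ c(1) t(1)] openin_chart triv(1) 0 by blast
  have oS: "open (snd c0 ` ?W \<times> (UNIV :: 'v set))"
    using open_image[OF oW 0(1)] by (intro open_Times) (auto simp: Int_ac)
  let ?zz = "(snd c0 p, t0 p v)"
  have z0: "?zz \<in> snd c0 ` ?W \<times> UNIV" using p0 c t by auto
  have eq: "(snd ?C \<circ> chart_inv ?K) (snd c0 x, k) = (snd c x, t x (inv (t0 x) k))" if "x \<in> ?W" for x k
    using that 0 by simp
  have D: "((snd ?C \<circ> chart_inv ?K) has_derivative tcoord N ?C (p, v)) (at ?zz)"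
    using N.smooth_map_has_derivative[OF N.smooth_map_chart[OF tchartI[OF c(1) t(1)]], of "(p, v)" ?K] c t 0 p0
      tchartI[OF 0(1,2)] by (simp add: tcoord_def)
  have trans: "frechet_derivative (snd d \<circ> chart_inv c0) (at (snd c0 p)) h = tcoord M d p (inv (tcoord M c0 p) h)"
    if "d \<in> M" "p \<in> fst d" for d h
    using tcoord_transition[OF 0(1) p0(1) that, of "inv (tcoord M c0 p) h"] bij_tcoord_simps(1)[OF 0(1) p0(1)] by simp
  \<comment> \<open>The base part of a transition does not see the fibre coordinate. It is needed
    twice, for the chart c and for the chart chosen at p.\<close>
  have base: "((\<lambda>z. (snd d \<circ> chart_inv c0) (fst z)) has_derivative (\<lambda>w. tcoord M d p (inv (tcoord M c0 p) (fst w)))) (at ?zz)"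
    if d: "d \<in> M" "p \<in> fst d" for d
  proof -
    have "((snd d \<circ> chart_inv c0) has_derivative frechet_derivative (snd d \<circ> chart_inv c0) (at (snd c0 p))) (at (fst ?zz))"
      using smooth_map_has_derivative[OF smooth_map_chart[OF d(1)] d(2) 0(1) p0(1)] by simp
    from has_derivative_compose[OF has_derivative_fst[OF has_derivative_ident] this]
    show ?thesis by (simp add: trans[OF d])
  qed
  have "((\<lambda>z. fst ((snd ?C \<circ> chart_inv ?K) z)) has_derivative (\<lambda>w. tcoord M c p (inv (tcoord M c0 p) (fst w)))) (at ?zz)"
    by (rule has_derivative_transform_within_open[OF base[OF c] oS z0]) (use eq 0 in auto)
  from has_derivative_unique[OF has_derivative_fst[OF D] this]
  have f: "fst (tcoord N ?C (p, v) w) = tcoord M c p (inv (tcoord M c0 p) (fst w))" for w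
    by (rule fun_cong)
  let ?a = "chart_at M p"
  have a: "?a \<in> M" "p \<in> fst ?a" using chart_at[OF pM] by auto
  let ?W' = "fst c0 \<inter> U0 \<inter> fst ?a"
  have oW': "openin (man_topology M) ?W'" using openin_chart a triv(1) 0 by blast
  have oS': "open (snd c0 ` ?W' \<times> (UNIV :: 'v set))"
    using open_image[OF oW' 0(1)] by (intro open_Times) (auto simp: Int_ac)
  have "((snd ?a \<circ> fst \<circ> chart_inv ?K) has_derivative (\<lambda>w. tcoord M ?a p (inv (tcoord M c0 p) (fst w)))) (at ?zz)"
    by (rule has_derivative_transform_within_open[OF base[OF a] oS'])
      (use p0 a 0 in auto)
  from frechet_derivative_eqI[OF this]
  have dp: "dproj M V (p, v) w = inv (tcoord M c0 p) (fst w)" for w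
    unfolding dproj_def tdiff_def 0(3) by (simp add: tcoord_chart_at[OF pM])
  show "fst (tcoord N ?C (p, v) w) = tcoord M c p (dproj M V (p, v) w)"
    by (simp add: f dp)
  have bl: "bounded_linear (t0 p)" "bounded_linear (\<lambda>k. t p (inv (t0 p) k))"
    using linear_imp_bounded_linear triv(2)[OF 0(2) p0(2)]
      linear_compose[OF linear_triv_inv[OF 0(2) p0(2)] triv(2)[OF t]] by (auto simp: comp_def)
  have "((\<lambda>s. snd ?K (fst (p, v), s)) has_derivative (\<lambda>k. (0, t0 p k))) (at (snd (p, v)))"
    by (auto intro!: derivative_eq_intros bounded_linear.has_derivative[OF bl(1)])
  then have vt: "vert M V (p, v) k = (0, t0 p k)" for k
    unfolding vert_def 0(3) by (simp add: frechet_derivative_eqI)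
  \<comment> \<open>Restriction to the fibre: there the transition fixes the base point and is a
    linear frame change.\<close>
  have "((\<lambda>k. (snd ?C \<circ> chart_inv ?K) (snd c0 p, k)) has_derivative (\<lambda>k. tcoord N ?C (p, v) (0, k))) (at (t0 p v))"
    by (rule has_derivative_compose[where f = "\<lambda>k. (snd c0 p, k)" and g = "snd ?C \<circ> chart_inv ?K", OF _ D])
      (auto intro!: derivative_eq_intros)
  moreover have "((\<lambda>k. (snd ?C \<circ> chart_inv ?K) (snd c0 p, k)) has_derivative (\<lambda>k. (0, t p (inv (t0 p) k)))) (at (t0 p v))"
    using p0 c t by (subst eq) (auto intro!: derivative_eq_intros bounded_linear.has_derivative[OF bl(2)])
  ultimately have "(\<lambda>k. tcoord N ?C (p, v) (0, k)) = (\<lambda>k. (0, t p (inv (t0 p) k)))"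
    by (rule has_derivative_unique)
  from fun_cong[OF this, of "t0 p k"] show "tcoord N ?C (p, v) (vert M V (p, v) k) = (0, t p k)"
    by (simp add: vt triv_inv[OF 0(2) p0(2)])
qed

section \<open>The connection splitting in bundle charts\<close>

lemma frame_section:
  "(U, t) \<in> V \<Longrightarrow> smooth_section M V U (\<lambda>x. inv (t x) k)"
  by (rule triv(4))

text \<open>Coefficients constant in the frame have no derivative, so only the connection
  coefficients survive, and these are linear in k.\<close>

lemma nab_frame_expand:
  assumes t: "(U, t) \<in> V" "p \<in> U"
  shows "nab (\<lambda>x. inv (t x) k) p Y = (\<Sum>b\<in>Basis. (k \<bullet> b) *\<^sub>R nab (\<lambda>x. inv (t x) b) p Y)"
proof -
  have "dfun M (\<lambda>x. t x (inv (t x) k) \<bullet> b) p Y = 0" for b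
    using dfun_cong[OF triv(1)[OF t(1)] t(2), of "\<lambda>x. t x (inv (t x) k) \<bullet> b" "\<lambda>x. k \<bullet> b"] t
    by (simp add: dfun_const)
  then show ?thesis
    using conn_frame[OF vbundle conn triv(1)[OF t(1)] t(2) frame_section[OF t(1)] t, of k Y] t by simp
qed

lemma linear_nab_frame: "(U, t) \<in> V \<Longrightarrow> p \<in> U \<Longrightarrow> linear (nab (\<lambda>x. inv (t x) k) p)"
  using connectionD(1)[OF conn triv(1), unfolded section_of_UNIV, OF _ frame_section] .

lemma tcoord_tchart:
  assumes "c \<in> M" "p \<in> fst c" "(U, t) \<in> V" "p \<in> U"
  shows "linear (tcoord N (tchart c U t) (p, v))" "bij (tcoord N (tchart c U t) (p, v))"
  using assms by (auto intro!: N.linear_tcoord N.bij_tcoord tchartI)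

lemma dproj_tchart:
  assumes "c \<in> M" "p \<in> fst c" "(U, t) \<in> V" "p \<in> U"
  shows "dproj M V (p, v) w = inv (tcoord M c p) (fst (tcoord N (tchart c U t) (p, v) w))"
  using assms by (simp add: tcoord_tchart_fst_vert bij_tcoord_simps)

text \<open>The formula D(w, m) = m + A(w) k in an arbitrary trivialisation t, whereas
  \<open>pullback_conn\<close> uses the one chosen at p. Passing from one to the other
  differentiates the frame change, and the Leibniz rule for \<open>nab\<close> absorbs that
  derivative.\<close>

lemma vproj_tchart:
  assumes c: "c \<in> M" "p \<in> fst c" and t: "(U, t) \<in> V" "p \<in> U"
  shows "vproj M V nab (p, v) w = inv (t p) (snd (tcoord N (tchart c U t) (p, v) w)) +
    nab (\<lambda>x. inv (t x) (t p v)) p (dproj M V (p, v) w)"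
proof -
  have pM: "p \<in> points M" using c chart_in_points by blast
  define r where "r = triv_at V p"
  obtain Ur where r: "(Ur, r) \<in> V" "p \<in> Ur" using triv_at[OF vbundle pM] unfolding r_def by blast
  let ?C = "tchart c U t" and ?s = "\<lambda>x. inv (t x) (t p v)"
  let ?T = "tcoord N ?C (p, v)" and ?W = "fst c \<inter> (U \<inter> Ur)"
  have oW: "openin (man_topology M) ?W" "p \<in> ?W" using openin_chart triv(1) c t r by blast+
  have oS: "open (snd c ` ?W)" using open_image[OF oW(1) c(1)] by (simp add: Int_ac)
  let ?S = "snd c ` ?W \<times> (UNIV :: 'v set)" and ?z = "(snd c p, t p v)"
  have S: "open ?S" "?z \<in> ?S" using oS c t r by (auto intro: open_Times)
  let ?g = "\<lambda>k b x. r x (inv (t x) k) \<bullet> b"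
  have g: "smooth_map M ?W (?g k b)" for k b
    by (rule smooth_map_bounded_linear[OF bounded_linear_inner_left oW(1)
          smooth_bundle_frame_change[OF vbundle t(1) r(1) smooth_map_const oW(1)]]) blast
  have D: "dfun N (\<lambda>q. r (fst q) (snd q) \<bullet> b) (p, v) w =
      r p (inv (t p) (snd (?T w))) \<bullet> b + dfun M (\<lambda>x. r x (?s x) \<bullet> b) p (dproj M V (p, v) w)" for b
  proof -
    \<comment> \<open>One coordinate of the change from t to r, as a linear family over the base
      chart. Applied to the fibre coordinate it gives the tautological section in the frame
      r.\<close>
    let ?L = "\<lambda>z k. ?g k b (chart_inv c (fst z))"
    have gd: "((\<lambda>z. ?L z k) has_derivative (\<lambda>w. frechet_derivative (?g k b \<circ> chart_inv c) (at (snd c p)) (fst w))) (at ?z)" for k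
      using has_derivative_compose[OF has_derivative_fst[OF has_derivative_ident], of "?g k b \<circ> chart_inv c" _ ?z UNIV]
        smooth_map_has_derivative[OF g oW(2) c] by (simp add: comp_def)
    have lin: "linear (?L z)" if z: "z \<in> ?S" for z
    proof -
      obtain x where x: "x \<in> ?W" "fst z = snd c x" using z by auto
      have "linear (\<lambda>k. r x (inv (t x) k))"
        using linear_compose[OF linear_triv_inv[OF t(1), of x] triv(2)[OF r(1), of x]] x by (simp add: comp_def)
      from linear_compose[OF this bounded_linear.linear[OF bounded_linear_inner_left]]
      show ?thesis using x c by (simp add: comp_def)
    qed
    have "((\<lambda>z. ?L z (snd z)) has_derivative (\<lambda>w. frechet_derivative (\<lambda>z. ?L z (snd ?z)) (at ?z) w + ?L ?z (snd w))) (at ?z)"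
      by (rule has_derivative_linear_family[OF S lin _ has_derivative_snd[OF has_derivative_ident]])
        (use gd in \<open>auto simp: differentiable_def\<close>)
    then have "((\<lambda>z. ?L z (snd z)) has_derivative
        (\<lambda>w. frechet_derivative (?g (t p v) b \<circ> chart_inv c) (at (snd c p)) (fst w) + r p (inv (t p) (snd w)) \<bullet> b)) (at ?z)"
      unfolding frechet_derivative_eqI[OF gd] using c by simp
    then have dN: "(((\<lambda>q. r (fst q) (snd q) \<bullet> b) \<circ> chart_inv ?C) has_derivative
        (\<lambda>w. frechet_derivative (?g (t p v) b \<circ> chart_inv c) (at (snd c p)) (fst w) + r p (inv (t p) (snd w)) \<bullet> b)) (at ?z)"
      by (rule has_derivative_transform_within_open[OF _ S]) (use c t in auto)
    have "dfun N (\<lambda>q. r (fst q) (snd q) \<bullet> b) (p, v) w = frechet_derivative ((\<lambda>q. r (fst q) (snd q) \<bullet> b) \<circ> chart_inv ?C) (at (snd ?C (p, v))) (?T w)"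
      by (rule N.dfun_chart[OF tchartI[OF c(1) t(1)]]) (use c t dN in \<open>auto simp: differentiable_def\<close>)
    also have "\<dots> = frechet_derivative (?g (t p v) b \<circ> chart_inv c) (at (snd c p)) (tcoord M c p (dproj M V (p, v) w)) + r p (inv (t p) (snd (?T w))) \<bullet> b"
      using frechet_derivative_eqI[OF dN] by (simp add: tcoord_tchart_fst_vert[OF c t])
    also have "\<dots> = dfun M (?g (t p v) b) p (dproj M V (p, v) w) + r p (inv (t p) (snd (?T w))) \<bullet> b"
      using dfun_chart[OF c smooth_map_differentiable[OF g oW(2) c]] by simp
    finally show ?thesis by simp
  qed
  have "vproj M V nab (p, v) w = (\<Sum>b\<in>Basis. dfun N (\<lambda>q. r (fst q) (snd q) \<bullet> b) (p, v) w *\<^sub>R inv (r p) b +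
      (r p v \<bullet> b) *\<^sub>R nab (\<lambda>x. inv (r x) b) p (dproj M V (p, v) w))"
    unfolding vproj_def pullback_conn_def Let_def dproj_def r_def by simp
  \<comment> \<open>The fibre part is split off; the rest is \<open>conn_frame\<close> for the
    section through v that is constant in t.\<close>
  also have "\<dots> = (\<Sum>b\<in>Basis. (r p (inv (t p) (snd (?T w))) \<bullet> b) *\<^sub>R inv (r p) b) +
      (\<Sum>b\<in>Basis. dfun M (\<lambda>x. r x (?s x) \<bullet> b) p (dproj M V (p, v) w) *\<^sub>R inv (r p) b +
      (r p v \<bullet> b) *\<^sub>R nab (\<lambda>x. inv (r x) b) p (dproj M V (p, v) w))"
    unfolding D by (simp add: scaleR_add_left sum.distrib add.assoc)
  also have "\<dots> = inv (t p) (snd (?T w)) + nab ?s p (dproj M V (p, v) w)"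
    using conn_frame[OF vbundle conn triv(1)[OF t(1)] t(2) frame_section[OF t(1)] r, of "t p v" "dproj M V (p, v) w"]
      frame_expansion[OF vbundle r, of "inv (t p) (snd (?T w))"] t by simp
  finally show ?thesis .
qed

text \<open>\<open>hlift\<close> is a definite description, so existence and uniqueness are both
  due. Its two equations prescribe the base component and, through \<open>vproj_tchart\<close>, the
  fibre component.\<close>

lemma hlift_tchart:
  assumes c: "c \<in> M" "p \<in> fst c" and t: "(U, t) \<in> V" "p \<in> U"
  shows "tcoord N (tchart c U t) (p, v) (hlift M V nab (p, v) Y) =
    (tcoord M c p Y, - t p (nab (\<lambda>x. inv (t x) (t p v)) p Y))"
proof -
  let ?T = "tcoord N (tchart c U t) (p, v)" and ?n = "nab (\<lambda>x. inv (t x) (t p v)) p Y"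
  let ?z = "(tcoord M c p Y, - t p ?n)"
  have T: "?T (inv ?T z) = z" "inv ?T (?T w) = w" for z w
    using bij_inv_simps[OF tcoord_tchart(2)[OF c t]] by auto
  have neg: "inv (t p) (- t p n) = - n" for n
    using linear_neg[OF linear_triv_inv[OF t], of "t p n"] t by simp
  have "hlift M V nab (p, v) Y = inv ?T ?z"
    unfolding hlift_def
  proof (rule the_equality)
    have d: "dproj M V (p, v) (inv ?T ?z) = Y"
      by (simp add: dproj_tchart[OF c t] T bij_tcoord_simps[OF c])
    then show "dproj M V (p, v) (inv ?T ?z) = Y \<and> vproj M V nab (p, v) (inv ?T ?z) = 0"
      unfolding vproj_tchart[OF c t] by (simp add: T neg)
  next
    fix w assume w: "dproj M V (p, v) w = Y \<and> vproj M V nab (p, v) w = 0"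
    then have "fst (?T w) = tcoord M c p Y" by (simp add: tcoord_tchart_fst_vert[OF c t])
    moreover have "inv (t p) (snd (?T w)) = - ?n"
      using w unfolding vproj_tchart[OF c t] by (simp add: add_eq_0_iff2)
    then have "t p (inv (t p) (snd (?T w))) = t p (- ?n)" by simp
    then have "snd (?T w) = - t p ?n" using t linear_neg[OF triv(2)[OF t]] by simp
    ultimately have "?T w = ?z" by (simp add: prod_eq_iff)
    then show "w = inv ?T ?z" using T(2)[of w] by simp
  qed
  then show ?thesis by (simp add: T)
qed

text \<open>The connection splits the tangent sequence. Every identity is read off in a bundle
  chart, where \<open>tcoord\<close> is linear and injective.\<close>

lemma splitting:
  assumes p: "p \<in> points M"
  shows linear_dproj: "linear (dproj M V (p, v))"
    and linear_vproj: "linear (vproj M V nab (p, v))"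
    and linear_vert: "linear (vert M V (p, v))"
    and linear_hlift: "linear (hlift M V nab (p, v))"
    and dproj_vert: "dproj M V (p, v) (vert M V (p, v) k) = 0"
    and vproj_vert: "vproj M V nab (p, v) (vert M V (p, v) k) = k"
    and dproj_hlift: "dproj M V (p, v) (hlift M V nab (p, v) Y) = Y"
    and vproj_hlift: "vproj M V nab (p, v) (hlift M V nab (p, v) Y) = 0"
    and split_sum: "vert M V (p, v) (vproj M V nab (p, v) w) + hlift M V nab (p, v) (dproj M V (p, v) w) = w"
proof -
  obtain c U t where c: "c \<in> M" "p \<in> fst c" and t: "(U, t) \<in> V" "p \<in> U" by (rule ex_tchart[OF p])
  let ?T = "tcoord N (tchart c U t) (p, v)" and ?n = "nab (\<lambda>x. inv (t x) (t p v)) p"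
  note lT = tcoord_tchart(1)[OF c t, of v]
  have iT: "inv ?T (?T w) = w" for w using bij_inv_simps[OF tcoord_tchart(2)[OF c t]] by auto
  have inj: "w = w'" if "?T w = ?T w'" for w w'
    by (rule trans[OF iT[of w, symmetric]], subst that, rule iT)
  note ln = linear_nab_frame[OF t, of "t p v"]
  note li = linear_triv_inv[OF t] and lt = triv(2)[OF t] and lc = linear_tcoord[OF c]
  note lci = linear_inv_bij[OF lc bij_tcoord[OF c]]
  note v = tcoord_tchart_fst_vert(2)[OF c t] and h = hlift_tchart[OF c t]
  show ld: "linear (dproj M V (p, v))"
    by (rule linearI) (simp_all add: dproj_tchart[OF c t] linear_add[OF lT] linear_scale[OF lT] linear_add[OF lci] linear_scale[OF lci])
  show lv: "linear (vproj M V nab (p, v))"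
    by (rule linearI) (simp_all add: vproj_tchart[OF c t] linear_add[OF lT] linear_scale[OF lT] linear_add[OF li] linear_scale[OF li]
      linear_add[OF ln] linear_scale[OF ln] linear_add[OF ld] linear_scale[OF ld] scaleR_add_right)
  show lvt: "linear (vert M V (p, v))"
    by (rule linearI; rule inj) (simp_all add: linear_add[OF lT] linear_scale[OF lT] v linear_add[OF lt] linear_scale[OF lt])
  show lh: "linear (hlift M V nab (p, v))"
    by (rule linearI; rule inj) (simp_all add: linear_add[OF lT] linear_scale[OF lT] h linear_add[OF lt] linear_scale[OF lt]
      linear_add[OF ln] linear_scale[OF ln] linear_add[OF lc] linear_scale[OF lc])
  show dv: "dproj M V (p, v) (vert M V (p, v) k) = 0"
    by (simp add: dproj_tchart[OF c t] v linear_0[OF lci])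
  show "vproj M V nab (p, v) (vert M V (p, v) k) = k"
    using t by (simp add: vproj_tchart[OF c t] v dv linear_0[OF ln])
  show dh: "dproj M V (p, v) (hlift M V nab (p, v) Y) = Y"
    by (simp add: dproj_tchart[OF c t] h bij_tcoord_simps[OF c])
  show "vproj M V nab (p, v) (hlift M V nab (p, v) Y) = 0"
    using linear_neg[OF li] t by (simp add: vproj_tchart[OF c t] h dh)
  show "vert M V (p, v) (vproj M V nab (p, v) w) + hlift M V nab (p, v) (dproj M V (p, v) w) = w"
    by (rule inj) (use t in \<open>simp add: linear_add[OF lT] v h vproj_tchart[OF c t] linear_add[OF lt]
        tcoord_tchart_fst_vert(1)[OF c t, symmetric] prod_eq_iff\<close>)
qed

text \<open>The inverse of \<open>Fmap\<close>: vectors are assembled by the splitting, and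
  covectors are pulled back along the pair formed by D and the differential of the
  projection.\<close>

definition Finv :: "'m \<times> 'v \<Rightarrow> ('v \<times> 'e) \<times> (('v \<times> 'e) \<Rightarrow>\<^sub>L real) \<Rightarrow> ('e \<times> 'v) \<times> (('e \<times> 'v) \<Rightarrow>\<^sub>L real)" where
  "Finv q = (\<lambda>((k, Y), \<zeta>). (vert M V q k + hlift M V nab q Y,
      \<zeta> o\<^sub>L Blinfun (\<lambda>w. (vproj M V nab q w, dproj M V q w))))"

lemma Fmap_inverse:
  assumes p: "p \<in> points M"
  shows "bij (Fmap M V nab (p, v))" "inv (Fmap M V nab (p, v)) = Finv (p, v)"
proof -
  note lin = linear_dproj[OF p] linear_vproj[OF p] linear_vert[OF p] linear_hlift[OF p]
  have lpair: "linear (\<lambda>w. (vproj M V nab (p, v) w, dproj M V (p, v) w))"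
    by (rule linearI) (simp_all add: linear_add[OF lin(1)] linear_add[OF lin(2)] linear_scale[OF lin(1)] linear_scale[OF lin(2)])
  have 1: "Fmap M V nab (p, v) (Finv (p, v) y) = y" for y
  proof -
    obtain k Y \<zeta> where y: "y = ((k, Y), \<zeta>)" by (metis prod.collapse)
    have "\<zeta> (a, 0) + \<zeta> (0, b) = \<zeta> (a, b)" for a b
      by (simp add: blinfun.add_right[symmetric])
    then show ?thesis
      unfolding y Finv_def Fmap_def
      by (auto intro!: blinfun_eqI simp: Blinfun_linear_apply[OF lpair] Blinfun_linear_apply[OF lin(3)] Blinfun_linear_apply[OF lin(4)]
          linear_add[OF lin(1)] linear_add[OF lin(2)] dproj_vert[OF p] vproj_vert[OF p] dproj_hlift[OF p] vproj_hlift[OF p]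
          blinfun.add_left fst_blinfun.rep_eq snd_blinfun.rep_eq)
  qed
  have 2: "Finv (p, v) (Fmap M V nab (p, v) z) = z" for z
  proof -
    obtain w \<xi> where z: "z = (w, \<xi>)" by (metis prod.collapse)
    have "\<xi> (vert M V (p, v) (vproj M V nab (p, v) x)) + \<xi> (hlift M V nab (p, v) (dproj M V (p, v) x)) = \<xi> x" for x
      by (simp add: blinfun.add_right[symmetric] split_sum[OF p])
    then show ?thesis
      unfolding z Finv_def Fmap_def
      by (auto intro!: blinfun_eqI simp: Blinfun_linear_apply[OF lpair] Blinfun_linear_apply[OF lin(3)] Blinfun_linear_apply[OF lin(4)]
          split_sum[OF p] blinfun.add_left fst_blinfun.rep_eq snd_blinfun.rep_eq)
  qed
  show b: "bij (Fmap M V nab (p, v))" by (rule o_bij[of "Finv (p, v)"]) (auto simp: fun_eq_iff 1 2)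
  show "inv (Fmap M V nab (p, v)) = Finv (p, v)"
    by (rule ext) (metis 1 b bij_inv_simps(2))
qed

section \<open>Smooth lifts to the total space\<close>

lemma vector_field_total_spaceI:
  assumes W: "openin (man_topology M) W"
    and loc: "\<And>p c U t. p \<in> W \<Longrightarrow> c \<in> M \<Longrightarrow> (U, t) \<in> V \<Longrightarrow> openin (man_topology M) (W \<inter> (fst c \<inter> U)) \<Longrightarrow>
      smooth_map N ((W \<inter> (fst c \<inter> U)) \<times> UNIV) (\<lambda>q. tcoord N (tchart c U t) q (s q))"
  shows "vector_field N (W \<times> UNIV) s"
  unfolding vector_field_def
proof (rule N.smooth_sectionI[OF N.smooth_bundle_tangent openin_total_space[OF W]])
  fix q :: "'m \<times> 'v" assume q: "q \<in> W \<times> UNIV"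
  then have "fst q \<in> points M" using openin_subset_points[OF W] by auto
  then obtain c U t where c: "c \<in> M" "(U, t) \<in> V" "fst q \<in> fst c" "fst q \<in> U" by (rule ex_tchart)
  let ?W = "(W \<inter> (fst c \<inter> U)) \<times> (UNIV :: 'v set)"
  have o: "openin (man_topology M) (W \<inter> (fst c \<inter> U))" by (rule openin_Int_charts[OF W c(1,2)])
  have "?W \<inter> fst (tchart c U t) = ?W" by auto
  moreover have "smooth_map N ?W (\<lambda>q. tcoord N (tchart c U t) q (s q))"
    using loc[OF _ c(1,2) o, of "fst q"] q by auto
  moreover have "q \<in> ?W" using q c by (cases q) auto
  ultimately show "\<exists>W U' t. openin (man_topology N) W \<and> (U', t) \<in> tangent_bundle N \<and> q \<in> W \<inter> U' \<and>
      smooth_map N (W \<inter> U') (\<lambda>x. t x (s x))"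
    using openin_total_space[OF o] N.tangent_bundleI[OF tchartI[OF c(1,2)]]
    by - (rule exI[of _ ?W], rule exI[of _ "fst (tchart c U t)"], rule exI[of _ "tcoord N (tchart c U t)"], simp)
qed

lemma vector_field_vert:
  assumes W: "openin (man_topology M) W" and s: "smooth_section M V W s"
  shows "vector_field N (W \<times> UNIV) (\<lambda>q. vert M V q (s (fst q)))"
proof (rule vector_field_total_spaceI[OF W])
  fix c U t assume c: "c \<in> M" "(U, t) \<in> V" and o: "openin (man_topology M) (W \<inter> (fst c \<inter> U))"
  let ?W = "(W \<inter> (fst c \<inter> U)) \<times> (UNIV :: 'v set)"
  have "smooth_map M (W \<inter> (fst c \<inter> U)) (\<lambda>x. t x (s x))"
    by (rule smooth_map_subset[OF smooth_sectionD[OF s c(2)]]) blast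
  then have "smooth_map N ?W (\<lambda>q. (0::'e, t (fst q) (s (fst q))))"
    by (intro N.smooth_map_Pair openin_total_space o smooth_map_pullback N.smooth_map_const)
  then show "smooth_map N ?W (\<lambda>q. tcoord N (tchart c U t) q (vert M V q (s (fst q))))"
    by (rule N.smooth_map_transform[OF openin_total_space[OF o]]) (use c tcoord_tchart_fst_vert(2)[OF c(1) _ c(2)] in auto)
qed

lemma smooth_nab_frame:
  assumes W: "openin (man_topology M) W" and X: "vector_field M W X" and t: "(U, t) \<in> V" and "W \<subseteq> U"
  shows "smooth_section M V W (\<lambda>x. nab (\<lambda>y. inv (t y) k) x (X x))"
  by (rule connectionD(2)[OF conn W, unfolded section_of_UNIV, OF smooth_section_subset[OF frame_section[OF t] \<open>W \<subseteq> U\<close>] X])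

lemma vector_field_hlift:
  assumes W: "openin (man_topology M) W" and X: "vector_field M W X"
  shows "vector_field N (W \<times> UNIV) (\<lambda>q. hlift M V nab q (X (fst q)))"
proof (rule vector_field_total_spaceI[OF W])
  fix c U t assume c: "c \<in> M" "(U, t) \<in> V" and o: "openin (man_topology M) (W \<inter> (fst c \<inter> U))"
  let ?B = "W \<inter> (fst c \<inter> U)" let ?W = "?B \<times> (UNIV :: 'v set)"
  note oN = openin_total_space[OF o]
  have 1: "smooth_map M ?B (\<lambda>x. tcoord M c x (X x))"
    by (rule smooth_map_subset[OF smooth_sectionD[OF X[unfolded vector_field_def] tangent_bundleI[OF c(1)]]]) blast
  have X': "vector_field M ?B X" using X unfolding vector_field_def by (rule smooth_section_subset) blast
  have 2: "smooth_map M ?B (\<lambda>x. t x (nab (\<lambda>y. inv (t y) b) x (X x)))" for b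
    by (rule smooth_map_subset[OF smooth_sectionD[OF smooth_nab_frame[OF o X' c(2)] c(2)]]) auto
  have 3: "smooth_map N ?W (\<lambda>q. t (fst q) (snd q) \<bullet> b)" for b
    by (rule N.smooth_map_bounded_linear[OF bounded_linear_inner_left oN
          N.smooth_map_subset[OF smooth_map_fibre_coord[OF c(2)]]]) auto
  \<comment> \<open>In the fibre component the fibre coordinates are separated from connection
    coefficients that are pulled back from the base.\<close>
  have "smooth_map N ?W (\<lambda>q. (tcoord M c (fst q) (X (fst q)),
      - (\<Sum>b\<in>Basis. (t (fst q) (snd q) \<bullet> b) *\<^sub>R t (fst q) (nab (\<lambda>y. inv (t y) b) (fst q) (X (fst q))))))"
    by (intro N.smooth_map_Pair N.smooth_map_minus N.smooth_map_sum N.smooth_map_scaleR oN 3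
        smooth_map_pullback[OF o 1] smooth_map_pullback[OF o 2])
  then show "smooth_map N ?W (\<lambda>q. tcoord N (tchart c U t) q (hlift M V nab q (X (fst q))))"
  proof (rule N.smooth_map_transform[OF oN])
    fix q assume q: "q \<in> ?W"
    then obtain p v where pv: "q = (p, v)" "p \<in> fst c" "p \<in> U" by auto
    show "(tcoord M c (fst q) (X (fst q)),
      - (\<Sum>b\<in>Basis. (t (fst q) (snd q) \<bullet> b) *\<^sub>R t (fst q) (nab (\<lambda>y. inv (t y) b) (fst q) (X (fst q))))) =
      tcoord N (tchart c U t) q (hlift M V nab q (X (fst q)))"
      using hlift_tchart[OF c(1) pv(2) c(2) pv(3), of v "X p"] nab_frame_expand[OF c(2) pv(3), of "t p v" "X p"]
      by (simp add: pv linear_sum[OF triv(2)[OF c(2) pv(3)]] linear_scale[OF triv(2)[OF c(2) pv(3)]])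
  qed
qed

lemma form_total_spaceI:
  fixes \<xi> :: "'m \<times> 'v \<Rightarrow> ('e \<times> 'v) \<Rightarrow>\<^sub>L real"
  assumes W: "openin (man_topology M) W"
    and loc: "\<And>c U t w. c \<in> M \<Longrightarrow> (U, t) \<in> V \<Longrightarrow> openin (man_topology M) (W \<inter> (fst c \<inter> U)) \<Longrightarrow>
      smooth_map N ((W \<inter> (fst c \<inter> U)) \<times> UNIV) (\<lambda>q. \<xi> q (inv (tcoord N (tchart c U t) q) w))"
  shows "smooth_section N (dual_bundle (tangent_bundle N)) (W \<times> UNIV) \<xi>"
proof (rule N.smooth_section_dualI[OF N.smooth_bundle_tangent openin_total_space[OF W]])
  fix U' r w assume "(U', r) \<in> tangent_bundle N"
  then obtain C where C: "C \<in> N" "U' = fst C" "r = tcoord N C" by (rule N.tangent_bundleE)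
  obtain c U t where c: "c \<in> M" "(U, t) \<in> V" "C = tchart c U t" using C(1) by (rule tchartE)
  have "W \<times> UNIV \<inter> U' = (W \<inter> (fst c \<inter> U)) \<times> UNIV" using c C by auto
  then show "smooth_map N (W \<times> UNIV \<inter> U') (\<lambda>x. \<xi> x (inv (r x) w))"
    using loc[OF c(1,2) openin_Int_charts[OF W c(1,2)], of w] by (simp add: C(3) c(3))
qed

lemma dproj_inv_tcoord:
  assumes "c \<in> M" "p \<in> fst c" "(U, t) \<in> V" "p \<in> U"
  shows "dproj M V (p, v) (inv (tcoord N (tchart c U t) (p, v)) w) = inv (tcoord M c p) (fst w)"
  by (simp add: dproj_tchart[OF assms] bij_inv_simps[OF tcoord_tchart(2)[OF assms]])

lemma vproj_inv_tcoord:
  assumes "c \<in> M" "p \<in> fst c" "(U, t) \<in> V" "p \<in> U"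
  shows "vproj M V nab (p, v) (inv (tcoord N (tchart c U t) (p, v)) w) = inv (t p) (snd w) +
    (\<Sum>b\<in>Basis. (t p v \<bullet> b) *\<^sub>R nab (\<lambda>x. inv (t x) b) p (inv (tcoord M c p) (fst w)))"
  by (simp add: vproj_tchart[OF assms] dproj_inv_tcoord[OF assms] bij_inv_simps[OF tcoord_tchart(2)[OF assms]]
      nab_frame_expand[OF assms(3,4), of "t p v"])

lemma smooth_dproj_form:
  assumes W: "openin (man_topology M) W" and \<xi>: "smooth_section M (dual_bundle (tangent_bundle M)) W \<xi>"
  shows "smooth_section N (dual_bundle (tangent_bundle N)) (W \<times> UNIV) (\<lambda>q. \<xi> (fst q) o\<^sub>L Blinfun (dproj M V q))"
proof (rule form_total_spaceI[OF W])
  fix c U t and w :: "'e \<times> 'v"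
  assume c: "c \<in> M" "(U, t) \<in> V" and o: "openin (man_topology M) (W \<inter> (fst c \<inter> U))"
  let ?B = "W \<inter> (fst c \<inter> U)"
  have "smooth_section M (tangent_bundle M) ?B (\<lambda>x. inv (tcoord M c x) (fst w))"
    by (rule smooth_section_subset[OF smooth_bundle_triv(4)[OF smooth_bundle_tangent tangent_bundleI[OF c(1)]]]) blast
  from smooth_section_dual_apply[OF smooth_bundle_tangent o smooth_section_subset[OF \<xi>] this]
  have "smooth_map N (?B \<times> UNIV) (\<lambda>q. \<xi> (fst q) (inv (tcoord M c (fst q)) (fst w)))"
    by (intro smooth_map_pullback[OF o]) auto
  then show "smooth_map N (?B \<times> UNIV) (\<lambda>q. (\<xi> (fst q) o\<^sub>L Blinfun (dproj M V q)) (inv (tcoord N (tchart c U t) q) w))"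
    by (rule N.smooth_map_transform[OF openin_total_space[OF o]])
      (use c dproj_inv_tcoord[OF c(1) _ c(2), where w = w] Blinfun_linear_apply[OF linear_dproj] chart_in_points[OF c(1)] in auto)
qed

lemma smooth_vproj_form:
  assumes W: "openin (man_topology M) W" and f: "smooth_section M (dual_bundle V) W f"
  shows "smooth_section N (dual_bundle (tangent_bundle N)) (W \<times> UNIV) (\<lambda>q. f (fst q) o\<^sub>L Blinfun (vproj M V nab q))"
proof (rule form_total_spaceI[OF W])
  fix c U t and w :: "'e \<times> 'v"
  assume c: "c \<in> M" "(U, t) \<in> V" and o: "openin (man_topology M) (W \<inter> (fst c \<inter> U))"
  let ?B = "W \<inter> (fst c \<inter> U)"
  note oN = openin_total_space[OF o]
  have f0: "smooth_section M (dual_bundle V) ?B f" by (rule smooth_section_subset[OF f]) blast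
  have X: "vector_field M ?B (\<lambda>x. inv (tcoord M c x) (fst w))" unfolding vector_field_def
    by (rule smooth_section_subset[OF smooth_bundle_triv(4)[OF smooth_bundle_tangent tangent_bundleI[OF c(1)]]]) blast
  have 1: "smooth_map M ?B (\<lambda>x. f x (inv (t x) (snd w)))"
    by (rule smooth_section_dual_apply[OF vbundle o f0 smooth_section_subset[OF frame_section[OF c(2)]]]) blast
  have 2: "smooth_map M ?B (\<lambda>x. f x (nab (\<lambda>y. inv (t y) b) x (inv (tcoord M c x) (fst w))))" for b
    by (rule smooth_section_dual_apply[OF vbundle o f0 smooth_nab_frame[OF o X c(2)]]) blast
  have 3: "smooth_map N (?B \<times> UNIV) (\<lambda>q. t (fst q) (snd q) \<bullet> b)" for b
    by (rule N.smooth_map_bounded_linear[OF bounded_linear_inner_left oN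
          N.smooth_map_subset[OF smooth_map_fibre_coord[OF c(2)]]]) auto
  have "smooth_map N (?B \<times> UNIV) (\<lambda>q. f (fst q) (inv (t (fst q)) (snd w)) +
      (\<Sum>b\<in>Basis. (t (fst q) (snd q) \<bullet> b) *\<^sub>R f (fst q) (nab (\<lambda>y. inv (t y) b) (fst q) (inv (tcoord M c (fst q)) (fst w)))))"
    by (intro N.smooth_map_add N.smooth_map_sum N.smooth_map_scaleR oN 3
        smooth_map_pullback[OF o 1] smooth_map_pullback[OF o 2])
  then show "smooth_map N (?B \<times> UNIV) (\<lambda>q. (f (fst q) o\<^sub>L Blinfun (vproj M V nab q)) (inv (tcoord N (tchart c U t) q) w))"
  proof (rule N.smooth_map_transform[OF oN])
    fix q assume "q \<in> ?B \<times> (UNIV :: 'v set)"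
    then obtain p v where pv: "q = (p, v)" "p \<in> fst c" "p \<in> U" by auto
    show "f (fst q) (inv (t (fst q)) (snd w)) +
      (\<Sum>b\<in>Basis. (t (fst q) (snd q) \<bullet> b) *\<^sub>R f (fst q) (nab (\<lambda>y. inv (t y) b) (fst q) (inv (tcoord M c (fst q)) (fst w)))) =
      (f (fst q) o\<^sub>L Blinfun (vproj M V nab q)) (inv (tcoord N (tchart c U t) q) w)"
      using vproj_inv_tcoord[OF c(1) pv(2) c(2) pv(3), of v w]
        Blinfun_linear_apply[OF linear_vproj[OF chart_in_points[OF c(1) pv(2)], of v]]
      by (simp add: pv blinfun.add_right blinfun.sum_right blinfun.scaleR_right)
  qed
qed

end

section \<open>Brackets of lifts along the zero section\<close>

context atlas begin

lemma vector_field_zero: "openin (man_topology A) U \<Longrightarrow> vector_field A U (\<lambda>_. 0)"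
  unfolding vector_field_def by (rule smooth_section_zero[OF smooth_bundle_tangent])

lemma rep_zero_derivative:
  assumes "c \<in> A" "p \<in> fst c"
  shows "frechet_derivative (local_rep c (tcoord A c) (\<lambda>_. 0)) (at (snd c p)) w = 0"
proof -
  have "frechet_derivative (local_rep c (tcoord A c) (\<lambda>_. 0)) (at (snd c p)) = frechet_derivative (\<lambda>_. 0) (at (snd c p))"
    by (rule frechet_derivative_cong_open[OF open_chart_image[OF assms(1)]])
      (use assms linear_0[OF linear_tcoord[OF assms(1)]] in \<open>auto simp: local_rep_def\<close>)
  then show ?thesis by simp
qed

lemma lie_bracket_swap: "lie_bracket A X Y p = - lie_bracket A Y X p"
  by (simp add: lie_bracket_def Let_def)

lemma lie_bracket_zero_right:
  assumes X: "vector_field A U X" and U: "openin (man_topology A) U" "p \<in> U"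
  shows "lie_bracket A X (\<lambda>_. 0) p = 0"
proof -
  have p: "p \<in> points A" using openin_subset_points U by blast
  let ?a = "chart_at A p"
  have a: "?a \<in> A" "p \<in> fst ?a" using chart_at[OF p] by auto
  have "linear (frechet_derivative (vf_rep A p X) (at (snd ?a p)))"
    using has_derivative_linear[OF rep_has_derivative[OF X a(1) U(2) a(2)]] by (simp add: vf_rep_def)
  then show ?thesis
    using rep_zero_derivative[OF a] by (simp add: lie_bracket_def Let_def vf_rep_def linear_0)
qed

lemma lie_deriv_zero_form: "lie_deriv_form A X (\<lambda>_. 0) p = 0"
proof -
  have "form_rep A p (\<lambda>_. 0) = (\<lambda>_. 0)"
    by (rule ext) (simp add: form_rep_def local_rep_def dual_triv_def)
  then show ?thesis by (simp add: lie_deriv_form_def Let_def)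
qed

lemma lie_deriv_zero_field:
  assumes \<eta>: "smooth_section A (dual_bundle (tangent_bundle A)) U \<eta>" and U: "openin (man_topology A) U" "p \<in> U"
  shows "lie_deriv_form A (\<lambda>_. 0) \<eta> p = 0"
proof (rule blinfun_eqI)
  fix w
  have p: "p \<in> points A" using openin_subset_points U by blast
  let ?a = "chart_at A p"
  have a: "?a \<in> A" "p \<in> fst ?a" using chart_at[OF p] by auto
  have "linear (frechet_derivative (local_rep ?a (dual_triv (tcoord A ?a)) \<eta>) (at (snd ?a p)))"
    using has_derivative_linear[OF form_rep_has_derivative[OF \<eta> a(1) U(2) a(2)]] .
  then show "lie_deriv_form A (\<lambda>_. 0) \<eta> p w = blinfun_apply 0 w"
    unfolding lie_deriv_form_chart[OF vector_field_zero[OF U(1)] \<eta> U(1) a U(2)]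
    using rep_zero_derivative[OF a] linear_0[OF linear_tcoord[OF a]] linear_0[OF linear_inv_bij[OF linear_tcoord[OF a] bij_tcoord[OF a]]]
    by (simp add: linear_0)
qed

end

section \<open>Coordinate derivatives of lifted fields and forms\<close>

context bundle_connection begin

text \<open>The classical form d + A of a connection in a trivialisation, which is what brackets of
  lifts produce.\<close>

lemma conn_chart:
  assumes c: "c \<in> M" "p \<in> fst c" and t: "(U, t) \<in> V" "p \<in> U" and W: "openin (man_topology M) W" "p \<in> W"
    and s: "smooth_section M V W s"
  shows "(local_rep c t s has_derivative frechet_derivative (local_rep c t s) (at (snd c p))) (at (snd c p))"
    and "t p (nab s p Y) = frechet_derivative (local_rep c t s) (at (snd c p)) (tcoord M c p Y) +
      t p (nab (\<lambda>x. inv (t x) (t p (s p))) p Y)"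
proof -
  have sm: "smooth_map M (W \<inter> U) (\<lambda>x. t x (s x))" by (rule smooth_sectionD[OF s t(1)])
  have pw: "p \<in> W \<inter> U" using W t by blast
  have o: "openin (man_topology M) (W \<inter> U)" using W triv(1)[OF t(1)] by blast
  show D: "(local_rep c t s has_derivative frechet_derivative (local_rep c t s) (at (snd c p))) (at (snd c p))"
    using smooth_map_has_derivative[OF sm pw c] by (simp add: local_rep_comp)
  let ?D = "frechet_derivative (local_rep c t s) (at (snd c p))"
  have "dfun M (\<lambda>x. t x (s x) \<bullet> b) p Y = ?D (tcoord M c p Y) \<bullet> b" for b
  proof -
    have "((\<lambda>x. t x (s x) \<bullet> b) \<circ> chart_inv c has_derivative (\<lambda>h. ?D h \<bullet> b)) (at (snd c p))"
      using has_derivative_inner_left[OF D] by (simp add: local_rep_def comp_def)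
    moreover from this have "dfun M (\<lambda>x. t x (s x) \<bullet> b) p Y =
        frechet_derivative ((\<lambda>x. t x (s x) \<bullet> b) \<circ> chart_inv c) (at (snd c p)) (tcoord M c p Y)"
      by (intro dfun_chart[OF c]) (auto simp: differentiable_def)
    ultimately show ?thesis by (simp add: frechet_derivative_eqI)
  qed
  then have "nab s p Y = (\<Sum>b\<in>Basis. (?D (tcoord M c p Y) \<bullet> b) *\<^sub>R inv (t p) b) + nab (\<lambda>x. inv (t x) (t p (s p))) p Y"
    using conn_frame[OF vbundle conn W s t, of Y] nab_frame_expand[OF t, of "t p (s p)" Y] by (simp add: sum.distrib)
  also have "(\<Sum>b\<in>Basis. (?D (tcoord M c p Y) \<bullet> b) *\<^sub>R inv (t p) b) = inv (t p) (?D (tcoord M c p Y))"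
    using frame_expansion[OF vbundle t, of "inv (t p) (?D (tcoord M c p Y))"] t by simp
  finally show "t p (nab s p Y) = ?D (tcoord M c p Y) + t p (nab (\<lambda>x. inv (t x) (t p (s p))) p Y)"
    using t by (simp add: linear_add[OF triv(2)[OF t]])
qed

lemma tchart_nhd:
  assumes c: "c \<in> M" "p \<in> fst c" and t: "(U, t) \<in> V" "p \<in> U" and W: "openin (man_topology M) W" "p \<in> W"
  shows "open (snd c ` (W \<inter> (fst c \<inter> U)) \<times> (UNIV :: 'v set))" "(snd c p, k) \<in> snd c ` (W \<inter> (fst c \<inter> U)) \<times> UNIV"
proof -
  have "open (snd c ` (W \<inter> (fst c \<inter> U)))"
    using open_image[OF openin_Int_charts[OF W(1) c(1) t(1)] c(1)] by (simp add: Int_ac)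
  then show "open (snd c ` (W \<inter> (fst c \<inter> U)) \<times> (UNIV :: 'v set))" by (rule open_Times) simp
  show "(snd c p, k) \<in> snd c ` (W \<inter> (fst c \<inter> U)) \<times> UNIV" using c t W by blast
qed

lemma has_derivative_fst_pullback:
  "(g has_derivative D) (at a) \<Longrightarrow> ((\<lambda>z. g (fst z)) has_derivative (\<lambda>z. D (fst z))) (at (a, b))"
  using has_derivative_compose[OF has_derivative_fst[OF has_derivative_ident], of g D "(a, b)" UNIV] by simp

lemma rep_vert_derivative:
  assumes c: "c \<in> M" "p \<in> fst c" and t: "(U, t) \<in> V" "p \<in> U" and W: "openin (man_topology M) W" "p \<in> W"
    and s: "smooth_section M V W s"
  shows "frechet_derivative (local_rep (tchart c U t) (tcoord N (tchart c U t)) (\<lambda>q. vert M V q (s (fst q)))) (at (snd c p, k)) =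
    (\<lambda>z. (0, frechet_derivative (local_rep c t s) (at (snd c p)) (fst z)))"
proof (rule frechet_derivative_eqI, rule has_derivative_transform_within_open[OF _ tchart_nhd[OF c t W]])
  show "((\<lambda>z. (0::'e, local_rep c t s (fst z))) has_derivative
      (\<lambda>z. (0, frechet_derivative (local_rep c t s) (at (snd c p)) (fst z)))) (at (snd c p, k))"
    by (intro has_derivative_Pair has_derivative_const has_derivative_fst_pullback conn_chart(1)[OF c t W s])
qed (use c t tcoord_tchart_fst_vert(2)[OF c(1) _ t(1)] in \<open>auto simp: local_rep_def\<close>)

lemma nab_zero_frame: "(U, t) \<in> V \<Longrightarrow> p \<in> U \<Longrightarrow> nab (\<lambda>x. inv (t x) 0) p Y = 0"
  by (subst nab_frame_expand) simp_all

text \<open>The product rule for A(X) k gives two terms. The one with the derivative of A carries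
  the factor k and vanishes here, where k = 0.\<close>

lemma rep_hlift_derivative:
  assumes c: "c \<in> M" "p \<in> fst c" and t: "(U, t) \<in> V" "p \<in> U" and W: "openin (man_topology M) W" "p \<in> W"
    and X: "vector_field M W X"
  shows "frechet_derivative (local_rep (tchart c U t) (tcoord N (tchart c U t)) (\<lambda>q. hlift M V nab q (X (fst q)))) (at (snd c p, 0)) =
    (\<lambda>z. (frechet_derivative (local_rep c (tcoord M c) X) (at (snd c p)) (fst z), - t p (nab (\<lambda>x. inv (t x) (snd z)) p (X p))))"
proof (rule frechet_derivative_eqI, rule has_derivative_transform_within_open[OF _ tchart_nhd[OF c t W]])
  let ?G = "\<lambda>b. local_rep c t (\<lambda>x. nab (\<lambda>y. inv (t y) b) x (X x))"
  have o: "openin (man_topology M) (W \<inter> U)" "p \<in> W \<inter> U" using W t triv(1)[OF t(1)] by auto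
  have X': "vector_field M (W \<inter> U) X" using X unfolding vector_field_def by (rule smooth_section_subset) blast
  note G = conn_chart(1)[OF c t o smooth_nab_frame[OF o(1) X' t(1)]]
  have 1: "((\<lambda>z. (local_rep c (tcoord M c) X (fst z), - (\<Sum>b\<in>Basis. (snd z \<bullet> b) *\<^sub>R ?G b (fst z)))) has_derivative
      (\<lambda>z. (frechet_derivative (local_rep c (tcoord M c) X) (at (snd c p)) (fst z),
        - (\<Sum>b\<in>Basis. (snd (snd c p, 0::'v) \<bullet> b) *\<^sub>R frechet_derivative (?G b) (at (snd c p)) (fst z) +
           (snd z \<bullet> b) *\<^sub>R ?G b (fst (snd c p, 0::'v)))))) (at (snd c p, 0))"
    by (intro has_derivative_Pair has_derivative_minus has_derivative_sum has_derivative_scaleR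
        has_derivative_inner_left has_derivative_snd has_derivative_ident has_derivative_fst_pullback G
        rep_has_derivative[OF X c(1) W(2) c(2)]) auto
  have 2: "t p (nab (\<lambda>x. inv (t x) k) p (X p)) = (\<Sum>b\<in>Basis. (k \<bullet> b) *\<^sub>R t p (nab (\<lambda>x. inv (t x) b) p (X p)))" for k
    by (subst nab_frame_expand[OF t]) (simp add: linear_sum[OF triv(2)[OF t]] linear_scale[OF triv(2)[OF t]])
  show "((\<lambda>z. (local_rep c (tcoord M c) X (fst z), - (\<Sum>b\<in>Basis. (snd z \<bullet> b) *\<^sub>R ?G b (fst z)))) has_derivative
      (\<lambda>z. (frechet_derivative (local_rep c (tcoord M c) X) (at (snd c p)) (fst z),
        - t p (nab (\<lambda>x. inv (t x) (snd z)) p (X p))))) (at (snd c p, 0))"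
    using 1 c by (simp add: local_rep_def 2[of "snd _"])
  fix z assume "z \<in> snd c ` (W \<inter> (fst c \<inter> U)) \<times> (UNIV :: 'v set)"
  then obtain x k where x: "z = (snd c x, k)" "x \<in> W" "x \<in> fst c" "x \<in> U" by auto
  show "(local_rep c (tcoord M c) X (fst z), - (\<Sum>b\<in>Basis. (snd z \<bullet> b) *\<^sub>R ?G b (fst z))) =
      local_rep (tchart c U t) (tcoord N (tchart c U t)) (\<lambda>q. hlift M V nab q (X (fst q))) z"
    using hlift_tchart[OF c(1) x(3) t(1) x(4), of "inv (t x) k" "X x"] nab_frame_expand[OF t(1) x(4), of k "X x"] x c t
    by (simp add: local_rep_def linear_sum[OF triv(2)[OF t(1) x(4)]] linear_scale[OF triv(2)[OF t(1) x(4)]])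
qed

lemma bounded_linear_compose_fst: "bounded_linear (\<lambda>\<zeta>::'e \<Rightarrow>\<^sub>L real. \<zeta> o\<^sub>L (fst_blinfun :: ('e \<times> 'v) \<Rightarrow>\<^sub>L 'e))"
  by (rule bounded_bilinear.bounded_linear_left[OF bounded_bilinear_blinfun_compose])

lemma rep_dproj_form_derivative:
  assumes c: "c \<in> M" "p \<in> fst c" and t: "(U, t) \<in> V" "p \<in> U" and W: "openin (man_topology M) W" "p \<in> W"
    and \<xi>: "smooth_section M (dual_bundle (tangent_bundle M)) W \<xi>"
  shows "frechet_derivative (local_rep (tchart c U t) (dual_triv (tcoord N (tchart c U t)))
      (\<lambda>q. \<xi> (fst q) o\<^sub>L Blinfun (dproj M V q))) (at (snd c p, k)) =
    (\<lambda>z. frechet_derivative (local_rep c (dual_triv (tcoord M c)) \<xi>) (at (snd c p)) (fst z) o\<^sub>L fst_blinfun)"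
proof (rule frechet_derivative_eqI, rule has_derivative_transform_within_open[OF _ tchart_nhd[OF c t W]])
  show "((\<lambda>z. local_rep c (dual_triv (tcoord M c)) \<xi> (fst z) o\<^sub>L (fst_blinfun :: ('e \<times> 'v) \<Rightarrow>\<^sub>L 'e)) has_derivative
    (\<lambda>z. frechet_derivative (local_rep c (dual_triv (tcoord M c)) \<xi>) (at (snd c p)) (fst z) o\<^sub>L fst_blinfun)) (at (snd c p, k))"
    by (intro bounded_linear.has_derivative[OF bounded_linear_compose_fst] has_derivative_fst_pullback
        form_rep_has_derivative[OF \<xi> c(1) W(2) c(2)])
  fix z assume "z \<in> snd c ` (W \<inter> (fst c \<inter> U)) \<times> (UNIV :: 'v set)"
  then obtain x k where x: "z = (snd c x, k)" "x \<in> W" "x \<in> fst c" "x \<in> U" by auto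
  note d = Blinfun_linear_apply[OF linear_dproj[OF chart_in_points[OF c(1) x(3)]]]
  show "local_rep c (dual_triv (tcoord M c)) \<xi> (fst z) o\<^sub>L fst_blinfun =
      local_rep (tchart c U t) (dual_triv (tcoord N (tchart c U t))) (\<lambda>q. \<xi> (fst q) o\<^sub>L Blinfun (dproj M V q)) z"
    by (rule blinfun_eqI)
      (use x c t in \<open>simp add: local_rep_def dual_triv_apply tcoord_tchart linear_tcoord bij_tcoord dproj_inv_tcoord d fst_blinfun.rep_eq\<close>)
qed

lemma tcoord_eqI:
  assumes "c \<in> M" "p \<in> fst c" "(U, t) \<in> V" "p \<in> U"
    and "tcoord N (tchart c U t) (p, v) w = tcoord N (tchart c U t) (p, v) w'"
  shows "w = w'"
  using injD[OF bij_is_inj[OF tcoord_tchart(2)[OF assms(1-4)]] assms(5)] .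

lemma dfun_pullback:
  assumes W: "openin (man_topology M) W" "p \<in> W" and g: "smooth_map M W g"
  shows "dfun N (\<lambda>q. g (fst q)) (p, v) w = dfun M g p (dproj M V (p, v) w)"
proof -
  have pM: "p \<in> points M" using W openin_subset_points by blast
  obtain c U t where c: "c \<in> M" "p \<in> fst c" and t: "(U, t) \<in> V" "p \<in> U" by (rule ex_tchart[OF pM])
  have D: "(((\<lambda>q. g (fst q)) \<circ> chart_inv (tchart c U t)) has_derivative
      (\<lambda>w. frechet_derivative (g \<circ> chart_inv c) (at (snd c p)) (fst w))) (at (snd c p, t p v))"
    by (rule has_derivative_transform_within_open[OF has_derivative_fst_pullback[OF smooth_map_has_derivative[OF g W(2) c]]
          tchart_nhd[OF c t W]]) (use c t in auto)
  have "dfun N (\<lambda>q. g (fst q)) (p, v) w =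
      frechet_derivative ((\<lambda>q. g (fst q)) \<circ> chart_inv (tchart c U t)) (at (snd (tchart c U t) (p, v))) (tcoord N (tchart c U t) (p, v) w)"
    by (rule N.dfun_chart[OF tchartI[OF c(1) t(1)]]) (use c t D in \<open>auto simp: differentiable_def\<close>)
  then show ?thesis
    using dfun_chart[OF c smooth_map_differentiable[OF g W(2) c]]
    by (simp add: frechet_derivative_eqI[OF D] tcoord_tchart_fst_vert(1)[OF c t])
qed

section \<open>Lie brackets and Lie derivatives at a point of the zero section\<close>

context
  fixes W p
  assumes W: "openin (man_topology M) W" "p \<in> W"
begin

lemma base_point: "p \<in> points M" using W openin_subset_points by blast

lemma total_nhd: "openin (man_topology N) (W \<times> UNIV)" "(p, v) \<in> W \<times> UNIV"
  using W openin_total_space by auto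

text \<open>In a bundle chart both fields point along the fibre and their components depend on the
  base point only, so neither changes along the other.\<close>

lemma lie_bracket_vert_vert:
  assumes s: "smooth_section M V W s" "smooth_section M V W s'"
  shows "lie_bracket N (\<lambda>q. vert M V q (s (fst q))) (\<lambda>q. vert M V q (s' (fst q))) (p, 0) = 0"
proof -
  obtain c U t where c: "c \<in> M" "p \<in> fst c" and t: "(U, t) \<in> V" "p \<in> U" by (rule ex_tchart[OF base_point])
  note lin = has_derivative_linear[OF conn_chart(1)[OF c t W]]
  show ?thesis
    by (rule tcoord_eqI[OF c t, where v = 0])
      (use N.lie_bracket_chart[OF vector_field_vert[OF W(1) s(1)] vector_field_vert[OF W(1) s(2)] total_nhd(1) tchartI[OF c(1) t(1)], of "(p, 0)"]
        c t W in \<open>simp add: rep_vert_derivative[OF c t W s(1)] rep_vert_derivative[OF c t W s(2)] tcoord_tchart_fst_vert(2)[OF c t]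
          linear_0[OF lin[OF s(1)]] linear_0[OF lin[OF s(2)]] linear_0[OF tcoord_tchart(1)[OF c t]] linear_0[OF triv(2)[OF t]]\<close>)
qed

text \<open>The vertical field along the lift contributes ds(X); the lift along the vertical field
  contributes - A(X) s and is subtracted. By \<open>conn_chart\<close> the total is the covariant
  derivative.\<close>

lemma lie_bracket_hlift_vert:
  assumes X: "vector_field M W X" and s: "smooth_section M V W s"
  shows "lie_bracket N (\<lambda>q. hlift M V nab q (X (fst q))) (\<lambda>q. vert M V q (s (fst q))) (p, 0) =
    vert M V (p, 0) (nab s p (X p))"
proof -
  obtain c U t where c: "c \<in> M" "p \<in> fst c" and t: "(U, t) \<in> V" "p \<in> U" by (rule ex_tchart[OF base_point])
  let ?X = "\<lambda>q. hlift M V nab q (X (fst q))" and ?s = "\<lambda>q. vert M V q (s (fst q))"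
  have t0: "t p 0 = 0" by (rule linear_0[OF triv(2)[OF t]])
  have "linear (frechet_derivative (local_rep c (tcoord M c) X) (at (snd c p)))"
    by (rule has_derivative_linear[OF rep_has_derivative[OF X c(1) W(2) c(2)]])
  then have D0: "frechet_derivative (local_rep c (tcoord M c) X) (at (snd c p)) 0 = 0" by (rule linear_0)
  have "tcoord N (tchart c U t) (p, 0) (lie_bracket N ?X ?s (p, 0)) = tcoord N (tchart c U t) (p, 0) (vert M V (p, 0) (nab s p (X p)))"
    using N.lie_bracket_chart[OF vector_field_hlift[OF W(1) X] vector_field_vert[OF W(1) s] total_nhd(1) tchartI[OF c(1) t(1)], of "(p, 0)"] c t W
    by (simp add: t0 rep_vert_derivative[OF c t W s] rep_hlift_derivative[OF c t W X] tcoord_tchart_fst_vert(2)[OF c t]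
        hlift_tchart[OF c t] D0 conn_chart(2)[OF c t W s])
  then show ?thesis by (rule tcoord_eqI[OF c t])
qed

text \<open>Both lifts have zero fibre component on the zero section, so no connection coefficient
  is met and the curvature, which is linear in k, does not show.\<close>

lemma lie_bracket_hlift_hlift:
  assumes X: "vector_field M W X" and Y: "vector_field M W Y"
  shows "lie_bracket N (\<lambda>q. hlift M V nab q (X (fst q))) (\<lambda>q. hlift M V nab q (Y (fst q))) (p, 0) =
    hlift M V nab (p, 0) (lie_bracket M X Y p)"
proof -
  obtain c U t where c: "c \<in> M" "p \<in> fst c" and t: "(U, t) \<in> V" "p \<in> U" by (rule ex_tchart[OF base_point])
  let ?h = "\<lambda>X q. hlift M V nab q (X (fst q))"
  have t0: "t p 0 = 0" by (rule linear_0[OF triv(2)[OF t]])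
  have "tcoord N (tchart c U t) (p, 0) (lie_bracket N (?h X) (?h Y) (p, 0)) =
      tcoord N (tchart c U t) (p, 0) (hlift M V nab (p, 0) (lie_bracket M X Y p))"
    using N.lie_bracket_chart[OF vector_field_hlift[OF W(1) X] vector_field_hlift[OF W(1) Y] total_nhd(1) tchartI[OF c(1) t(1)], of "(p, 0)"] c t W
    by (simp add: t0 rep_hlift_derivative[OF c t W X] rep_hlift_derivative[OF c t W Y] hlift_tchart[OF c t]
        nab_zero_frame[OF t] lie_bracket_chart[OF X Y W(1) c W(2)])
  then show ?thesis by (rule tcoord_eqI[OF c t])
qed

text \<open>The lift projects to X and the form is pulled back along the projection, so the Lie
  derivative is the pullback of the one on the base.\<close>

lemma lie_deriv_hlift_dproj:
  assumes X: "vector_field M W X" and \<eta>: "smooth_section M (dual_bundle (tangent_bundle M)) W \<eta>"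
  shows "lie_deriv_form N (\<lambda>q. hlift M V nab q (X (fst q))) (\<lambda>q. \<eta> (fst q) o\<^sub>L Blinfun (dproj M V q)) (p, 0) =
    lie_deriv_form M X \<eta> p o\<^sub>L Blinfun (dproj M V (p, 0))"
proof (rule blinfun_eqI)
  fix w
  obtain c U t where c: "c \<in> M" "p \<in> fst c" and t: "(U, t) \<in> V" "p \<in> U" by (rule ex_tchart[OF base_point])
  have t0: "t p 0 = 0" by (rule linear_0[OF triv(2)[OF t]])
  note d = Blinfun_linear_apply[OF linear_dproj[OF base_point]]
  show "lie_deriv_form N (\<lambda>q. hlift M V nab q (X (fst q))) (\<lambda>q. \<eta> (fst q) o\<^sub>L Blinfun (dproj M V q)) (p, 0) w =
    (lie_deriv_form M X \<eta> p o\<^sub>L Blinfun (dproj M V (p, 0))) w"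
    using N.lie_deriv_form_chart[OF vector_field_hlift[OF W(1) X] smooth_dproj_form[OF W(1) \<eta>] total_nhd(1) tchartI[OF c(1) t(1)], of "(p, 0)" w] c t W
    by (simp add: t0 rep_hlift_derivative[OF c t W X] rep_dproj_form_derivative[OF c t W \<eta>] hlift_tchart[OF c t] d
        dproj_inv_tcoord[OF c t] fst_blinfun.rep_eq lie_deriv_form_chart[OF X \<eta> W(1) c W(2)] tcoord_tchart_fst_vert(1)[OF c t])
qed

text \<open>A vertical field projects to 0, and a form pulled back from the base does not change
  along it.\<close>

lemma lie_deriv_vert_dproj:
  assumes s: "smooth_section M V W s" and \<eta>: "smooth_section M (dual_bundle (tangent_bundle M)) W \<eta>"
  shows "lie_deriv_form N (\<lambda>q. vert M V q (s (fst q))) (\<lambda>q. \<eta> (fst q) o\<^sub>L Blinfun (dproj M V q)) (p, 0) = 0"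
proof (rule blinfun_eqI)
  fix w
  obtain c U t where c: "c \<in> M" "p \<in> fst c" and t: "(U, t) \<in> V" "p \<in> U" by (rule ex_tchart[OF base_point])
  have t0: "t p 0 = 0" by (rule linear_0[OF triv(2)[OF t]])
  note d = Blinfun_linear_apply[OF linear_dproj[OF base_point]]
  have "linear (frechet_derivative (local_rep c (dual_triv (tcoord M c)) \<eta>) (at (snd c p)))"
    by (rule has_derivative_linear[OF form_rep_has_derivative[OF \<eta> c(1) W(2) c(2)]])
  then have D0: "frechet_derivative (local_rep c (dual_triv (tcoord M c)) \<eta>) (at (snd c p)) 0 = 0" by (rule linear_0)
  note i0 = linear_0[OF linear_inv_bij[OF linear_tcoord[OF c] bij_tcoord[OF c]]]
  show "lie_deriv_form N (\<lambda>q. vert M V q (s (fst q))) (\<lambda>q. \<eta> (fst q) o\<^sub>L Blinfun (dproj M V q)) (p, 0) w = blinfun_apply 0 w"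
    using N.lie_deriv_form_chart[OF vector_field_vert[OF W(1) s] smooth_dproj_form[OF W(1) \<eta>] total_nhd(1) tchartI[OF c(1) t(1)], of "(p, 0)" w] c t W
    by (simp add: t0 rep_vert_derivative[OF c t W s] rep_dproj_form_derivative[OF c t W \<eta>] tcoord_tchart_fst_vert(2)[OF c t] d
        dproj_inv_tcoord[OF c t] fst_blinfun.rep_eq D0 i0)
qed

text \<open>On a vector with base part w and fibre part m, both in coordinates, the form has value
  f(m) + f(A(w) k). Its derivative along the lift gives d(f(e)) for the frame section e, and the
  derivative of the lift gives - f(A(X) e); together they define the dual connection.\<close>

lemma lie_deriv_hlift_vproj:
  assumes X: "vector_field M W X" and f: "smooth_section M (dual_bundle V) W f"
  shows "lie_deriv_form N (\<lambda>q. hlift M V nab q (X (fst q))) (\<lambda>q. f (fst q) o\<^sub>L Blinfun (vproj M V nab q)) (p, 0) =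
    dual_conn M V nab f p (X p) o\<^sub>L Blinfun (vproj M V nab (p, 0))"
proof (rule blinfun_eqI)
  fix w
  obtain c U t where c: "c \<in> M" "p \<in> fst c" and t: "(U, t) \<in> V" "p \<in> U" by (rule ex_tchart[OF base_point])
  let ?C = "tchart c U t" and ?f = "\<lambda>q. f (fst q) o\<^sub>L Blinfun (vproj M V nab q)"
  let ?R = "local_rep ?C (dual_triv (tcoord N ?C)) ?f"
  have t0: "t p 0 = 0" by (rule linear_0[OF triv(2)[OF t]])
  let ?B = "W \<inter> (fst c \<inter> U)"
  have B: "openin (man_topology M) ?B" "p \<in> ?B" using openin_Int_charts[OF W(1) c(1) t(1)] W c t by auto
  have fB: "smooth_section M (dual_bundle V) ?B f" by (rule smooth_section_subset[OF f]) blast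
  have e: "smooth_section M V ?B (\<lambda>x. inv (t x) k)" for k
    by (rule smooth_section_subset[OF frame_section[OF t(1)]]) blast
  note Rd = N.form_rep_has_derivative[OF smooth_vproj_form[OF W(1) f] tchartI[OF c(1) t(1)] total_nhd(2), of 0]
  \<comment> \<open>Along the direction with zero fibre part, at k = 0, both product-rule terms of
    the A-summand vanish and only the derivative of f on the frame section of the fibre part of y is
    left.\<close>
  have main: "frechet_derivative ?R (at (snd c p, 0)) (tcoord M c p (X p), 0) y = dfun M (\<lambda>x. f x (inv (t x) (snd y))) p (X p)" for y
  proof -
    let ?F = "\<lambda>x. f x (inv (t x) (snd y))"
    let ?Y = "\<lambda>x. inv (tcoord M c x) (fst y)"
    let ?G = "\<lambda>b x. f x (nab (\<lambda>z. inv (t z) b) x (?Y x))"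
    have Y: "vector_field M ?B ?Y" unfolding vector_field_def
      by (rule smooth_section_subset[OF smooth_bundle_triv(4)[OF smooth_bundle_tangent tangent_bundleI[OF c(1)]]]) blast
    have F: "smooth_map M ?B ?F" by (rule smooth_section_dual_apply[OF vbundle B(1) fB e])
    have G: "smooth_map M ?B (?G b)" for b
      by (rule smooth_section_dual_apply[OF vbundle B(1) fB smooth_nab_frame[OF B(1) Y t(1)]]) blast
    let ?dF = "frechet_derivative (?F \<circ> chart_inv c) (at (snd c p))"
    have "((\<lambda>z. (?F \<circ> chart_inv c) (fst z) + (\<Sum>b\<in>Basis. (snd z \<bullet> b) *\<^sub>R (?G b \<circ> chart_inv c) (fst z))) has_derivative
      (\<lambda>z. ?dF (fst z) + (\<Sum>b\<in>Basis. (snd (snd c p, 0::'v) \<bullet> b) *\<^sub>R frechet_derivative (?G b \<circ> chart_inv c) (at (snd c p)) (fst z) +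
           (snd z \<bullet> b) *\<^sub>R (?G b \<circ> chart_inv c) (fst (snd c p, 0::'v))))) (at (snd c p, 0))"
      by (intro has_derivative_add has_derivative_sum has_derivative_scaleR has_derivative_inner_left has_derivative_snd
          has_derivative_ident has_derivative_fst_pullback smooth_map_has_derivative[OF F B(2) c] smooth_map_has_derivative[OF G B(2) c])
    then have "((\<lambda>z. ?R z y) has_derivative
      (\<lambda>z. ?dF (fst z) + (\<Sum>b\<in>Basis. (snd (snd c p, 0::'v) \<bullet> b) *\<^sub>R frechet_derivative (?G b \<circ> chart_inv c) (at (snd c p)) (fst z) +
           (snd z \<bullet> b) *\<^sub>R (?G b \<circ> chart_inv c) (fst (snd c p, 0::'v))))) (at (snd c p, 0))"
    proof (rule has_derivative_transform_within_open[OF _ tchart_nhd[OF c t W]])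
      fix z assume "z \<in> snd c ` (W \<inter> (fst c \<inter> U)) \<times> (UNIV :: 'v set)"
      then obtain x k where x: "z = (snd c x, k)" "x \<in> W" "x \<in> fst c" "x \<in> U" by auto
      note d = Blinfun_linear_apply[OF linear_vproj[OF chart_in_points[OF c(1) x(3)]]]
      show "(?F \<circ> chart_inv c) (fst z) + (\<Sum>b\<in>Basis. (snd z \<bullet> b) *\<^sub>R (?G b \<circ> chart_inv c) (fst z)) = ?R z y"
        using x c t by (simp add: local_rep_def dual_triv_apply tcoord_tchart vproj_inv_tcoord d
            blinfun.add_right blinfun.sum_right blinfun.scaleR_right)
    qed
    moreover have "((\<lambda>z. ?R z y) has_derivative (\<lambda>z. frechet_derivative ?R (at (snd c p, 0)) z y)) (at (snd c p, 0))"
      using bounded_linear.has_derivative[OF blinfun.bounded_linear_left Rd, of y] c t t0 by simp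
    ultimately have "(\<lambda>z. ?dF (fst z) + (\<Sum>b\<in>Basis. (snd (snd c p, 0::'v) \<bullet> b) *\<^sub>R frechet_derivative (?G b \<circ> chart_inv c) (at (snd c p)) (fst z) +
           (snd z \<bullet> b) *\<^sub>R (?G b \<circ> chart_inv c) (fst (snd c p, 0::'v)))) = (\<lambda>z. frechet_derivative ?R (at (snd c p, 0)) z y)"
      by (rule has_derivative_unique)
    from fun_cong[OF this, of "(tcoord M c p (X p), 0)"]
    have "frechet_derivative ?R (at (snd c p, 0)) (tcoord M c p (X p), 0) y = ?dF (tcoord M c p (X p))" by simp
    then show ?thesis using dfun_chart[OF c smooth_map_differentiable[OF F B(2) c]] by simp
  qed
  note d = Blinfun_linear_apply[OF linear_vproj[OF base_point]]
  let ?y = "tcoord N ?C (p, 0) w"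
  have neg: "inv (t p) (- t p n) = - n" for n
    using linear_neg[OF linear_triv_inv[OF t], of "t p n"] t by simp
  have vw: "vproj M V nab (p, 0) w = inv (t p) (snd ?y)"
    by (simp add: vproj_tchart[OF c t] t0 nab_zero_frame[OF t])
  have "lie_deriv_form N (\<lambda>q. hlift M V nab q (X (fst q))) ?f (p, 0) w =
      dfun M (\<lambda>x. f x (inv (t x) (snd ?y))) p (X p) - f p (nab (\<lambda>x. inv (t x) (snd ?y)) p (X p))"
    using N.lie_deriv_form_chart[OF vector_field_hlift[OF W(1) X] smooth_vproj_form[OF W(1) f] total_nhd(1) tchartI[OF c(1) t(1)], of "(p, 0)" w] c t W
    by (simp add: t0 hlift_tchart[OF c t] nab_zero_frame[OF t] main rep_hlift_derivative[OF c t W X] d vproj_inv_tcoord[OF c t]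
        neg blinfun.minus_right)
  also have "\<dots> = dual_conn M V nab f p (X p) (inv (t p) (snd ?y))"
    using dual_conn_apply[OF vbundle conn B e fB, of "X p" "snd ?y"] by simp
  finally show "lie_deriv_form N (\<lambda>q. hlift M V nab q (X (fst q))) ?f (p, 0) w =
      (dual_conn M V nab f p (X p) o\<^sub>L Blinfun (vproj M V nab (p, 0))) w"
    by (simp add: d vw)
qed

end

end

section \<open>Courant brackets of lifts\<close>

context bundle_connection begin

text \<open>\<open>hor\<close>, \<open>ver\<close> and \<open>ver_dual\<close> are explicit forms of
  the lift of sections of $T_M\<oplus>T_M^\<or>$, of V and of its dual; \<open>hor_eq_Finv\<close>
  and its companions relate them to \<open>Finv\<close>.\<close>

definition hor :: "('m \<Rightarrow> 'e \<times> ('e \<Rightarrow>\<^sub>L real)) \<Rightarrow> 'm \<times> 'v \<Rightarrow> ('e \<times> 'v) \<times> (('e \<times> 'v) \<Rightarrow>\<^sub>L real)" where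
  "hor a q = (hlift M V nab q (fst (a (fst q))), snd (a (fst q)) o\<^sub>L Blinfun (dproj M V q))"

definition ver :: "('m \<Rightarrow> 'v) \<Rightarrow> 'm \<times> 'v \<Rightarrow> ('e \<times> 'v) \<times> (('e \<times> 'v) \<Rightarrow>\<^sub>L real)" where
  "ver s q = (vert M V q (s (fst q)), 0)"

definition ver_dual :: "('m \<Rightarrow> 'v \<Rightarrow>\<^sub>L real) \<Rightarrow> 'm \<times> 'v \<Rightarrow> ('e \<times> 'v) \<times> (('e \<times> 'v) \<Rightarrow>\<^sub>L real)" where
  "ver_dual f q = (0, f (fst q) o\<^sub>L Blinfun (vproj M V nab q))"

lemma linear_split_pair:
  assumes "p \<in> points M" shows "linear (\<lambda>w. (vproj M V nab (p, v) w, dproj M V (p, v) w))"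
  by (rule linearI) (simp_all add: linear_add[OF linear_dproj[OF assms]] linear_add[OF linear_vproj[OF assms]]
      linear_scale[OF linear_dproj[OF assms]] linear_scale[OF linear_vproj[OF assms]])

lemma hor_eq_Finv: "p \<in> points M \<Longrightarrow> hor a (p, v) = Finv (p, v) (incl_T (a p))"
  by (cases "a p") (auto intro!: blinfun_eqI simp: hor_def Finv_def incl_T_def linear_0[OF linear_vert]
      Blinfun_linear_apply[OF linear_split_pair] Blinfun_linear_apply[OF linear_dproj] snd_blinfun.rep_eq)

lemma ver_eq_Finv: "p \<in> points M \<Longrightarrow> ver s (p, v) = Finv (p, v) (incl_V (s p))"
  by (simp add: ver_def Finv_def incl_V_def linear_0[OF linear_hlift])

lemma ver_dual_eq_Finv: "p \<in> points M \<Longrightarrow> ver_dual f (p, v) = Finv (p, v) (incl_Vdual (f p))"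
  by (auto intro!: blinfun_eqI simp: ver_dual_def Finv_def incl_Vdual_def linear_0[OF linear_vert] linear_0[OF linear_hlift]
      Blinfun_linear_apply[OF linear_split_pair] Blinfun_linear_apply[OF linear_vproj] fst_blinfun.rep_eq)

lemma Finv_add: "p \<in> points M \<Longrightarrow> Finv (p, v) (y + y') = Finv (p, v) y + Finv (p, v) y'"
  by (cases y; cases y') (auto intro!: blinfun_eqI simp: Finv_def linear_add[OF linear_vert] linear_add[OF linear_hlift]
      blinfun.add_left)

lemma Finv_minus: "p \<in> points M \<Longrightarrow> Finv (p, v) (- y) = - Finv (p, v) y"
  by (cases y) (auto intro!: blinfun_eqI simp: Finv_def linear_neg[OF linear_vert] linear_neg[OF linear_hlift]
      blinfun.minus_left)

lemma Finv_inj: "p \<in> points M \<Longrightarrow> Finv (p, v) y = Finv (p, v) y' \<Longrightarrow> y = y'"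
  using Fmap_inverse[of p v] by (metis bij_inv_simps(1))

lemmas gen_bundle_M = smooth_bundle_sum[OF smooth_bundle_tangent smooth_bundle_cotangent]
lemmas gen_bundle_N = N.smooth_bundle_sum[OF N.smooth_bundle_tangent N.smooth_bundle_cotangent]

lemma gen_section_iff:
  assumes "openin (man_topology M) W"
  shows "smooth_section M (gen_bundle (tangent_bundle M)) W a \<longleftrightarrow>
    vector_field M W (\<lambda>x. fst (a x)) \<and> smooth_section M (dual_bundle (tangent_bundle M)) W (\<lambda>x. snd (a x))"
  unfolding vector_field_def by (rule smooth_section_sum_bundle_iff[OF smooth_bundle_tangent smooth_bundle_cotangent assms])

lemma gen_section_N_iff:
  assumes "openin (man_topology N) W"
  shows "smooth_section N (gen_bundle (tangent_bundle N)) W a \<longleftrightarrow>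
    vector_field N W (\<lambda>x. fst (a x)) \<and> smooth_section N (dual_bundle (tangent_bundle N)) W (\<lambda>x. snd (a x))"
  unfolding vector_field_def by (rule N.smooth_section_sum_bundle_iff[OF N.smooth_bundle_tangent N.smooth_bundle_cotangent assms])

section \<open>Courant brackets at a point of the zero section\<close>

context
  fixes W p
  assumes W: "openin (man_topology M) W" "p \<in> W"
begin

lemma smooth_hor:
  "smooth_section M (gen_bundle (tangent_bundle M)) W a \<Longrightarrow> smooth_section N (gen_bundle (tangent_bundle N)) (W \<times> UNIV) (hor a)"
  unfolding gen_section_iff[OF W(1)] gen_section_N_iff[OF total_nhd(1)[OF W]]
  using vector_field_hlift[OF W(1), of "\<lambda>x. fst (a x)"] smooth_dproj_form[OF W(1), of "\<lambda>x. snd (a x)"]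
  by (simp add: hor_def)

lemma smooth_ver:
  "smooth_section M V W s \<Longrightarrow> smooth_section N (gen_bundle (tangent_bundle N)) (W \<times> UNIV) (ver s)"
  unfolding gen_section_N_iff[OF total_nhd(1)[OF W]]
  using vector_field_vert[OF W(1)] N.smooth_section_zero[OF N.smooth_bundle_cotangent total_nhd(1)[OF W]] by (simp add: ver_def)

lemma smooth_ver_dual:
  "smooth_section M (dual_bundle V) W f \<Longrightarrow> smooth_section N (gen_bundle (tangent_bundle N)) (W \<times> UNIV) (ver_dual f)"
  unfolding gen_section_N_iff[OF total_nhd(1)[OF W]]
  using N.vector_field_zero[OF total_nhd(1)[OF W]] smooth_vproj_form[OF W(1)] by (simp add: ver_dual_def)

lemma dfun_N_zero:
  assumes "\<And>x v. x \<in> W \<Longrightarrow> f (x, v) = 0"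
  shows "dfun N f (p, v) = 0"
proof -
  have "dfun N f (p, v) = dfun N (\<lambda>_. 0) (p, v)"
    by (rule N.dfun_cong[OF total_nhd[OF W]]) (use assms in auto)
  then show ?thesis by (intro blinfun_eqI) (simp add: N.dfun_const)
qed

private lemma dproj_simps:
  assumes "x \<in> W"
  shows "blinfun_apply (Blinfun (dproj M V (x, v))) = dproj M V (x, v)"
    "blinfun_apply (Blinfun (vproj M V nab (x, v))) = vproj M V nab (x, v)"
    "dproj M V (x, v) (vert M V (x, v) k) = 0" "dproj M V (x, v) (hlift M V nab (x, v) Y) = Y"
    "vproj M V nab (x, v) (hlift M V nab (x, v) Y) = 0"
proof -
  have x: "x \<in> points M" using assms W openin_subset_points by blast
  show "blinfun_apply (Blinfun (dproj M V (x, v))) = dproj M V (x, v)"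
    "blinfun_apply (Blinfun (vproj M V nab (x, v))) = vproj M V nab (x, v)"
    "dproj M V (x, v) (vert M V (x, v) k) = 0" "dproj M V (x, v) (hlift M V nab (x, v) Y) = Y"
    "vproj M V nab (x, v) (hlift M V nab (x, v) Y) = 0"
    by (simp_all add: Blinfun_linear_apply linear_dproj[OF x] linear_vproj[OF x] dproj_vert[OF x] dproj_hlift[OF x] vproj_hlift[OF x])
qed

lemma courant_hor_hor:
  assumes a: "smooth_section M (gen_bundle (tangent_bundle M)) W a" and b: "smooth_section M (gen_bundle (tangent_bundle M)) W b"
  shows "courant N (hor a) (hor b) (p, 0) = hor (\<lambda>_. courant M a b p) (p, 0)"
proof -
  note a' = a[unfolded gen_section_iff[OF W(1)]] and b' = b[unfolded gen_section_iff[OF W(1)]]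
  let ?g = "\<lambda>x. snd (a x) (fst (b x)) - snd (b x) (fst (a x))"
  note ap = smooth_section_dual_apply[OF smooth_bundle_tangent W(1)]
  have g: "smooth_map M W ?g"
    using ap[of "\<lambda>x. snd (a x)" "\<lambda>x. fst (b x)"] ap[of "\<lambda>x. snd (b x)" "\<lambda>x. fst (a x)"] a' b'
    by (intro smooth_map_diff W) (auto simp: vector_field_def)
  let ?h = "\<lambda>q. snd (hor a q) (fst (hor b q)) - snd (hor b q) (fst (hor a q))"
  \<comment> \<open>\<open>dproj\<close> undoes \<open>hlift\<close>, so contracting lifts gives the
    pullback of the contraction on the base.\<close>
  have "dfun N ?h (p, 0) = dfun N (\<lambda>q. ?g (fst q)) (p, 0)"
    by (rule N.dfun_cong[OF total_nhd[OF W]]) (auto simp: hor_def dproj_simps)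
  then have h: "dfun N ?h (p, 0) = dfun M ?g p o\<^sub>L Blinfun (dproj M V (p, 0))"
    by (intro blinfun_eqI) (simp add: dfun_pullback[OF W g] dproj_simps[OF W(2)])
  have "courant N (hor a) (hor b) (p, 0) = (hlift M V nab (p, 0) (fst (courant M a b p)),
      snd (courant M a b p) o\<^sub>L Blinfun (dproj M V (p, 0)))"
    unfolding courant_def Let_def h
    using lie_bracket_hlift_hlift[OF W, of "\<lambda>x. fst (a x)" "\<lambda>x. fst (b x)"]
      lie_deriv_hlift_dproj[OF W, of "\<lambda>x. fst (a x)" "\<lambda>x. snd (b x)"]
      lie_deriv_hlift_dproj[OF W, of "\<lambda>x. fst (b x)" "\<lambda>x. snd (a x)"] a' b'
    by (auto intro!: blinfun_eqI simp: hor_def dproj_simps[OF W(2)] blinfun.add_left blinfun.diff_left blinfun.scaleR_left)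
  then show ?thesis by (simp add: hor_def)
qed

text \<open>Pulled-back forms vanish on vertical vectors and are constant along vertical fields, so
  the covector part is 0 and only the Lie bracket of a lift with a vertical field remains.\<close>

lemma courant_hor_ver:
  assumes a: "smooth_section M (gen_bundle (tangent_bundle M)) W a" and s: "smooth_section M V W s"
  shows "courant N (hor a) (ver s) (p, 0) = ver (\<lambda>_. nab s p (fst (a p))) (p, 0)"
    and "courant N (ver s) (hor a) (p, 0) = ver (\<lambda>_. - nab s p (fst (a p))) (p, 0)"
proof -
  note a' = a[unfolded gen_section_iff[OF W(1)]]
  have z: "dfun N (\<lambda>q. snd (a (fst q)) (Blinfun (dproj M V q) (vert M V q (s (fst q))))) (p, 0) = 0"
    "dfun N (\<lambda>q. - snd (a (fst q)) (Blinfun (dproj M V q) (vert M V q (s (fst q))))) (p, 0) = 0"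
    by (rule dfun_N_zero; simp add: dproj_simps)+
  note l = lie_bracket_hlift_vert[OF W, of "\<lambda>x. fst (a x)" s] lie_deriv_vert_dproj[OF W s, of "\<lambda>x. snd (a x)"]
  show "courant N (hor a) (ver s) (p, 0) = ver (\<lambda>_. nab s p (fst (a p))) (p, 0)"
    using l a' s by (simp add: courant_def Let_def hor_def ver_def z N.lie_deriv_zero_form)
  show "courant N (ver s) (hor a) (p, 0) = ver (\<lambda>_. - nab s p (fst (a p))) (p, 0)"
    using l a' s N.lie_bracket_swap[of "\<lambda>q. vert M V q (s (fst q))" "\<lambda>q. hlift M V nab q (fst (a (fst q)))"]
    by (simp add: courant_def Let_def hor_def ver_def z N.lie_deriv_zero_form linear_neg[OF linear_vert[OF base_point[OF W]]])
qed

lemma courant_ver_ver: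
  assumes "smooth_section M V W s" "smooth_section M V W s'"
  shows "courant N (ver s) (ver s') (p, 0) = 0"
  using lie_bracket_vert_vert[OF W assms] dfun_N_zero[of "\<lambda>_. 0"]
  by (simp add: courant_def Let_def ver_def N.lie_deriv_zero_form zero_prod_def)

text \<open>Here the vector part vanishes, as the second section has none. D kills lifts, so the
  exact term vanishes too, and the Lie derivative along the lift is all that is left.\<close>

lemma courant_hor_ver_dual:
  assumes a: "smooth_section M (gen_bundle (tangent_bundle M)) W a" and f: "smooth_section M (dual_bundle V) W f"
  shows "courant N (hor a) (ver_dual f) (p, 0) = ver_dual (\<lambda>_. dual_conn M V nab f p (fst (a p))) (p, 0)"
    and "courant N (ver_dual f) (hor a) (p, 0) = ver_dual (\<lambda>_. - dual_conn M V nab f p (fst (a p))) (p, 0)"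
proof -
  note a' = a[unfolded gen_section_iff[OF W(1)]]
  let ?X = "\<lambda>q. hlift M V nab q (fst (a (fst q)))" and ?f = "\<lambda>q. f (fst q) o\<^sub>L Blinfun (vproj M V nab q)"
    and ?\<xi> = "\<lambda>q. snd (a (fst q)) o\<^sub>L Blinfun (dproj M V q)"
  have z: "dfun N (\<lambda>q. ?\<xi> q 0 - ?f q (?X q)) (p, 0) = 0" "dfun N (\<lambda>q. ?f q (?X q) - ?\<xi> q 0) (p, 0) = 0"
    by (rule dfun_N_zero; simp add: dproj_simps)+
  have X: "vector_field N (W \<times> UNIV) ?X" and \<xi>: "smooth_section N (dual_bundle (tangent_bundle N)) (W \<times> UNIV) ?\<xi>"
    using a' vector_field_hlift[OF W(1)] smooth_dproj_form[OF W(1)] by auto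
  have l: "lie_bracket N ?X (\<lambda>_. 0) (p, 0) = 0" "lie_bracket N (\<lambda>_. 0) ?X (p, 0) = 0"
    "lie_deriv_form N (\<lambda>_. 0) ?\<xi> (p, 0) = 0"
    "lie_deriv_form N ?X ?f (p, 0) = dual_conn M V nab f p (fst (a p)) o\<^sub>L Blinfun (vproj M V nab (p, 0))"
    using N.lie_bracket_zero_right[OF X total_nhd[OF W]] N.lie_bracket_swap[of "\<lambda>_. 0" ?X "(p, 0)"] N.lie_deriv_zero_field[OF \<xi> total_nhd[OF W]]
      lie_deriv_hlift_vproj[OF W _ f, of "\<lambda>x. fst (a x)"] a' by auto
  show "courant N (hor a) (ver_dual f) (p, 0) = ver_dual (\<lambda>_. dual_conn M V nab f p (fst (a p))) (p, 0)"
    unfolding courant_def Let_def hor_def ver_dual_def fst_conv snd_conv l z by simp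
  show "courant N (ver_dual f) (hor a) (p, 0) = ver_dual (\<lambda>_. - dual_conn M V nab f p (fst (a p))) (p, 0)"
    unfolding courant_def Let_def hor_def ver_dual_def fst_conv snd_conv l z
    by (auto intro!: blinfun_eqI simp: blinfun.minus_left)
qed

lemma courant_ver_dual_ver_dual:
  assumes "smooth_section M (dual_bundle V) W f" "smooth_section M (dual_bundle V) W f'"
  shows "courant N (ver_dual f) (ver_dual f') (p, 0) = 0"
  unfolding courant_def Let_def ver_dual_def fst_conv snd_conv
  using N.lie_bracket_zero_right[OF N.vector_field_zero[OF total_nhd(1)[OF W]] total_nhd[OF W]] dfun_N_zero[of "\<lambda>_. 0"]
    N.lie_deriv_zero_field[OF smooth_vproj_form[OF W(1) assms(1)] total_nhd[OF W]]
    N.lie_deriv_zero_field[OF smooth_vproj_form[OF W(1) assms(2)] total_nhd[OF W]]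
  by (simp add: prod_eq_iff)

end

end

section \<open>Semi-flat generalized complex structures\<close>

lemma incl_T_inj:
  fixes a b :: "'e::real_normed_vector \<times> ('e \<Rightarrow>\<^sub>L real)"
  assumes eq: "(incl_T a :: ('v::real_normed_vector \<times> 'e) \<times> (('v \<times> 'e) \<Rightarrow>\<^sub>L real)) = incl_T b"
  shows "a = b"
proof (rule prod_eqI)
  show "fst a = fst b" using eq by (simp add: incl_T_def case_prod_beta)
  have "snd a o\<^sub>L (snd_blinfun :: ('v \<times> 'e) \<Rightarrow>\<^sub>L 'e) = snd b o\<^sub>L snd_blinfun"
    using eq by (simp add: incl_T_def case_prod_beta)
  then have "(snd a o\<^sub>L (snd_blinfun :: ('v \<times> 'e) \<Rightarrow>\<^sub>L 'e)) (0, x) =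
      (snd b o\<^sub>L (snd_blinfun :: ('v \<times> 'e) \<Rightarrow>\<^sub>L 'e)) (0, x)" for x
    by simp
  then show "snd a = snd b" by (intro blinfun_eqI) (simp add: snd_blinfun.rep_eq)
qed

lemma pairing_incl_T: "pairing (incl_T a) (incl_T b) = pairing a b"
  by (simp add: pairing_def incl_T_def case_prod_beta snd_blinfun.rep_eq)

lemma linear_incl_T: "linear incl_T"
  by (rule linearI) (auto intro!: blinfun_eqI simp: incl_T_def case_prod_beta blinfun.add_left blinfun.scaleR_left)

text \<open>A left inverse of \<open>incl_T\<close> that is linear on the whole space. It replaces
  \<open>inv incl_T\<close>, which is controlled on the range only, when linearity and smoothness
  are at stake.\<close>

definition proj_T ::
  "('v::real_normed_vector \<times> 'e::real_normed_vector) \<times> (('v \<times> 'e) \<Rightarrow>\<^sub>L real) \<Rightarrow> 'e \<times> ('e \<Rightarrow>\<^sub>L real)" where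
  "proj_T y = (snd (fst y), snd y o\<^sub>L Blinfun (Pair 0))"

lemma bounded_linear_Pair_0: "bounded_linear (Pair 0)" "bounded_linear (\<lambda>x. (x, 0))"
  by (intro bounded_linear_Pair bounded_linear_zero bounded_linear_ident)+

lemma proj_T_incl_T: "proj_T (incl_T a) = a"
  by (auto intro!: blinfun_eqI simp: prod_eq_iff proj_T_def incl_T_def case_prod_beta snd_blinfun.rep_eq
      bounded_linear_Blinfun_apply[OF bounded_linear_Pair_0(1)])

lemma inv_incl_T:
  fixes y :: "('a::real_normed_vector \<times> 'b::real_normed_vector) \<times> (('a \<times> 'b) \<Rightarrow>\<^sub>L real)"
  shows "y \<in> range incl_T \<Longrightarrow> inv incl_T y = proj_T y"
proof -
  assume "y \<in> range incl_T"
  then obtain a where a: "y = incl_T a" by blast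
  have "inj (incl_T :: 'b \<times> ('b \<Rightarrow>\<^sub>L real) \<Rightarrow> ('a \<times> 'b) \<times> (('a \<times> 'b) \<Rightarrow>\<^sub>L real))"
    by (rule injI) (rule incl_T_inj)
  then show ?thesis by (simp add: a proj_T_incl_T)
qed

lemma linear_proj_T: "linear proj_T"
  by (rule linearI) (auto intro!: blinfun_eqI simp: proj_T_def blinfun.add_left blinfun.scaleR_left)

locale semi_flat = bundle_connection M V nab
  for M :: "('m, 'e::euclidean_space) chart set" and V :: "('m, 'v::euclidean_space) triv set" and nab +
  fixes J \<J>
  assumes semi_flat: "semi_flat_gc M V nab J \<J>"
begin

abbreviation "TM \<equiv> tangent_bundle M"
abbreviation "G \<equiv> gen_bundle (sum_bundle V TM)"

lemmas VT = smooth_bundle_sum[OF vbundle smooth_bundle_tangent]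

lemma G_bundle: "smooth_bundle M G"
  by (rule smooth_bundle_sum[OF VT smooth_bundle_dual[OF VT]])

lemma J_hom: "smooth_hom M G G J"
  using semi_flat unfolding semi_flat_gc_def semi_flat_gac_def gen_almost_complex_def by blast

lemma linear_J: "p \<in> points M \<Longrightarrow> linear (J p)"
  using J_hom unfolding smooth_hom_def by blast

lemma J_pairing: "p \<in> points M \<Longrightarrow> pairing (J p y) (J p y') = pairing y y'"
  and J_J: "p \<in> points M \<Longrightarrow> J p (J p y) = - y"
  using semi_flat unfolding semi_flat_gc_def semi_flat_gac_def gen_almost_complex_def by blast+

lemma J_inj: "p \<in> points M \<Longrightarrow> J p y = J p y' \<Longrightarrow> y = y'"
  by (metis J_J neg_equal_iff_equal)

lemma J_adapted: "p \<in> points M \<Longrightarrow> J p ` {incl_V v + incl_Vdual f |v f. True} = range incl_T"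
  using semi_flat unfolding semi_flat_gc_def semi_flat_gac_def adapted_def by blast

lemma total_J: "p \<in> points M \<Longrightarrow> \<J> (p, v) (Finv (p, v) y) = Finv (p, v) (J p y)"
proof -
  assume p: "p \<in> points M"
  then have "\<J> (p, v) = inv (Fmap M V nab (p, v)) \<circ> J p \<circ> Fmap M V nab (p, v)"
    using semi_flat unfolding semi_flat_gc_def semi_flat_gac_def by (simp add: points_total_space)
  then show ?thesis
    using Fmap_inverse[OF p, of v] bij_inv_simps(1)[OF Fmap_inverse(1)[OF p, of v], of y] by simp
qed

text \<open>The only use of integrability. The sections u and u' stand for lifted sections of V or
  of its dual, with n and n' describing the mixed brackets, so that both halves of the theorem can
  share the argument.\<close>

lemma bracket_relation:
  assumes W: "openin (man_topology M) W" "p \<in> W"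
    and a: "smooth_section M (gen_bundle TM) W a" and b: "smooth_section M (gen_bundle TM) W b"
    and L: "smooth_section N (gen_bundle (tangent_bundle N)) (W \<times> UNIV) L"
    and L': "smooth_section N (gen_bundle (tangent_bundle N)) (W \<times> UNIV) L'"
    and u: "\<And>x v. x \<in> W \<Longrightarrow> L (x, v) = Finv (x, v) (u x)" "\<And>x. x \<in> W \<Longrightarrow> J x (u x) = incl_T (a x)"
    and u': "\<And>x v. x \<in> W \<Longrightarrow> L' (x, v) = Finv (x, v) (u' x)" "\<And>x. x \<in> W \<Longrightarrow> J x (u' x) = incl_T (b x)"
    and 0: "courant N L L' (p, 0) = 0"
    and 1: "courant N (hor a) L' (p, 0) = Finv (p, 0) n" "courant N L (hor b) (p, 0) = Finv (p, 0) n'"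
  shows "J p (n + n') = incl_T (courant M a b p)"
proof -
  let ?GN = "gen_bundle (tangent_bundle N)" and ?E = "plus_i_eigenbundle \<J>"
  note pts = subsetD[OF openin_subset_points[OF W(1)]]
  note oN = openin_total_space[OF W(1)]
  have sec: "section_of N (sum_bundle ?GN ?GN) ?E (W \<times> UNIV) (\<lambda>q. (hor a q, L q))"
    if "smooth_section M (gen_bundle TM) W a" "smooth_section N ?GN (W \<times> UNIV) L"
      and u: "\<And>x v. x \<in> W \<Longrightarrow> L (x, v) = Finv (x, v) (u x)" "\<And>x. x \<in> W \<Longrightarrow> J x (u x) = incl_T (a x)" for a L u
    unfolding section_of_def
  proof (intro conjI ballI)
    show "smooth_section N (sum_bundle ?GN ?GN) (W \<times> UNIV) (\<lambda>q. (hor a q, L q))"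
      unfolding N.smooth_section_sum_bundle_iff[OF gen_bundle_N gen_bundle_N oN]
      using smooth_hor[OF W that(1)] that(2) by simp
    fix q :: "'m \<times> 'v" assume "q \<in> W \<times> UNIV"
    then obtain x v where q: "q = (x, v)" "x \<in> W" by auto
    \<comment> \<open>With J u = a this is the second half of the eigenvalue equation for a + i
      u.\<close>
    have "J x (incl_T (a x)) = - u x" using J_J[OF pts[OF q(2)], of "u x"] u(2)[OF q(2)] by simp
    then show "(hor a q, L q) \<in> ?E q"
      using total_J[OF pts[OF q(2)], of v] u[OF q(2)]
      by (simp add: plus_i_eigenbundle_def q(1) hor_eq_Finv[OF pts[OF q(2)]] Finv_minus[OF pts[OF q(2)]])
  qed
  let ?z = "\<lambda>q. (hor a q, L q)" and ?z' = "\<lambda>q. (hor b q, L' q)"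
  have int: "integrable_gac N \<J>" using semi_flat unfolding semi_flat_gc_def by blast
  have "section_of N (sum_bundle ?GN ?GN) ?E (W \<times> UNIV) (courant_cplx N ?z ?z')"
    using int[unfolded integrable_gac_def Let_def, rule_format, of "W \<times> UNIV" ?z ?z'] oN
      sec[OF a L u] sec[OF b L' u'] by blast
  then have "courant_cplx N ?z ?z' (p, 0) \<in> ?E (p, 0)"
    using W(2) unfolding section_of_def by blast
  moreover have "courant_cplx N ?z ?z' (p, 0) =
      (courant N (hor a) (hor b) (p, 0) - courant N L L' (p, 0), courant N (hor a) L' (p, 0) + courant N L (hor b) (p, 0))"
    by (simp add: courant_cplx_def Let_def comp_def)
  \<comment> \<open>The imaginary part is sent to the real part, which is the lift of the bracket on
    the base because the bracket of L and L' vanishes.\<close>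
  ultimately have "\<J> (p, 0) (Finv (p, 0) n + Finv (p, 0) n') = hor (\<lambda>_. courant M a b p) (p, 0)"
    unfolding 0 1 courant_hor_hor[OF W a b] by (simp add: plus_i_eigenbundle_def)
  then have "Finv (p, 0) (J p (n + n')) = Finv (p, 0) (incl_T (courant M a b p))"
    using total_J[OF pts[OF W(2)], of 0 "n + n'"] by (simp add: Finv_add[OF pts[OF W(2)]] hor_eq_Finv[OF pts[OF W(2)]])
  then show ?thesis by (rule Finv_inj[OF pts[OF W(2)]])
qed

section \<open>Smooth inclusions, restrictions and projections of the summands\<close>

lemma G_section_iff:
  assumes "openin (man_topology M) U"
  shows "smooth_section M G U y \<longleftrightarrow> smooth_section M V U (\<lambda>x. fst (fst (y x))) \<and>
    smooth_section M TM U (\<lambda>x. snd (fst (y x))) \<and> smooth_section M (dual_bundle (sum_bundle V TM)) U (\<lambda>x. snd (y x))"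
  unfolding smooth_section_sum_bundle_iff[OF VT smooth_bundle_dual[OF VT] assms]
    smooth_section_sum_bundle_iff[OF vbundle smooth_bundle_tangent assms] by blast

lemma smooth_dual_sum_frame:
  assumes U: "openin (man_topology M) U" and r: "(U', r) \<in> sum_bundle V TM"
  shows "openin (man_topology M) (U \<inter> U')" "smooth_section M V (U \<inter> U') (\<lambda>x. fst (inv (r x) w))"
    "smooth_section M TM (U \<inter> U') (\<lambda>x. snd (inv (r x) w))"
proof -
  show o: "openin (man_topology M) (U \<inter> U')" using U smooth_bundle_triv(1)[OF VT r] by blast
  have "smooth_section M (sum_bundle V TM) (U \<inter> U') (\<lambda>x. inv (r x) w)"
    by (rule smooth_section_subset[OF smooth_bundle_triv(4)[OF VT r]]) blast
  then show "smooth_section M V (U \<inter> U') (\<lambda>x. fst (inv (r x) w))" "smooth_section M TM (U \<inter> U') (\<lambda>x. snd (inv (r x) w))"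
    unfolding smooth_section_sum_bundle_iff[OF vbundle smooth_bundle_tangent o] by auto
qed

lemma smooth_dual_sum:
  assumes U: "openin (man_topology M) U"
  shows "smooth_section M (dual_bundle V) U f \<Longrightarrow> smooth_section M (dual_bundle (sum_bundle V TM)) U (\<lambda>x. f x o\<^sub>L fst_blinfun)"
    and "smooth_section M (dual_bundle TM) U \<xi> \<Longrightarrow> smooth_section M (dual_bundle (sum_bundle V TM)) U (\<lambda>x. \<xi> x o\<^sub>L snd_blinfun)"
proof -
  assume f: "smooth_section M (dual_bundle V) U f"
  show "smooth_section M (dual_bundle (sum_bundle V TM)) U (\<lambda>x. f x o\<^sub>L fst_blinfun)"
  proof (rule smooth_section_dualI[OF VT U])
    fix U' r w assume r: "(U', r) \<in> sum_bundle V TM"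
    note sf = smooth_dual_sum_frame[OF U r]
    have "smooth_map M (U \<inter> U') (\<lambda>x. f x (fst (inv (r x) w)))"
      by (rule smooth_section_dual_apply[OF vbundle sf(1) smooth_section_subset[OF f] sf(2)]) blast
    then show "smooth_map M (U \<inter> U') (\<lambda>x. (f x o\<^sub>L fst_blinfun) (inv (r x) w))" by (simp add: fst_blinfun.rep_eq)
  qed
next
  assume f: "smooth_section M (dual_bundle TM) U \<xi>"
  show "smooth_section M (dual_bundle (sum_bundle V TM)) U (\<lambda>x. \<xi> x o\<^sub>L snd_blinfun)"
  proof (rule smooth_section_dualI[OF VT U])
    fix U' r w assume r: "(U', r) \<in> sum_bundle V TM"
    note sf = smooth_dual_sum_frame[OF U r]
    have "smooth_map M (U \<inter> U') (\<lambda>x. \<xi> x (snd (inv (r x) w)))"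
      by (rule smooth_section_dual_apply[OF smooth_bundle_tangent sf(1) smooth_section_subset[OF f] sf(3)]) blast
    then show "smooth_map M (U \<inter> U') (\<lambda>x. (\<xi> x o\<^sub>L snd_blinfun) (inv (r x) w))" by (simp add: snd_blinfun.rep_eq)
  qed
qed

lemma smooth_dual_restrict:
  assumes U: "openin (man_topology M) U" and \<zeta>: "smooth_section M (dual_bundle (sum_bundle V TM)) U \<zeta>"
  shows "smooth_section M (dual_bundle V) U (\<lambda>x. \<zeta> x o\<^sub>L Blinfun (\<lambda>v. (v, 0)))"
    and "smooth_section M (dual_bundle TM) U (\<lambda>x. \<zeta> x o\<^sub>L Blinfun (Pair 0))"
proof -
  show "smooth_section M (dual_bundle V) U (\<lambda>x. \<zeta> x o\<^sub>L Blinfun (\<lambda>v. (v, 0)))"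
  proof (rule smooth_section_dualI[OF vbundle U])
    fix U' t w assume t: "(U', t) \<in> V"
    have o: "openin (man_topology M) (U \<inter> U')" using U triv(1)[OF t] by blast
    have "smooth_section M (sum_bundle V TM) (U \<inter> U') (\<lambda>x. (inv (t x) w, 0))"
      unfolding smooth_section_sum_bundle_iff[OF vbundle smooth_bundle_tangent o]
      using smooth_section_subset[OF triv(4)[OF t]] smooth_section_zero[OF smooth_bundle_tangent o] by simp
    from smooth_section_dual_apply[OF VT o smooth_section_subset[OF \<zeta>] this]
    show "smooth_map M (U \<inter> U') (\<lambda>x. (\<zeta> x o\<^sub>L Blinfun (\<lambda>v. (v, 0))) (inv (t x) w))"
      by (simp add: bounded_linear_Blinfun_apply[OF bounded_linear_Pair_0(2)])
  qed
  show "smooth_section M (dual_bundle TM) U (\<lambda>x. \<zeta> x o\<^sub>L Blinfun (Pair 0))"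
  proof (rule smooth_section_dualI[OF smooth_bundle_tangent U])
    fix U' t w assume t: "(U', t) \<in> TM"
    note bt = smooth_bundle_triv[OF smooth_bundle_tangent t]
    have o: "openin (man_topology M) (U \<inter> U')" using U bt(1) by blast
    have "smooth_section M (sum_bundle V TM) (U \<inter> U') (\<lambda>x. (0, inv (t x) w))"
      unfolding smooth_section_sum_bundle_iff[OF vbundle smooth_bundle_tangent o]
      using smooth_section_subset[OF bt(4)] smooth_section_zero[OF vbundle o] by simp
    from smooth_section_dual_apply[OF VT o smooth_section_subset[OF \<zeta>] this]
    show "smooth_map M (U \<inter> U') (\<lambda>x. (\<zeta> x o\<^sub>L Blinfun (Pair 0)) (inv (t x) w))"
      by (simp add: bounded_linear_Blinfun_apply[OF bounded_linear_Pair_0(1)])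
  qed
qed

lemma smooth_incl_T:
  assumes U: "openin (man_topology M) U" and a: "smooth_section M (gen_bundle TM) U a"
  shows "smooth_section M G U (\<lambda>x. incl_T (a x))"
  using a[unfolded gen_section_iff[OF U]] smooth_dual_sum(2)[OF U] smooth_section_zero[OF vbundle U]
  unfolding G_section_iff[OF U] by (simp add: incl_T_def case_prod_beta vector_field_def)

lemma smooth_proj_T:
  assumes U: "openin (man_topology M) U" and y: "smooth_section M G U y"
  shows "smooth_section M (gen_bundle TM) U (\<lambda>x. proj_T (y x))"
  using y[unfolded G_section_iff[OF U]] smooth_dual_restrict(2)[OF U]
  unfolding gen_section_iff[OF U] by (simp add: proj_T_def vector_field_def)

text \<open>The argument for $\Delta$ and $\widehat\Delta$ is the same: \<open>\<iota>\<close> is the inclusion of $V$ or $V^\vee$,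
  and \<open>\<kappa>\<close> the corresponding projection.\<close>

lemma dirac_half:
  fixes B :: "('m, 'b::finite_coords) triv set"
    and \<iota> :: "'b \<Rightarrow> ('v \<times> 'e) \<times> (('v \<times> 'e) \<Rightarrow>\<^sub>L real)" and \<kappa> :: "('v \<times> 'e) \<times> (('v \<times> 'e) \<Rightarrow>\<^sub>L real) \<Rightarrow> 'b"
  defines "\<Phi> \<equiv> \<lambda>p v. inv incl_T (J p (\<iota> v))" and "E \<equiv> \<lambda>p. incl_T -` (J p ` range \<iota>)"
  assumes B: "smooth_bundle M B" and \<iota>: "linear \<iota>" and \<kappa>: "linear \<kappa>" and \<kappa>\<iota>: "\<And>v. \<kappa> (\<iota> v) = v"
    and rng: "\<And>p v. p \<in> points M \<Longrightarrow> J p (\<iota> v) \<in> range incl_T"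
    and iso: "\<And>v w. pairing (\<iota> v) (\<iota> w) = 0"
    and max: "\<And>v f. (\<And>w. pairing (incl_V v + incl_Vdual f) (\<iota> w) = 0) \<Longrightarrow> incl_V v + incl_Vdual f \<in> range \<iota>"
    and sm\<iota>: "\<And>U s. openin (man_topology M) U \<Longrightarrow> smooth_section M B U s \<Longrightarrow> smooth_section M G U (\<lambda>x. \<iota> (s x))"
    and sm\<kappa>: "\<And>U y. openin (man_topology M) U \<Longrightarrow> smooth_section M G U y \<Longrightarrow> smooth_section M B U (\<lambda>x. \<kappa> (y x))"
    and nab': "flat_connection M B (\<lambda>_. UNIV) nab'"
    and key: "\<And>U p a b s s'. openin (man_topology M) U \<Longrightarrow> p \<in> U \<Longrightarrow>
      smooth_section M (gen_bundle TM) U a \<Longrightarrow> smooth_section M (gen_bundle TM) U b \<Longrightarrow>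
      smooth_section M B U s \<Longrightarrow> smooth_section M B U s' \<Longrightarrow>
      (\<And>x. x \<in> U \<Longrightarrow> J x (\<iota> (s x)) = incl_T (a x)) \<Longrightarrow> (\<And>x. x \<in> U \<Longrightarrow> J x (\<iota> (s' x)) = incl_T (b x)) \<Longrightarrow>
      J p (\<iota> (nab' s' p (fst (a p)) - nab' s p (fst (b p)))) = incl_T (courant M a b p)"
  shows "dirac M E" and "bundle_iso_onto M B (gen_bundle TM) E \<Phi>"
    and "flat_connection M (gen_bundle TM) E (transport_conn \<Phi> nab')"
proof -
  have J\<iota>: "J p (\<iota> v) = incl_T (\<Phi> p v)" if "p \<in> points M" for p v
    using rng[OF that, of v] unfolding \<Phi>_def by (simp add: f_inv_into_f)
  \<comment> \<open>In this form \<Phi> is a composition of linear, smooth maps defined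
    everywhere.\<close>
  have \<Phi>_proj: "\<Phi> p v = proj_T (J p (\<iota> v))" if "p \<in> points M" for p v
    using rng[OF that] unfolding \<Phi>_def by (rule inv_incl_T)
  have \<Phi>_inj: "v = w" if p: "p \<in> points M" and eq: "\<Phi> p v = \<Phi> p w" for p v w
  proof -
    have "J p (\<iota> v) = J p (\<iota> w)" using eq by (simp add: J\<iota>[OF p])
    then have "\<iota> v = \<iota> w" by (rule J_inj[OF p])
    then show ?thesis using \<kappa>\<iota> by metis
  qed
  have E: "E p = range (\<Phi> p)" if p: "p \<in> points M" for p
  proof (intro set_eqI iffI)
    fix a assume "a \<in> E p"
    then obtain v where "incl_T a = J p (\<iota> v)" unfolding E_def by auto
    then have "incl_T a = (incl_T (\<Phi> p v) :: ('v \<times> 'e) \<times> (('v \<times> 'e) \<Rightarrow>\<^sub>L real))" by (simp add: J\<iota>[OF p])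
    then show "a \<in> range (\<Phi> p)" using incl_T_inj by blast
  next
    fix a assume "a \<in> range (\<Phi> p)"
    then show "a \<in> E p" unfolding E_def using J\<iota>[OF p] by (metis (no_types, lifting) imageE rangeI vimageI imageI)
  qed
  have lin\<Phi>: "linear (\<Phi> p)" if p: "p \<in> points M" for p
  proof -
    have "\<Phi> p = proj_T \<circ> (J p \<circ> \<iota>)" using \<Phi>_proj[OF p] by auto
    then show ?thesis using linear_compose[OF linear_compose[OF \<iota> linear_J[OF p]] linear_proj_T] by simp
  qed
  have sm\<Phi>: "smooth_section M (gen_bundle TM) U (\<lambda>x. \<Phi> x (s x))"
    if U: "openin (man_topology M) U" and s: "smooth_section M B U s" for U s
    by (rule smooth_section_transform[OF gen_bundle_M U
          smooth_proj_T[OF U smooth_hom_apply[OF G_bundle G_bundle J_hom U sm\<iota>[OF U s]]]])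
      (simp add: \<Phi>_proj[OF subsetD[OF openin_subset_points[OF U]]])
  have hom: "smooth_hom M B (gen_bundle TM) \<Phi>"
    by (rule smooth_homI[OF B lin\<Phi> sm\<Phi>])
  show isoE: "bundle_iso_onto M B (gen_bundle TM) E \<Phi>"
    unfolding bundle_iso_onto_def using hom \<Phi>_inj E by (auto simp: bij_betw_def inj_on_def)
  \<comment> \<open>As the square of J is -1, the inverse on \<open>E p\<close> is -J followed by
    \<kappa>. This expression is smooth, which supplies the hypothesis of
    \<open>flat_connection_transport\<close>.\<close>
  have inv\<Phi>: "inv (\<Phi> p) a = \<kappa> (- J p (incl_T a))" "\<Phi> p (inv (\<Phi> p) a) = a"
    if p: "p \<in> points M" and a: "a \<in> E p" for p a
  proof -
    obtain v where v: "a = \<Phi> p v" using a E[OF p] by blast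
    have i: "inv (\<Phi> p) a = v" unfolding v using \<Phi>_inj[OF p] by (intro inv_f_f injI)
    show "\<Phi> p (inv (\<Phi> p) a) = a" unfolding i by (rule v[symmetric])
    have "J p (incl_T a) = - \<iota> v" using J_J[OF p, of "\<iota> v"] by (simp add: v J\<iota>[OF p])
    then show "inv (\<Phi> p) a = \<kappa> (- J p (incl_T a))" by (simp add: i \<kappa>\<iota>)
  qed
  have inv_smooth: "smooth_section M B U (\<lambda>q. inv (\<Phi> q) (\<delta> q))"
    if U: "openin (man_topology M) U" and \<delta>: "section_of M (gen_bundle TM) E U \<delta>" for U \<delta>
  proof (rule smooth_section_transform[OF B U])
    have "smooth_section M (gen_bundle TM) U \<delta>" using \<delta> unfolding section_of_def by blast
    then show "smooth_section M B U (\<lambda>q. \<kappa> (- J q (incl_T (\<delta> q))))"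
      by (intro sm\<kappa>[OF U] smooth_section_minus[OF G_bundle U] smooth_hom_apply[OF G_bundle G_bundle J_hom U]
          smooth_incl_T[OF U])
    show "\<kappa> (- J q (incl_T (\<delta> q))) = inv (\<Phi> q) (\<delta> q)" if "q \<in> U" for q
      using inv\<Phi>(1)[of q "\<delta> q"] that \<delta> openin_subset_points[OF U] unfolding section_of_def by auto
  qed
  show "flat_connection M (gen_bundle TM) E (transport_conn \<Phi> nab')"
    by (rule flat_connection_transport[OF B gen_bundle_M isoE inv_smooth nab'])
  have maximal: "maximally_isotropic (E p)" if p: "p \<in> points M" for p
    unfolding maximally_isotropic_def isotropic_def
  proof (intro conjI ballI allI impI)
    show "subspace (E p)" unfolding E[OF p] using linear_subspace_image[OF lin\<Phi>[OF p] subspace_UNIV] .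
    have pr: "pairing a (\<Phi> p w) = pairing u (\<iota> w)" if "incl_T a = J p u" for a u w
    proof -
      have "pairing a (\<Phi> p w) = pairing (J p u) (J p (\<iota> w))"
        unfolding J\<iota>[OF p] that[symmetric] by (rule pairing_incl_T[symmetric])
      then show ?thesis by (simp add: J_pairing[OF p])
    qed
    fix a b assume "a \<in> E p" "b \<in> E p"
    then obtain v w where "a = \<Phi> p v" "b = \<Phi> p w" unfolding E[OF p] by blast
    then show "pairing a b = 0" using pr[OF J\<iota>[OF p, symmetric], of v w] iso by simp
  next
    fix T assume T: "(subspace T \<and> (\<forall>a\<in>T. \<forall>b\<in>T. pairing a b = 0)) \<and> E p \<subseteq> T"
    \<comment> \<open>By adaptedness a is the image under J of some v + f. Since J is orthogonal and
      T is isotropic and contains \<open>E p\<close>, v + f is orthogonal to the range of \<iota>,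
      and \<open>max\<close> places it there.\<close>
    have "a \<in> E p" if a: "a \<in> T" for a
    proof -
      have "incl_T a \<in> J p ` {incl_V v + incl_Vdual f |v f. True}" unfolding J_adapted[OF p] by blast
      then obtain v f where vf: "incl_T a = J p (incl_V v + incl_Vdual f)" by blast
      have "pairing (incl_V v + incl_Vdual f) (\<iota> w) = 0" for w
      proof -
        have "pairing (incl_V v + incl_Vdual f) (\<iota> w) = pairing (J p (incl_V v + incl_Vdual f)) (J p (\<iota> w))"
          by (rule J_pairing[OF p, symmetric])
        also have "\<dots> = pairing a (\<Phi> p w)" unfolding vf[symmetric] J\<iota>[OF p] by (rule pairing_incl_T)
        also have "\<dots> = 0" using T a E[OF p] by blast
        finally show ?thesis .
      qed
      then have "incl_V v + incl_Vdual f \<in> range \<iota>" by (rule max)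
      then show ?thesis unfolding E_def using vf by auto
    qed
    then show "T = E p" using T by blast
  qed
  have closed: "section_of M (gen_bundle TM) E U (courant M a b)"
    if U: "openin (man_topology M) U" and a: "section_of M (gen_bundle TM) E U a"
      and b: "section_of M (gen_bundle TM) E U b" for U a b
  proof -
    note pts = subsetD[OF openin_subset_points[OF U]]
    define s where "s = (\<lambda>q. inv (\<Phi> q) (a q))"
    define s' where "s' = (\<lambda>q. inv (\<Phi> q) (b q))"
    have sm: "smooth_section M B U s" "smooth_section M B U s'"
      unfolding s_def s'_def by (rule inv_smooth[OF U a], rule inv_smooth[OF U b])
    have sa: "smooth_section M (gen_bundle TM) U a" "smooth_section M (gen_bundle TM) U b"
      and Ea: "x \<in> U \<Longrightarrow> a x \<in> E x" "x \<in> U \<Longrightarrow> b x \<in> E x" for x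
      using a b unfolding section_of_def by auto
    have Js: "J x (\<iota> (s x)) = incl_T (a x)" "J x (\<iota> (s' x)) = incl_T (b x)" if "x \<in> U" for x
      using J\<iota>[OF pts[OF that]] inv\<Phi>(2)[OF pts[OF that] Ea(1)[OF that]] inv\<Phi>(2)[OF pts[OF that] Ea(2)[OF that]]
      by (auto simp: s_def s'_def)
    let ?n = "\<lambda>p. nab' s' p (fst (a p)) - nab' s p (fst (b p))"
    have conn': "connection M B (\<lambda>_. UNIV) nab'" using nab' unfolding flat_connection_def by blast
    have vf: "vector_field M U (\<lambda>x. fst (a x))" "vector_field M U (\<lambda>x. fst (b x))"
      using sa unfolding gen_section_iff[OF U] by auto
    have n: "smooth_section M B U ?n"
      using connectionD(2)[OF conn' U, unfolded section_of_UNIV, OF sm(2) vf(1)]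
        connectionD(2)[OF conn' U, unfolded section_of_UNIV, OF sm(1) vf(2)]
      by (rule smooth_section_diff[OF B U])
    have eq: "\<Phi> p (?n p) = courant M a b p" if "p \<in> U" for p
    proof -
      have "incl_T (\<Phi> p (?n p)) = (incl_T (courant M a b p) :: ('v \<times> 'e) \<times> (('v \<times> 'e) \<Rightarrow>\<^sub>L real))"
        using key[OF U that sa sm Js] J\<iota>[OF pts[OF that], of "?n p"] by simp
      then show ?thesis by (rule incl_T_inj)
    qed
    show ?thesis
      unfolding section_of_def
    proof (intro conjI ballI)
      show "smooth_section M (gen_bundle TM) U (courant M a b)"
        by (rule smooth_section_transform[OF gen_bundle_M U sm\<Phi>[OF U n] eq])
      show "courant M a b p \<in> E p" if "p \<in> U" for p
        unfolding eq[OF that, symmetric] E[OF pts[OF that]] by blast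
    qed
  qed
  show "dirac M E"
    unfolding dirac_def almost_dirac_def Let_def
    using bundle_iso_onto_subbundle[OF B isoE] maximal closed by blast
qed

lemma incl_V_Vdual_in_range:
  "p \<in> points M \<Longrightarrow> J p (incl_V v) \<in> range incl_T" "p \<in> points M \<Longrightarrow> J p (incl_Vdual f) \<in> range incl_T"
proof -
  assume p: "p \<in> points M"
  have 0: "incl_V v + incl_Vdual 0 = incl_V v" "incl_V 0 + incl_Vdual f = incl_Vdual f"
    by (auto simp: incl_V_def incl_Vdual_def)
  have "J p (incl_V v + incl_Vdual f) \<in> range incl_T" for v f
    unfolding J_adapted[OF p, symmetric] by blast
  from this[of v 0] this[of 0 f] show "J p (incl_V v) \<in> range incl_T" "J p (incl_Vdual f) \<in> range incl_T"
    unfolding 0 .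
qed

end

lemma linear_incl_V: "linear incl_V"
  by (rule linearI) (auto simp: incl_V_def)

lemma linear_incl_Vdual: "linear incl_Vdual"
  by (rule linearI) (auto intro!: blinfun_eqI simp: incl_Vdual_def blinfun.add_left blinfun.scaleR_left)

lemma pairing_incl:
  "pairing (incl_V v + incl_Vdual f) (incl_V w) = - (1/2) * f w"
  "pairing (incl_V v + incl_Vdual f) (incl_Vdual g) = - (1/2) * g v"
  by (simp_all add: pairing_def incl_V_def incl_Vdual_def fst_blinfun.rep_eq)

lemma pairing_incl_self: "pairing (incl_V v) (incl_V w) = 0" "pairing (incl_Vdual f) (incl_Vdual g) = 0"
  by (simp_all add: pairing_def incl_V_def incl_Vdual_def fst_blinfun.rep_eq)

section \<open>The two Dirac structures and their transversality\<close>

context semi_flat begin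

lemma Delta_dirac:
  assumes "flat_connection M V (\<lambda>_. UNIV) nab"
  shows "dirac M (Delta J)" "bundle_iso_onto M V (gen_bundle TM) (Delta J) (J_V J)"
    "flat_connection M (gen_bundle TM) (Delta J) (transport_conn (J_V J) nab)"
proof -
  have eq: "(\<lambda>p. incl_T -` (J p ` range incl_V)) = Delta J" "(\<lambda>p v. inv incl_T (J p (incl_V v))) = J_V J"
    by (auto simp: fun_eq_iff Delta_def J_V_def)
  \<comment> \<open>V is its own orthogonal complement inside the sum of V and its dual: f vanishes
    once it pairs to 0 with every w.\<close>
  have max: "(incl_V v + incl_Vdual f :: ('v \<times> 'e) \<times> (('v \<times> 'e) \<Rightarrow>\<^sub>L real)) \<in> range incl_V"
    if "\<And>w. pairing (incl_V v + incl_Vdual f) (incl_V w :: ('v \<times> 'e) \<times> (('v \<times> 'e) \<Rightarrow>\<^sub>L real)) = 0" for v :: 'v and f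
  proof -
    have "f = 0" using that unfolding pairing_incl by (intro blinfun_eqI) simp
    then have "incl_V v + incl_Vdual f = (incl_V v :: ('v \<times> 'e) \<times> (('v \<times> 'e) \<Rightarrow>\<^sub>L real))"
      by (simp add: linear_0[OF linear_incl_Vdual])
    then show ?thesis by (rule range_eqI)
  qed
  have sm\<iota>: "smooth_section M G U (\<lambda>x. incl_V (s x))" if U: "openin (man_topology M) U" and "smooth_section M V U s" for U s
    unfolding G_section_iff[OF U] using that smooth_section_zero[OF smooth_bundle_tangent U] smooth_section_zero[OF smooth_bundle_dual[OF VT] U]
    by (simp add: incl_V_def)
  have sm\<kappa>: "smooth_section M V U (\<lambda>x. fst (fst (y x)))" if "openin (man_topology M) U" "smooth_section M G U y" for U y
    using that(2) unfolding G_section_iff[OF that(1)] by blast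
  have \<kappa>\<iota>: "fst (fst (incl_V v :: ('v \<times> 'e) \<times> (('v \<times> 'e) \<Rightarrow>\<^sub>L real))) = v" for v :: 'v
    by (simp add: incl_V_def)
  have key: "J p (incl_V (nab s' p (fst (a p)) - nab s p (fst (b p)))) = incl_T (courant M a b p)"
    if U: "openin (man_topology M) U" and p: "p \<in> U"
      and a: "smooth_section M (gen_bundle TM) U a" and b: "smooth_section M (gen_bundle TM) U b"
      and s: "smooth_section M V U s" and s': "smooth_section M V U s'"
      and Ja: "\<And>x. x \<in> U \<Longrightarrow> J x (incl_V (s x)) = incl_T (a x)" and Jb: "\<And>x. x \<in> U \<Longrightarrow> J x (incl_V (s' x)) = incl_T (b x)"
    for U p a b s s'
  proof -
    note pts = subsetD[OF openin_subset_points[OF U]]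
    \<comment> \<open>The minus sign comes from the mixed bracket with the vertical lift as first
      argument.\<close>
    have "J p (incl_V (nab s' p (fst (a p))) + incl_V (- nab s p (fst (b p)))) = incl_T (courant M a b p)"
      by (rule bracket_relation[OF U p a b smooth_ver[OF U p s] smooth_ver[OF U p s'] ver_eq_Finv[OF pts] Ja ver_eq_Finv[OF pts] Jb
            courant_ver_ver[OF U p s s']])
        (simp_all add: courant_hor_ver[OF U p a s'] courant_hor_ver[OF U p b s] ver_eq_Finv[OF pts[OF p]])
    then show ?thesis by (simp add: linear_add[OF linear_incl_V, symmetric])
  qed
  note half = dirac_half[OF vbundle linear_incl_V linear_compose[OF linear_fst linear_fst, unfolded comp_def] \<kappa>\<iota>
      incl_V_Vdual_in_range(1) pairing_incl_self(1) max sm\<iota> sm\<kappa> assms key, unfolded eq]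
  show "dirac M (Delta J)" by (rule half(1))
  show "bundle_iso_onto M V (gen_bundle TM) (Delta J) (J_V J)" by (rule half(2))
  show "flat_connection M (gen_bundle TM) (Delta J) (transport_conn (J_V J) nab)" by (rule half(3))
qed

lemma Delta_hat_dirac:
  assumes flat: "flat_connection M V (\<lambda>_. UNIV) nab"
  shows "dirac M (Delta_hat J)" "bundle_iso_onto M (dual_bundle V) (gen_bundle TM) (Delta_hat J) (J_Vdual J)"
    "flat_connection M (gen_bundle TM) (Delta_hat J) (transport_conn (J_Vdual J) (dual_conn M V nab))"
proof -
  let ?\<kappa> = "\<lambda>y::('v \<times> 'e) \<times> (('v \<times> 'e) \<Rightarrow>\<^sub>L real). snd y o\<^sub>L Blinfun (\<lambda>v. (v, 0))"
  have eq: "(\<lambda>p. incl_T -` (J p ` range incl_Vdual)) = Delta_hat J" "(\<lambda>p v. inv incl_T (J p (incl_Vdual v))) = J_Vdual J"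
    by (auto simp: fun_eq_iff Delta_hat_def J_Vdual_def)
  have \<kappa>: "linear ?\<kappa>"
    by (rule linearI) (auto intro!: blinfun_eqI simp: blinfun.add_left blinfun.scaleR_left)
  have \<kappa>\<iota>: "?\<kappa> (incl_Vdual f) = f" for f
    by (rule blinfun_eqI) (simp add: incl_Vdual_def fst_blinfun.rep_eq bounded_linear_Blinfun_apply[OF bounded_linear_Pair_0(2)])
  have max: "(incl_V v + incl_Vdual f :: ('v \<times> 'e) \<times> (('v \<times> 'e) \<Rightarrow>\<^sub>L real)) \<in> range incl_Vdual"
    if "\<And>g. pairing (incl_V v + incl_Vdual f) (incl_Vdual g :: ('v \<times> 'e) \<times> (('v \<times> 'e) \<Rightarrow>\<^sub>L real)) = 0" for v :: 'v and f
  proof -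
    \<comment> \<open>The functional given by the inner product with v detects v: its value there is
      the square of the norm.\<close>
    have "blinfun_apply (Blinfun (\<lambda>x. x \<bullet> v)) v = 0"
      using that[of "Blinfun (\<lambda>x. x \<bullet> v)"] unfolding pairing_incl by simp
    then have "v = 0" by (simp add: bounded_linear_Blinfun_apply[OF bounded_linear_inner_left])
    then have "incl_V v + incl_Vdual f = (incl_Vdual f :: ('v \<times> 'e) \<times> (('v \<times> 'e) \<Rightarrow>\<^sub>L real))"
      by (simp add: linear_0[OF linear_incl_V])
    then show ?thesis by (rule range_eqI)
  qed
  have sm\<iota>: "smooth_section M G U (\<lambda>x. incl_Vdual (f x))"
    if U: "openin (man_topology M) U" and "smooth_section M (dual_bundle V) U f" for U f
    unfolding G_section_iff[OF U] using that smooth_section_zero[OF smooth_bundle_tangent U] smooth_section_zero[OF vbundle U]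
      smooth_dual_sum(1)[OF U]
    by (simp add: incl_Vdual_def)
  have sm\<kappa>: "smooth_section M (dual_bundle V) U (\<lambda>x. ?\<kappa> (y x))" if "openin (man_topology M) U" "smooth_section M G U y" for U y
    using that(2) smooth_dual_restrict(1)[OF that(1)] unfolding G_section_iff[OF that(1)] by blast
  let ?D = "dual_conn M V nab"
  have key: "J p (incl_Vdual (?D s' p (fst (a p)) - ?D s p (fst (b p)))) = incl_T (courant M a b p)"
    if U: "openin (man_topology M) U" and p: "p \<in> U"
      and a: "smooth_section M (gen_bundle TM) U a" and b: "smooth_section M (gen_bundle TM) U b"
      and s: "smooth_section M (dual_bundle V) U s" and s': "smooth_section M (dual_bundle V) U s'"
      and Ja: "\<And>x. x \<in> U \<Longrightarrow> J x (incl_Vdual (s x)) = incl_T (a x)" and Jb: "\<And>x. x \<in> U \<Longrightarrow> J x (incl_Vdual (s' x)) = incl_T (b x)"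
    for U p a b s s'
  proof -
    note pts = subsetD[OF openin_subset_points[OF U]]
    have "J p (incl_Vdual (?D s' p (fst (a p))) + incl_Vdual (- ?D s p (fst (b p)))) = incl_T (courant M a b p)"
      by (rule bracket_relation[OF U p a b smooth_ver_dual[OF U p s] smooth_ver_dual[OF U p s'] ver_dual_eq_Finv[OF pts] Ja ver_dual_eq_Finv[OF pts] Jb
            courant_ver_dual_ver_dual[OF U p s s']])
        (simp_all add: courant_hor_ver_dual[OF U p a s'] courant_hor_ver_dual[OF U p b s] ver_dual_eq_Finv[OF pts[OF p]])
    then show ?thesis by (simp add: linear_add[OF linear_incl_Vdual, symmetric])
  qed
  note half = dirac_half[OF smooth_bundle_dual[OF vbundle] linear_incl_Vdual \<kappa> \<kappa>\<iota>
      incl_V_Vdual_in_range(2) pairing_incl_self(2) max sm\<iota> sm\<kappa> dual_conn_flat_connection[OF vbundle flat] key, unfolded eq]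
  show "dirac M (Delta_hat J)" by (rule half(1))
  show "bundle_iso_onto M (dual_bundle V) (gen_bundle TM) (Delta_hat J) (J_Vdual J)" by (rule half(2))
  show "flat_connection M (gen_bundle TM) (Delta_hat J) (transport_conn (J_Vdual J) ?D)" by (rule half(3))
qed

text \<open>J is injective and, by adaptedness, carries the direct sum of V and its dual onto
  $T_M\<oplus>T_M^\<or>$, so the decomposition is transported.\<close>

lemma Delta_transverse:
  assumes p: "p \<in> points M"
  shows "Delta J p \<inter> Delta_hat J p = {0}" "{a + b |a b. a \<in> Delta J p \<and> b \<in> Delta_hat J p} = UNIV"
proof -
  note lJ = linear_J[OF p]
  have "a = 0" if a: "a \<in> Delta J p" "a \<in> Delta_hat J p" for a
  proof -
    obtain v f where vf: "incl_T a = J p (incl_V v)" "incl_T a = J p (incl_Vdual f)"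
      using a unfolding Delta_def Delta_hat_def by auto
    then have "incl_V v = (incl_Vdual f :: ('v \<times> 'e) \<times> (('v \<times> 'e) \<Rightarrow>\<^sub>L real))" using J_inj[OF p] by metis
    then have "v = 0" by (simp add: incl_V_def incl_Vdual_def)
    then have "incl_T a = (incl_T 0 :: ('v \<times> 'e) \<times> (('v \<times> 'e) \<Rightarrow>\<^sub>L real))"
      using vf(1) by (simp add: linear_0[OF linear_incl_V] linear_0[OF linear_incl_T] linear_0[OF lJ])
    then show ?thesis by (rule incl_T_inj)
  qed
  moreover have "0 \<in> Delta J p" "0 \<in> Delta_hat J p"
    unfolding Delta_def Delta_hat_def using linear_0[OF linear_incl_T] linear_0[OF lJ] linear_0[OF linear_incl_V] linear_0[OF linear_incl_Vdual]
    by (metis rangeI imageI vimageI)+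
  ultimately show "Delta J p \<inter> Delta_hat J p = {0}" by blast
  have "\<exists>c d. a = c + d \<and> c \<in> Delta J p \<and> d \<in> Delta_hat J p" for a
  proof -
    have "incl_T a \<in> J p ` {incl_V v + incl_Vdual f |v f. True}" unfolding J_adapted[OF p] by blast
    then obtain v f where vf: "incl_T a = J p (incl_V v + incl_Vdual f)" by blast
    obtain c d where cd: "J p (incl_V v) = incl_T c" "J p (incl_Vdual f) = incl_T d"
      using incl_V_Vdual_in_range[OF p] by blast
    have "incl_T a = (incl_T (c + d) :: ('v \<times> 'e) \<times> (('v \<times> 'e) \<Rightarrow>\<^sub>L real))"
      using vf cd by (simp add: linear_add[OF lJ] linear_add[OF linear_incl_T])
    then have "a = c + d" by (rule incl_T_inj)
    moreover have "c \<in> Delta J p" "d \<in> Delta_hat J p" using cd unfolding Delta_def Delta_hat_def by (metis rangeI imageI vimageI)+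
    ultimately show ?thesis by blast
  qed
  then show "{a + b |a b. a \<in> Delta J p \<and> b \<in> Delta_hat J p} = UNIV" by blast
qed

end

theorem corollary7p7:
  fixes M :: "('m, real ^ 'n) chart set"
    and V :: "('m, real ^ 'n) triv set"
    and nab :: "('m, real ^ 'n, real ^ 'n) conn"
    and J :: "'m \<Rightarrow> ((real ^ 'n) \<times> (real ^ 'n)) \<times> (((real ^ 'n) \<times> (real ^ 'n)) \<Rightarrow>\<^sub>L real)
                 \<Rightarrow> ((real ^ 'n) \<times> (real ^ 'n)) \<times> (((real ^ 'n) \<times> (real ^ 'n)) \<Rightarrow>\<^sub>L real)"
    and \<J> :: "'m \<times> (real ^ 'n) \<Rightarrow> ((real ^ 'n) \<times> (real ^ 'n)) \<times> (((real ^ 'n) \<times> (real ^ 'n)) \<Rightarrow>\<^sub>L real)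
                 \<Rightarrow> ((real ^ 'n) \<times> (real ^ 'n)) \<times> (((real ^ 'n) \<times> (real ^ 'n)) \<Rightarrow>\<^sub>L real)"
  assumes "smooth_manifold M"
    and "vector_bundle M V"
    and "flat_connection M V (\<lambda>_. UNIV) nab"
    and "semi_flat_gc M V nab J \<J>"
  shows "dirac M (Delta J) \<and> dirac M (Delta_hat J) \<and>
    (\<forall>p\<in>points M. Delta J p \<inter> Delta_hat J p = {0} \<and>
       {a + b |a b. a \<in> Delta J p \<and> b \<in> Delta_hat J p} = UNIV) \<and>
    bundle_iso_onto M V (gen_bundle (tangent_bundle M)) (Delta J) (J_V J) \<and>
    bundle_iso_onto M (dual_bundle V) (gen_bundle (tangent_bundle M)) (Delta_hat J) (J_Vdual J) \<and>
    flat_connection M (gen_bundle (tangent_bundle M)) (Delta J) (transport_conn (J_V J) nab) \<and>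
    flat_connection M (gen_bundle (tangent_bundle M)) (Delta_hat J)
      (transport_conn (J_Vdual J) (dual_conn M V nab))"
proof -
  interpret atlas M using assms(1) by (rule smooth_manifold_atlas)
  \<comment> \<open>The locale carries the connection only; flatness is handed separately to the
    lemmas about transported connections.\<close>
  interpret semi_flat M V nab J \<J>
    by unfold_locales
      (use assms vector_bundle_smooth_bundle in \<open>auto simp: flat_connection_def\<close>)
  show ?thesis
    by (intro conjI ballI Delta_dirac[OF assms(3)] Delta_hat_dirac[OF assms(3)] Delta_transverse)
qed

end
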